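(* Let $\mathcal{D}$ be a deformation space (or restricted deformation space) of $G$-trees which is irreducible or genuine abelian. If $\mathcal{D}$ consists of locally finite trees with finitely generated vertex stabilizers, then the Gromov topology and the weak topology coincide on $\mathcal{D}$ and on $P\mathcal{D}$.
   Context: $G$ is a finitely generated group. A $G$-tree is a simplicial tree $T$ with an action of $G$ by simplicial automorphisms without inversions; it is always assumed minimal (no proper $G$-invariant subtree) and without redundant vertex (the only vertices of degree 2 allowed are those $v$ such that some element of $G$ fixes $v$ and exchanges the two adjacent edges). A metric $G$-tree is a $G$-tree with a positive length assigned to each edge, constant on $G$-orbits, so that $G$ acts isometrically. Metric $G$-trees are considered up to equivariant isometry. A subgroup of $G$ is elliptic in $T$ if it fixes a point of $T$. A deformation space $\mathcal{D}$ is the set of all metric $G$-trees having the same elliptic subgroups as a given one. If $\mathcal{A}$ is a family of subgroups of $G$ stable under conjugation and under passing to subgroups, the restricted deformation space $\mathcal{D}_{\mathcal{A}}$ is the set of trees in $\mathcal{D}$ with all edge stabilizers in $\mathcal{A}$. The space is irreducible if in its trees there are two hyperbolic (non-elliptic) elements with disjoint axes; it is genuine abelian if in its trees $G$ fixes an end and the tree is not a line. $P\mathcal{D}$ is the quotient of $\mathcal{D}$ by rescaling, with the quotient topologies. Weak topology. The open cone of $T$ is the set of metric trees obtained by changing the edge lengths of $T$, keeping them positive; with $p$ orbits of edges it is parametrized by $(0,\infty)^p$. Allowing some (not all) lengths to be $0$ (collapsing edges) gives a set parametrized by $[0,\infty)^p\setminus\{0\}$, whose intersection with $\mathcal{D}$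 is a closed cone of $\mathcal{D}$, topologized as a subset of $\mathbb{R}^p$. A subset of $\mathcal{D}$ is closed in the weak topology if its intersection with every closed cone of $\mathcal{D}$ is closed in that cone. Gromov topology. A fundamental system of neighborhoods of $T$ is given by the sets $V_T(X,A,\varepsilon)$, with $X\subset T$ and $A\subset G$ finite and $\varepsilon>0$, where $T'\in V_T(X,A,\varepsilon)$ if and only if there is a map $x\mapsto\tilde x$ from $X$ to $T'$ with $|d(x,gy)-d(\tilde x,g\tilde y)|<\varepsilon$ for all $x,y\in X$, $g\in A$. *)

theory Defs
  imports "HOL-Analysis.Analysis" "HOL-Algebra.Generated_Groups" "HOL-Algebra.Group_Action"
begin

section \<open>Trees\<close>

text \<open>A tree is a nonempty connected graph without circuits. Edges are two-element sets of
  vertices, which loses no generality since a tree has neither loops nor multiple edges.\<close>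

definition is_tree :: "'v set \<Rightarrow> 'v set set \<Rightarrow> bool" where
  "is_tree V E \<longleftrightarrow>
     V \<noteq> {} \<and>
     E \<subseteq> {{u, v} | u v. u \<in> V \<and> v \<in> V \<and> u \<noteq> v} \<and>
     (\<forall>u\<in>V. \<forall>v\<in>V. (u, v) \<in> {(a, b). {a, b} \<in> E}\<^sup>*) \<and>
     \<not> (\<exists>(n::nat) p. n \<ge> 3 \<and> inj_on p {..<n} \<and> (\<forall>i<n. {p i, p (Suc i mod n)} \<in> E))"

record ('g, 'v) gtree =
  verts :: "'v set"
  edges :: "'v set set"
  len :: "'v set \<Rightarrow> real"
  act :: "'g \<Rightarrow> 'v \<Rightarrow> 'v"

definition incident :: "('g, 'v) gtree \<Rightarrow> 'v \<Rightarrow> 'v set set" where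
  "incident T v = {e \<in> edges T. v \<in> e}"

definition edge_act :: "('g, 'v) gtree \<Rightarrow> 'g \<Rightarrow> 'v set \<Rightarrow> 'v set" where
  "edge_act T g e = act T g ` e"

definition no_inversions :: "('g, 'b) monoid_scheme \<Rightarrow> ('g, 'v) gtree \<Rightarrow> bool" where
  "no_inversions G T \<longleftrightarrow>
     \<not> (\<exists>g\<in>carrier G. \<exists>u v. u \<noteq> v \<and> {u, v} \<in> edges T \<and> act T g u = v \<and> act T g v = u)"

definition minimal_gtree :: "('g, 'b) monoid_scheme \<Rightarrow> ('g, 'v) gtree \<Rightarrow> bool" where
  "minimal_gtree G T \<longleftrightarrow>
     (\<forall>W F. W \<subseteq> verts T \<and> F \<subseteq> edges T \<and> is_tree W F \<and>
        (\<forall>g\<in>carrier G. (\<forall>w\<in>W. act T g w \<in> W) \<and> (\<forall>e\<in>F. edge_act T g e \<in> F))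
        \<longrightarrow> W = verts T \<and> F = edges T)"

definition no_redundant_vertex :: "('g, 'b) monoid_scheme \<Rightarrow> ('g, 'v) gtree \<Rightarrow> bool" where
  "no_redundant_vertex G T \<longleftrightarrow>
     (\<forall>v\<in>verts T. \<forall>e f. e \<noteq> f \<and> incident T v = {e, f} \<longrightarrow>
        (\<exists>g\<in>carrier G. act T g v = v \<and> edge_act T g e = f \<and> edge_act T g f = e))"

definition metric_gtree :: "('g, 'b) monoid_scheme \<Rightarrow> ('g, 'v) gtree \<Rightarrow> bool" where
  "metric_gtree G T \<longleftrightarrow>
     is_tree (verts T) (edges T) \<and>
     group_action G (verts T) (act T) \<and>
     (\<forall>g\<in>carrier G. \<forall>e\<in>edges T. edge_act T g e \<in> edges T) \<and>
     no_inversions G T \<and> minimal_gtree G T \<and> no_redundant_vertex G T \<and>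
     (\<forall>e\<in>edges T. len T e > 0) \<and>
     (\<forall>g\<in>carrier G. \<forall>e\<in>edges T. len T (edge_act T g e) = len T e)"

subsection \<open>Geometric realization\<close>

text \<open>Points of the tree are given by their barycentric coordinates, so the set of points
  does not depend on the lengths; in particular a single set of points serves for all
  (possibly degenerate) length assignments on the same simplicial tree.\<close>

definition cell :: "'v set \<Rightarrow> ('v \<Rightarrow> real) set" where
  "cell s = {x. (\<forall>v. x v \<ge> 0) \<and> (\<forall>v. v \<notin> s \<longrightarrow> x v = 0) \<and> (\<Sum>v\<in>s. x v) = 1}"

definition points :: "('g, 'v) gtree \<Rightarrow> ('v \<Rightarrow> real) set" where
  "points T = (\<Union>v\<in>verts T. cell {v}) \<union> (\<Union>e\<in>edges T. cell e)"

definition point_act ::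
  "('g, 'b) monoid_scheme \<Rightarrow> ('g, 'v) gtree \<Rightarrow> 'g \<Rightarrow> ('v \<Rightarrow> real) \<Rightarrow> 'v \<Rightarrow> real" where
  "point_act G T g x = (\<lambda>v. if v \<in> verts T then x (act T (inv\<^bsub>G\<^esub> g) v) else 0)"

text \<open>The path distance: the infimum of the lengths of broken lines. On an edge \<open>{a, b}\<close> the two
  coordinates sum to 1, so half the \<open>l1\<close> distance is \<open>\<bar>x a - y a\<bar>\<close>, the fraction of the edge
  between \<open>x\<close> and \<open>y\<close>. If some lengths are 0 this is the pseudo-distance whose metric quotient
  is the tree with these edges collapsed.\<close>

definition seg_length :: "('g, 'v) gtree \<Rightarrow> 'v set \<Rightarrow> ('v \<Rightarrow> real) \<Rightarrow> ('v \<Rightarrow> real) \<Rightarrow> real" where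
  "seg_length T e x y = len T e * ((\<Sum>v\<in>e. \<bar>x v - y v\<bar>) / 2)"

definition tdist :: "('g, 'v) gtree \<Rightarrow> ('v \<Rightarrow> real) \<Rightarrow> ('v \<Rightarrow> real) \<Rightarrow> real" where
  "tdist T x y =
     Inf {(\<Sum>i<n. seg_length T (e i) (p i) (p (Suc i))) | (n::nat) p e.
            p 0 = x \<and> p n = y \<and>
            (\<forall>i<n. e i \<in> edges T \<and> p i \<in> cell (e i) \<and> p (Suc i) \<in> cell (e i))}"

definition equivariant_isometry ::
  "('g, 'b) monoid_scheme \<Rightarrow> (('g, 'v) gtree \<times> ('g, 'v) gtree) set" where
  "equivariant_isometry G =
     {(T, T'). metric_gtree G T \<and> metric_gtree G T' \<and>
        (\<exists>f. bij_betw f (points T) (points T') \<and>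
             (\<forall>x\<in>points T. \<forall>y\<in>points T. tdist T' (f x) (f y) = tdist T x y) \<and>
             (\<forall>g\<in>carrier G. \<forall>x\<in>points T. f (point_act G T g x) = point_act G T' g (f x)))}"

subsection \<open>Elliptic and hyperbolic elements, axes, ends\<close>

definition elliptic_subgroups :: "('g, 'b) monoid_scheme \<Rightarrow> ('g, 'v) gtree \<Rightarrow> 'g set set" where
  "elliptic_subgroups G T =
     {H. subgroup H G \<and> (\<exists>x\<in>points T. \<forall>h\<in>H. point_act G T h x = x)}"

definition hyperbolic :: "('g, 'b) monoid_scheme \<Rightarrow> ('g, 'v) gtree \<Rightarrow> 'g \<Rightarrow> bool" where
  "hyperbolic G T g \<longleftrightarrow> g \<in> carrier G \<and> \<not> (\<exists>x\<in>points T. point_act G T g x = x)"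

definition isometric_on :: "('g, 'v) gtree \<Rightarrow> real set \<Rightarrow> (real \<Rightarrow> 'v \<Rightarrow> real) \<Rightarrow> bool" where
  "isometric_on T I \<gamma> \<longleftrightarrow>
     \<gamma> ` I \<subseteq> points T \<and> (\<forall>s\<in>I. \<forall>t\<in>I. tdist T (\<gamma> s) (\<gamma> t) = \<bar>s - t\<bar>)"

definition is_axis ::
  "('g, 'b) monoid_scheme \<Rightarrow> ('g, 'v) gtree \<Rightarrow> 'g \<Rightarrow> ('v \<Rightarrow> real) set \<Rightarrow> bool" where
  "is_axis G T g A \<longleftrightarrow>
     (\<exists>\<gamma> \<tau>. isometric_on T UNIV \<gamma> \<and> A = range \<gamma> \<and> \<tau> > 0 \<and>
        (\<forall>t. point_act G T g (\<gamma> t) = \<gamma> (t + \<tau>)))"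

definition irreducible_gtree :: "('g, 'b) monoid_scheme \<Rightarrow> ('g, 'v) gtree \<Rightarrow> bool" where
  "irreducible_gtree G T \<longleftrightarrow>
     (\<exists>g h A B. hyperbolic G T g \<and> hyperbolic G T h \<and>
        is_axis G T g A \<and> is_axis G T h B \<and> A \<inter> B = {})"

definition is_line :: "('g, 'v) gtree \<Rightarrow> bool" where
  "is_line T \<longleftrightarrow> (\<exists>\<gamma>. isometric_on T UNIV \<gamma> \<and> range \<gamma> = points T)"

definition is_ray :: "('g, 'v) gtree \<Rightarrow> (real \<Rightarrow> 'v \<Rightarrow> real) \<Rightarrow> bool" where
  "is_ray T \<rho> \<longleftrightarrow> isometric_on T {0..} \<rho>"

definition end_of_ray ::
  "('g, 'v) gtree \<Rightarrow> (real \<Rightarrow> 'v \<Rightarrow> real) \<Rightarrow> (real \<Rightarrow> 'v \<Rightarrow> real) set" where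
  "end_of_ray T \<rho> =
     {\<sigma>. is_ray T \<sigma> \<and> (\<exists>a\<ge>0. \<exists>b\<ge>0. \<forall>t\<ge>0. \<rho> (a + t) = \<sigma> (b + t))}"

definition fixes_end :: "('g, 'b) monoid_scheme \<Rightarrow> ('g, 'v) gtree \<Rightarrow> bool" where
  "fixes_end G T \<longleftrightarrow>
     (\<exists>\<rho>. is_ray T \<rho> \<and>
        (\<forall>g\<in>carrier G. end_of_ray T (\<lambda>t. point_act G T g (\<rho> t)) = end_of_ray T \<rho>))"

definition genuine_abelian_gtree :: "('g, 'b) monoid_scheme \<Rightarrow> ('g, 'v) gtree \<Rightarrow> bool" where
  "genuine_abelian_gtree G T \<longleftrightarrow> fixes_end G T \<and> \<not> is_line T"

subsection \<open>Finiteness conditions\<close>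

definition finitely_generated :: "('g, 'b) monoid_scheme \<Rightarrow> 'g set \<Rightarrow> bool" where
  "finitely_generated G H \<longleftrightarrow> (\<exists>S. finite S \<and> S \<subseteq> carrier G \<and> H = generate G S)"

definition locally_finite_gtree :: "('g, 'v) gtree \<Rightarrow> bool" where
  "locally_finite_gtree T \<longleftrightarrow> (\<forall>v\<in>verts T. finite (incident T v))"

definition fg_vertex_stabilizers :: "('g, 'b) monoid_scheme \<Rightarrow> ('g, 'v) gtree \<Rightarrow> bool" where
  "fg_vertex_stabilizers G T \<longleftrightarrow>
     (\<forall>v\<in>verts T. finitely_generated G (stabilizer G (act T) v))"

section \<open>Deformation spaces\<close>

text \<open>The elements of a deformation space are equivariant isometry classes, so it is a set of sets
  of trees. All vertices are taken from one type \<open>'v\<close>. If \<open>G\<close> is finitely generated, a minimal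
  \<open>G\<close>-tree has countably many vertices, so every class is represented as soon as \<open>'v\<close> is
  infinite.\<close>

definition is_deformation_space ::
  "('g, 'b) monoid_scheme \<Rightarrow> ('g, 'v) gtree set set \<Rightarrow> bool" where
  "is_deformation_space G D \<longleftrightarrow>
     (\<exists>T\<^sub>0 :: ('g, 'v) gtree. metric_gtree G T\<^sub>0 \<and>
        D = {T. metric_gtree G T \<and> elliptic_subgroups G T = elliptic_subgroups G T\<^sub>0}
              // equivariant_isometry G)"

definition stable_family :: "('g, 'b) monoid_scheme \<Rightarrow> 'g set set \<Rightarrow> bool" where
  "stable_family G \<A> \<longleftrightarrow>
     (\<forall>H\<in>\<A>. subgroup H G) \<and>
     (\<forall>H\<in>\<A>. \<forall>g\<in>carrier G. g <#\<^bsub>G\<^esub> H #>\<^bsub>G\<^esub> (inv\<^bsub>G\<^esub> g) \<in> \<A>) \<and>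
     (\<forall>H\<in>\<A>. \<forall>K. subgroup K G \<and> K \<subseteq> H \<longrightarrow> K \<in> \<A>)"

definition is_restricted_deformation_space ::
  "('g, 'b) monoid_scheme \<Rightarrow> ('g, 'v) gtree set set \<Rightarrow> bool" where
  "is_restricted_deformation_space G D \<longleftrightarrow>
     (\<exists>(T\<^sub>0 :: ('g, 'v) gtree) \<A>. metric_gtree G T\<^sub>0 \<and> stable_family G \<A> \<and>
        D = {T. metric_gtree G T \<and> elliptic_subgroups G T = elliptic_subgroups G T\<^sub>0 \<and>
                (\<forall>e\<in>edges T. stabilizer G (edge_act T) e \<in> \<A>)}
              // equivariant_isometry G)"

definition irreducible_space ::
  "('g, 'b) monoid_scheme \<Rightarrow> ('g, 'v) gtree set set \<Rightarrow> bool" where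
  "irreducible_space G D \<longleftrightarrow> (\<forall>c\<in>D. \<forall>T\<in>c. irreducible_gtree G T)"

definition genuine_abelian_space ::
  "('g, 'b) monoid_scheme \<Rightarrow> ('g, 'v) gtree set set \<Rightarrow> bool" where
  "genuine_abelian_space G D \<longleftrightarrow> (\<forall>c\<in>D. \<forall>T\<in>c. genuine_abelian_gtree G T)"

subsection \<open>The weak topology\<close>

definition edge_orbits :: "('g, 'b) monoid_scheme \<Rightarrow> ('g, 'v) gtree \<Rightarrow> 'v set set set" where
  "edge_orbits G T = orbits G (edges T) (edge_act T)"

definition cone_params ::
  "('g, 'b) monoid_scheme \<Rightarrow> ('g, 'v) gtree \<Rightarrow> ('v set set \<Rightarrow> real) set" where
  "cone_params G T = {l \<in> edge_orbits G T \<rightarrow>\<^sub>E {0..}. \<exists>k\<in>edge_orbits G T. l k \<noteq> 0}"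

definition with_lengths ::
  "('g, 'b) monoid_scheme \<Rightarrow> ('g, 'v) gtree \<Rightarrow> ('v set set \<Rightarrow> real) \<Rightarrow> ('g, 'v) gtree" where
  "with_lengths G T l = T\<lparr>len := (\<lambda>e. l (orbit G (edge_act T) e))\<rparr>"

text \<open>The equivariant isometry class of the metric tree obtained from \<open>T\<close> by giving the edges the
  lengths \<open>l\<close>, the edges of length 0 being collapsed: it consists of the metric \<open>G\<close>-trees
  that are the metric quotient of \<open>T\<close> by the pseudo-distance defined by \<open>l\<close>.\<close>

definition cone_point ::
  "('g, 'b) monoid_scheme \<Rightarrow> ('g, 'v) gtree \<Rightarrow> ('v set set \<Rightarrow> real) \<Rightarrow> ('g, 'v) gtree set" where
  "cone_point G T l =
     {T'. metric_gtree G T' \<and>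
        (\<exists>f. f ` points T = points T' \<and>
             (\<forall>x\<in>points T. \<forall>y\<in>points T.
                tdist T' (f x) (f y) = tdist (with_lengths G T l) x y) \<and>
             (\<forall>g\<in>carrier G. \<forall>x\<in>points T. f (point_act G T g x) = point_act G T' g (f x)))}"

text \<open>The part of \<open>[0,\<infinity>)\<^sup>p - {0}\<close> that parametrizes the closed cone of \<open>T\<close> in \<open>D\<close>.\<close>

definition closed_cone_params ::
  "('g, 'b) monoid_scheme \<Rightarrow> ('g, 'v) gtree set set \<Rightarrow> ('g, 'v) gtree
     \<Rightarrow> ('v set set \<Rightarrow> real) set" where
  "closed_cone_params G D T = {l \<in> cone_params G T. cone_point G T l \<in> D}"

text \<open>The parametrization transports the topology of \<open>\<real>\<^sup>p\<close>: a set is closed in the cone iff the set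
  of its parameters is closed among the parameters of the cone.\<close>

definition weakly_closed ::
  "('g, 'b) monoid_scheme \<Rightarrow> ('g, 'v) gtree set set \<Rightarrow> ('g, 'v) gtree set set \<Rightarrow> bool" where
  "weakly_closed G D C \<longleftrightarrow>
     C \<subseteq> D \<and>
     (\<forall>c\<in>D. \<forall>T\<in>c.
        closedin (subtopology (powertop_real (edge_orbits G T)) (closed_cone_params G D T))
          {l \<in> closed_cone_params G D T. cone_point G T l \<in> C})"

definition weak_topology ::
  "('g, 'b) monoid_scheme \<Rightarrow> ('g, 'v) gtree set set \<Rightarrow> ('g, 'v) gtree set topology" where
  "weak_topology G D = topology (\<lambda>U. U \<subseteq> D \<and> weakly_closed G D (D - U))"

lemma weakly_closed_Un:
  assumes "weakly_closed G D A" "weakly_closed G D B"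
  shows "weakly_closed G D (A \<union> B)"
  unfolding weakly_closed_def
proof (intro conjI ballI)
  show "A \<union> B \<subseteq> D"
    using assms by (simp add: weakly_closed_def)
next
  fix c T assume "c \<in> D" "T \<in> c"
  let ?P = "closed_cone_params G D T"
  let ?X = "subtopology (powertop_real (edge_orbits G T)) ?P"
  have "closedin ?X ({l \<in> ?P. cone_point G T l \<in> A} \<union> {l \<in> ?P. cone_point G T l \<in> B})"
    using assms \<open>c \<in> D\<close> \<open>T \<in> c\<close> unfolding weakly_closed_def by (intro closedin_Un) simp_all
  moreover have "{l \<in> ?P. cone_point G T l \<in> A} \<union> {l \<in> ?P. cone_point G T l \<in> B}
      = {l \<in> ?P. cone_point G T l \<in> A \<union> B}"
    by blast
  ultimately show "closedin ?X {l \<in> ?P. cone_point G T l \<in> A \<union> B}"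
    by simp
qed

lemma weakly_closed_Inter:
  assumes "\<K> \<noteq> {}" "\<And>A. A \<in> \<K> \<Longrightarrow> weakly_closed G D A"
  shows "weakly_closed G D (\<Inter>\<K>)"
  unfolding weakly_closed_def
proof (intro conjI ballI)
  show "\<Inter>\<K> \<subseteq> D"
    using assms by (auto simp: weakly_closed_def)
next
  fix c T assume "c \<in> D" "T \<in> c"
  let ?P = "closed_cone_params G D T"
  let ?X = "subtopology (powertop_real (edge_orbits G T)) ?P"
  have "closedin ?X {l \<in> ?P. cone_point G T l \<in> A}" if "A \<in> \<K>" for A
    using assms(2)[OF that] \<open>c \<in> D\<close> \<open>T \<in> c\<close> unfolding weakly_closed_def by simp
  then have "closedin ?X (\<Inter>((\<lambda>A. {l \<in> ?P. cone_point G T l \<in> A}) ` \<K>))"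
    using assms(1) by (intro closedin_Inter) auto
  moreover have "\<Inter>((\<lambda>A. {l \<in> ?P. cone_point G T l \<in> A}) ` \<K>)
      = {l \<in> ?P. cone_point G T l \<in> \<Inter>\<K>}"
    using assms(1) by blast
  ultimately show "closedin ?X {l \<in> ?P. cone_point G T l \<in> \<Inter>\<K>}"
    by simp
qed

lemma weakly_closed_empty: "weakly_closed G D {}"
  by (simp add: weakly_closed_def)

lemma weakly_closed_whole: "weakly_closed G D D"
  unfolding weakly_closed_def
proof (intro conjI ballI)
  fix c T assume "c \<in> D" "T \<in> c"
  let ?P = "closed_cone_params G D T"
  let ?X = "subtopology (powertop_real (edge_orbits G T)) ?P"
  have "?P \<subseteq> topspace (powertop_real (edge_orbits G T))"
    by (auto simp: closed_cone_params_def cone_params_def PiE_iff extensional_def)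
  then have "topspace ?X = ?P"
    by (rule topspace_subtopology_subset)
  moreover have "{l \<in> ?P. cone_point G T l \<in> D} = ?P"
    by (auto simp: closed_cone_params_def)
  ultimately show "closedin ?X {l \<in> ?P. cone_point G T l \<in> D}"
    using closedin_topspace[of ?X] by simp
qed simp

lemma openin_weak_topology:
  "openin (weak_topology G D) U \<longleftrightarrow> U \<subseteq> D \<and> weakly_closed G D (D - U)"
proof -
  have "istopology (\<lambda>U. U \<subseteq> D \<and> weakly_closed G D (D - U))"
    unfolding istopology_def
  proof (intro conjI allI impI)
    fix S T
    assume *: "S \<subseteq> D \<and> weakly_closed G D (D - S)" "T \<subseteq> D \<and> weakly_closed G D (D - T)"
    then show "S \<inter> T \<subseteq> D" by blast
    show "weakly_closed G D (D - S \<inter> T)"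
      using weakly_closed_Un[of G D "D - S" "D - T"] * by (simp add: Diff_Int)
  next
    fix \<K>
    assume *: "\<forall>K\<in>\<K>. K \<subseteq> D \<and> weakly_closed G D (D - K)"
    then show "\<Union>\<K> \<subseteq> D" by blast
    show "weakly_closed G D (D - \<Union>\<K>)"
    proof (cases "\<K> = {}")
      case True
      then show ?thesis by (simp add: weakly_closed_whole)
    next
      case False
      then have "weakly_closed G D (\<Inter>((\<lambda>K. D - K) ` \<K>))"
        using * by (intro weakly_closed_Inter) auto
      moreover have "D - \<Union>\<K> = \<Inter>((\<lambda>K. D - K) ` \<K>)"
        using False by blast
      ultimately show ?thesis by simp
    qed
  qed
  then show ?thesis
    by (simp add: weak_topology_def topology_inverse')
qed

lemma topspace_weak_topology: "topspace (weak_topology G D) = D"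
proof (rule antisym)
  have "openin (weak_topology G D) D"
    by (simp add: openin_weak_topology weakly_closed_empty)
  then show "D \<subseteq> topspace (weak_topology G D)"
    by (rule openin_subset)
  show "topspace (weak_topology G D) \<subseteq> D"
    using openin_topspace[of "weak_topology G D"] by (simp only: openin_weak_topology)
qed

lemma closedin_weak_topology: "closedin (weak_topology G D) C \<longleftrightarrow> weakly_closed G D C"
proof (cases "C \<subseteq> D")
  case True
  then have "D - (D - C) = C" by blast
  then show ?thesis
    using True by (simp add: closedin_def openin_weak_topology topspace_weak_topology)
next
  case False
  then show ?thesis
    by (simp add: closedin_def topspace_weak_topology weakly_closed_def)
qed

subsection \<open>The Gromov topology\<close>

definition gromov_nbhd ::
  "('g, 'b) monoid_scheme \<Rightarrow> ('g, 'v) gtree set set \<Rightarrow> ('g, 'v) gtree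
     \<Rightarrow> ('v \<Rightarrow> real) set \<Rightarrow> 'g set \<Rightarrow> real \<Rightarrow> ('g, 'v) gtree set set" where
  "gromov_nbhd G D T X A \<epsilon> =
     {c' \<in> D. \<exists>T'\<in>c'. \<exists>f. f ` X \<subseteq> points T' \<and>
        (\<forall>x\<in>X. \<forall>y\<in>X. \<forall>g\<in>A.
           \<bar>tdist T x (point_act G T g y) - tdist T' (f x) (point_act G T' g (f y))\<bar> < \<epsilon>)}"

definition gromov_topology ::
  "('g, 'b) monoid_scheme \<Rightarrow> ('g, 'v) gtree set set \<Rightarrow> ('g, 'v) gtree set topology" where
  "gromov_topology G D = topology (\<lambda>U. U \<subseteq> D \<and>
     (\<forall>c\<in>U. \<forall>T\<in>c. \<exists>X A \<epsilon>. finite X \<and> X \<subseteq> points T \<and> finite A \<and> A \<subseteq> carrier G \<and> \<epsilon> > 0 \<and>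
        gromov_nbhd G D T X A \<epsilon> \<subseteq> U))"

lemma gromov_nbhd_mono:
  assumes "X \<subseteq> X'" "A \<subseteq> A'" "\<epsilon>' \<le> \<epsilon>"
  shows "gromov_nbhd G D T X' A' \<epsilon>' \<subseteq> gromov_nbhd G D T X A \<epsilon>"
proof
  fix c assume "c \<in> gromov_nbhd G D T X' A' \<epsilon>'"
  then obtain T' f where c: "c \<in> D" "T' \<in> c" and f: "f ` X' \<subseteq> points T'" and
    lt: "\<forall>x\<in>X'. \<forall>y\<in>X'. \<forall>g\<in>A'.
      \<bar>tdist T x (point_act G T g y) - tdist T' (f x) (point_act G T' g (f y))\<bar> < \<epsilon>'"
    unfolding gromov_nbhd_def by (elim CollectE conjE bexE exE)
  have "f ` X \<subseteq> points T'"
    using f assms(1) by blast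
  moreover have "\<forall>x\<in>X. \<forall>y\<in>X. \<forall>g\<in>A.
      \<bar>tdist T x (point_act G T g y) - tdist T' (f x) (point_act G T' g (f y))\<bar> < \<epsilon>"
  proof (intro ballI)
    fix x y g assume "x \<in> X" "y \<in> X" "g \<in> A"
    then have "x \<in> X'" "y \<in> X'" "g \<in> A'"
      using assms(1,2) by auto
    then show "\<bar>tdist T x (point_act G T g y) - tdist T' (f x) (point_act G T' g (f y))\<bar> < \<epsilon>"
      using lt assms(3) by (meson less_le_trans)
  qed
  ultimately show "c \<in> gromov_nbhd G D T X A \<epsilon>"
    unfolding gromov_nbhd_def using c by (intro CollectI conjI bexI exI)
qed

lemma openin_gromov_topology:
  "openin (gromov_topology G D) U \<longleftrightarrow> U \<subseteq> D \<and>
     (\<forall>c\<in>U. \<forall>T\<in>c. \<exists>X A \<epsilon>. finite X \<and> X \<subseteq> points T \<and> finite A \<and> A \<subseteq> carrier G \<and> \<epsilon> > 0 \<and>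
        gromov_nbhd G D T X A \<epsilon> \<subseteq> U)"
proof -
  define N where "N = (\<lambda>T U. \<exists>X A \<epsilon>. finite X \<and> X \<subseteq> points T \<and> finite A \<and> A \<subseteq> carrier G \<and>
    \<epsilon> > 0 \<and> gromov_nbhd G D T X A \<epsilon> \<subseteq> U)"
  have N_I: "N T U" if "finite X" "X \<subseteq> points T" "finite A" "A \<subseteq> carrier G" "\<epsilon> > 0"
    "gromov_nbhd G D T X A \<epsilon> \<subseteq> U" for T U X A \<epsilon>
    unfolding N_def by (intro exI conjI) (fact that)+
  have N_E: thesis if "N T U" and "\<And>X A \<epsilon>. \<lbrakk>finite X; X \<subseteq> points T; finite A; A \<subseteq> carrier G; \<epsilon> > 0;
    gromov_nbhd G D T X A \<epsilon> \<subseteq> U\<rbrakk> \<Longrightarrow> thesis" for T U thesis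
    using that(1) unfolding N_def by (elim exE conjE) (rule that(2))
  have mono: "N T V" if "N T U" "U \<subseteq> V" for T U V
    using that(1) by (rule N_E) (erule (4) N_I, erule order_trans, rule that(2))
  have inter: "N T (U \<inter> V)" if n1: "N T U" and n2: "N T V" for T U V
  proof -
    obtain X A \<epsilon> where 1: "finite X" "X \<subseteq> points T" "finite A" "A \<subseteq> carrier G" "\<epsilon> > 0"
      "gromov_nbhd G D T X A \<epsilon> \<subseteq> U"
      using n1 by (rule N_E)
    obtain X' A' \<epsilon>' where 2: "finite X'" "X' \<subseteq> points T" "finite A'" "A' \<subseteq> carrier G" "\<epsilon>' > 0"
      "gromov_nbhd G D T X' A' \<epsilon>' \<subseteq> V"
      using n2 by (rule N_E)
    have "gromov_nbhd G D T (X \<union> X') (A \<union> A') (min \<epsilon> \<epsilon>') \<subseteq> U"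
      by (rule order_trans[OF gromov_nbhd_mono 1(6)]) simp_all
    moreover have "gromov_nbhd G D T (X \<union> X') (A \<union> A') (min \<epsilon> \<epsilon>') \<subseteq> V"
      by (rule order_trans[OF gromov_nbhd_mono 2(6)]) simp_all
    ultimately show ?thesis
      using 1(1-5) 2(1-5) by (intro N_I[of "X \<union> X'" T "A \<union> A'" "min \<epsilon> \<epsilon>'"]) simp_all
  qed
  have "istopology (\<lambda>U. U \<subseteq> D \<and> (\<forall>c\<in>U. \<forall>T\<in>c. N T U))"
    unfolding istopology_def
  proof (intro conjI allI impI)
    fix S T
    assume *: "S \<subseteq> D \<and> (\<forall>c\<in>S. \<forall>T\<in>c. N T S)" "T \<subseteq> D \<and> (\<forall>c\<in>T. \<forall>T'\<in>c. N T' T)"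
    show "S \<inter> T \<subseteq> D" using * by (simp add: le_infI1)
    show "\<forall>c\<in>S \<inter> T. \<forall>T'\<in>c. N T' (S \<inter> T)"
    proof (intro ballI)
      fix c T' assume "c \<in> S \<inter> T" "T' \<in> c"
      then have "N T' S" "N T' T" using * by blast+
      then show "N T' (S \<inter> T)" by (rule inter)
    qed
  next
    fix \<K>
    assume *: "\<forall>K\<in>\<K>. K \<subseteq> D \<and> (\<forall>c\<in>K. \<forall>T\<in>c. N T K)"
    show "\<Union>\<K> \<subseteq> D" using * by (simp add: Sup_le_iff)
    show "\<forall>c\<in>\<Union>\<K>. \<forall>T\<in>c. N T (\<Union>\<K>)"
    proof (intro ballI)
      fix c T assume "c \<in> \<Union>\<K>" "T \<in> c"
      then obtain K where K: "K \<in> \<K>" "c \<in> K" by (elim UnionE)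
      then have "N T K" using * \<open>T \<in> c\<close> by simp
      then show "N T (\<Union>\<K>)" using Union_upper[OF K(1)] by (rule mono)
    qed
  qed
  then show ?thesis
    unfolding gromov_topology_def by (simp add: N_def topology_inverse')
qed

lemma topspace_gromov_topology: "topspace (gromov_topology G D) = D"
proof (rule antisym)
  have "\<exists>X A \<epsilon>. finite X \<and> X \<subseteq> points T \<and> finite A \<and> A \<subseteq> carrier G \<and> \<epsilon> > 0 \<and>
      gromov_nbhd G D T X A \<epsilon> \<subseteq> D" for T
    by (rule exI[of _ "{}"], rule exI[of _ "{}"], rule exI[of _ "1::real"])
       (auto simp: gromov_nbhd_def)
  then show "D \<subseteq> topspace (gromov_topology G D)"
    by (intro openin_subset) (simp add: openin_gromov_topology)
  show "topspace (gromov_topology G D) \<subseteq> D"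
    using openin_topspace[of "gromov_topology G D"] by (simp only: openin_gromov_topology)
qed

subsection \<open>Projectivization\<close>

definition rescale :: "real \<Rightarrow> ('g, 'v) gtree \<Rightarrow> ('g, 'v) gtree" where
  "rescale r T = T\<lparr>len := (\<lambda>e. r * len T e)\<rparr>"

definition projective_class :: "('g, 'v) gtree set \<Rightarrow> ('g, 'v) gtree set set" where
  "projective_class c = {rescale r ` c | r. r > 0}"

definition quotient_topology :: "'x topology \<Rightarrow> ('x \<Rightarrow> 'y) \<Rightarrow> 'y topology" where
  "quotient_topology X p =
     topology (\<lambda>U. U \<subseteq> p ` topspace X \<and> openin X {x \<in> topspace X. p x \<in> U})"

lemma openin_quotient_topology:
  "openin (quotient_topology X p) U \<longleftrightarrow>
     U \<subseteq> p ` topspace X \<and> openin X {x \<in> topspace X. p x \<in> U}"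
proof -
  have "istopology (\<lambda>U. U \<subseteq> p ` topspace X \<and> openin X {x \<in> topspace X. p x \<in> U})"
    unfolding istopology_def
  proof (intro conjI allI impI)
    fix S T
    assume *: "S \<subseteq> p ` topspace X \<and> openin X {x \<in> topspace X. p x \<in> S}"
      "T \<subseteq> p ` topspace X \<and> openin X {x \<in> topspace X. p x \<in> T}"
    then show "S \<inter> T \<subseteq> p ` topspace X" by blast
    have "{x \<in> topspace X. p x \<in> S \<inter> T}
        = {x \<in> topspace X. p x \<in> S} \<inter> {x \<in> topspace X. p x \<in> T}"
      by blast
    then show "openin X {x \<in> topspace X. p x \<in> S \<inter> T}"
      using * by (simp add: openin_Int)
  next
    fix \<K>
    assume *: "\<forall>K\<in>\<K>. K \<subseteq> p ` topspace X \<and> openin X {x \<in> topspace X. p x \<in> K}"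
    then show "\<Union>\<K> \<subseteq> p ` topspace X" by blast
    have "{x \<in> topspace X. p x \<in> \<Union>\<K>} = \<Union>((\<lambda>K. {x \<in> topspace X. p x \<in> K}) ` \<K>)"
      by blast
    moreover have "openin X (\<Union>((\<lambda>K. {x \<in> topspace X. p x \<in> K}) ` \<K>))"
      using * by (intro openin_Union) auto
    ultimately show "openin X {x \<in> topspace X. p x \<in> \<Union>\<K>}" by simp
  qed
  then show ?thesis
    by (simp add: quotient_topology_def topology_inverse')
qed

lemma topspace_quotient_topology: "topspace (quotient_topology X p) = p ` topspace X"
proof (rule antisym)
  have "{x \<in> topspace X. p x \<in> p ` topspace X} = topspace X" by blast
  then have "openin (quotient_topology X p) (p ` topspace X)"
    by (simp add: openin_quotient_topology)
  then show "p ` topspace X \<subseteq> topspace (quotient_topology X p)"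
    by (rule openin_subset)
  show "topspace (quotient_topology X p) \<subseteq> p ` topspace X"
    using openin_topspace[of "quotient_topology X p"] by (simp only: openin_quotient_topology)
qed

lemma quotient_map_quotient_topology: "quotient_map X (quotient_topology X p) p"
  by (simp add: quotient_map_def openin_quotient_topology topspace_quotient_topology)

text \<open>The space of projective classes of trees in \<open>D\<close>, where \<open>X\<close> is a topology on \<open>D\<close>.\<close>

definition projectivization ::
  "('g, 'v) gtree set topology \<Rightarrow> ('g, 'v) gtree set set topology" where
  "projectivization X = quotient_topology X projective_class"

end

theory Submission
  imports Defs
begin

text \<open>Gromov open sets are weakly open because the distance between two points of a tree is a finite
  sum of edge lengths, with coefficients that do not depend on the lengths.

  Conversely let \<open>U\<close> be weakly open and \<open>T\<close> in \<open>U\<close>. If \<open>T'\<close> in the same deformation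
  space is close to \<open>T\<close>, then the vertex stabilizers of \<open>T\<close>, being finitely generated and elliptic
  in \<open>T'\<close>, fix vertices of \<open>T'\<close> near the approximating points; this gives an equivariant
  map \<open>f\<close> from the vertices of \<open>T\<close> to those of \<open>T'\<close> which almost preserves the distances
  between vertices at combinatorial distance at most 2. By a local-to-global argument these
  distances determine all distances between points of the image of \<open>f\<close>, whose convex hull is
  \<open>T'\<close>. They are moreover linear combinations of the lengths of the edge orbits of \<open>T'\<close>, whose
  coefficients are natural numbers, bounded because \<open>T\<close> is locally finite. So there are finitely
  many types of such \<open>T'\<close>, a type being the set of columns of coefficients, and all trees of
  one type lie in the closed cone of any one of them. If no Gromov neighbourhood of \<open>T\<close> were
  contained in \<open>U\<close>, there would be trees outside \<open>U\<close>, of one type, converging to \<open>T\<close>. Their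
  parameters in a common closed cone are bounded, and at a cluster point the tree is \<open>T\<close>, because
  its distances are the right ones; this contradicts that \<open>U\<close> is weakly open. The quotient
  topologies then coincide as well.\<close>

section \<open>Edge coordinates\<close>

text \<open>The obstacle is that a tree close to \<open>T\<close> may contain arbitrarily short
  edges which no distances in \<open>T\<close> announce, so it need not arise from \<open>T\<close>
  by a small change of lengths. Therefore \<open>T\<close> is sought in the closed cone of a nearby
  tree, possibly on its boundary, and not the other way round. Images of adjacent edges may
  backtrack. Distance 2 is the least range at which this is visible. Backtracking that is small
  compared with the shortest edge gives strict four-point inequalities, and in a tree a strict
  inequality at one edge forces a four-point equality at all edges, hence for all length functions.
  This makes distances in two different trees comparable. Images are pushed to vertices so that the
  coefficients become integers; this rests on the absence of redundant vertices. The coefficients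
  are bounded because no edge of the nearby tree is crossed by the images of two disjoint edges of
  \<open>T\<close>.\<close>

definition adj :: "'v set set \<Rightarrow> ('v \<times> 'v) set" where
  "adj F = {(a, b). {a, b} \<in> F}"

definition branch :: "'v set set \<Rightarrow> 'v set \<Rightarrow> 'v set" where
  "branch E e = {v. (SOME a. a \<in> e, v) \<in> (adj (E - {e}))\<^sup>*}"

text \<open>The sum runs over the support because \<open>branch\<close> may be infinite, and a sum
  over an infinite set is 0 by default; a point of the tree has at most two nonzero
  coordinates.\<close>

definition coord :: "'v set set \<Rightarrow> 'v set \<Rightarrow> ('v \<Rightarrow> real) \<Rightarrow> real" where
  "coord E e x = (\<Sum>v | v \<in> branch E e \<and> x v \<noteq> 0. x v)"

text \<open>The function \<open>coord E e\<close> is the projection of the tree onto the edge \<open>e\<close>, identified with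
  \<open>[0, 1]\<close>. As \<open>branch\<close> chooses an end of \<open>e\<close>, only the separation \<open>sep\<close> is canonical.
  Weighted by the lengths, these coordinates embed the tree isometrically into an \<open>l1\<close> space.\<close>

definition sep :: "'v set set \<Rightarrow> 'v set \<Rightarrow> ('v \<Rightarrow> real) \<Rightarrow> ('v \<Rightarrow> real) \<Rightarrow> real" where
  "sep E e x y = \<bar>coord E e x - coord E e y\<bar>"

text \<open>Betweenness is tested edge by edge and without lengths, so distances add up along it for
  every length function at once, degenerate ones included.\<close>

definition betw :: "'v set set \<Rightarrow> ('v \<Rightarrow> real) \<Rightarrow> ('v \<Rightarrow> real) \<Rightarrow> ('v \<Rightarrow> real) \<Rightarrow> bool" where
  "betw E x m y \<longleftrightarrow> (\<forall>e\<in>E. sep E e x m + sep E e m y = sep E e x y)"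

definition vertex_point :: "'v \<Rightarrow> 'v \<Rightarrow> real" where
  "vertex_point v = (\<lambda>u. if u = v then 1 else 0)"

lemma adj_iff: "(a, b) \<in> adj F \<longleftrightarrow> {a, b} \<in> F"
  by (simp add: adj_def)

lemma adj_rtrancl_sym: "(a, b) \<in> (adj F)\<^sup>* \<Longrightarrow> (b, a) \<in> (adj F)\<^sup>*"
proof -
  have "sym (adj F)"
    by (auto simp: sym_def adj_def insert_commute)
  then show "(a, b) \<in> (adj F)\<^sup>* \<Longrightarrow> (b, a) \<in> (adj F)\<^sup>*"
    by (meson sym_rtrancl symD)
qed

lemma rtrancl_simple_path:
  assumes "(u, v) \<in> (adj F)\<^sup>*"
  obtains xs where "xs \<noteq> []" "hd xs = u" "last xs = v" "distinct xs"
    "successively (\<lambda>a b. {a, b} \<in> F) xs"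
proof -
  have "\<exists>xs. xs \<noteq> [] \<and> hd xs = u \<and> last xs = v \<and> distinct xs \<and> successively (\<lambda>a b. {a, b} \<in> F) xs"
    using assms
  proof (induction rule: rtrancl_induct)
    case base
    show ?case by (rule exI[of _ "[u]"]) simp
  next
    case (step y z)
    then obtain xs where xs: "xs \<noteq> []" "hd xs = u" "last xs = y" "distinct xs"
      "successively (\<lambda>a b. {a, b} \<in> F) xs" by blast
    show ?case
    \<comment> \<open>A revisited vertex closes a loop, which is erased by stopping at the earlier
      occurrence.\<close>
    proof (cases "z \<in> set xs")
      case True
      then obtain ys zs where "xs = ys @ z # zs" by (meson split_list)
      then have "successively (\<lambda>a b. {a, b} \<in> F) (ys @ [z])" "distinct (ys @ [z])"
        "hd (ys @ [z]) = u"
        using xs by (auto simp: successively_append_iff hd_append)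
      then show ?thesis by (intro exI[of _ "ys @ [z]"]) auto
    next
      case False
      then have "successively (\<lambda>a b. {a, b} \<in> F) (xs @ [z])"
        using xs step(2) by (auto simp: successively_append_iff adj_iff)
      then show ?thesis using xs False by (intro exI[of _ "xs @ [z]"]) auto
    qed
  qed
  then show ?thesis using that by blast
qed

lemma vertex_point_eq_iff [simp]: "vertex_point v = vertex_point w \<longleftrightarrow> v = w"
  by (metis vertex_point_def zero_neq_one)

lemma vertex_point_in_cell_iff [simp]: "finite s \<Longrightarrow> vertex_point v \<in> cell s \<longleftrightarrow> v \<in> s"
  by (auto simp: vertex_point_def cell_def sum.delta split: if_splits)

lemma cell_singleton [simp]: "cell {v} = {vertex_point v}"
  by (auto simp: vertex_point_def cell_def fun_eq_iff)

lemma coord_cell: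
  assumes "finite s" "x \<in> cell s"
  shows "coord E e x = (\<Sum>v\<in>s \<inter> branch E e. x v)"
  unfolding coord_def
  using assms by (intro sum.mono_neutral_left) (auto simp: cell_def)

lemma coord_vertex: "coord E e (vertex_point v) = (if v \<in> branch E e then 1 else 0)"
  by (subst coord_cell[of "{v}"]) (auto simp: vertex_point_def)

lemma sep_commute: "sep E e x y = sep E e y x"
  by (simp add: sep_def abs_minus_commute)

lemma sep_nonneg [simp]: "0 \<le> sep E e x y"
  by (simp add: sep_def)

lemma sep_self [simp]: "sep E e x x = 0"
  by (simp add: sep_def)

lemma sep_triangle: "sep E e x z \<le> sep E e x y + sep E e y z"
  by (simp add: sep_def)

lemma betw_commute: "betw E x m y \<longleftrightarrow> betw E y m x"
  by (simp add: betw_def sep_commute add.commute)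

lemma betw_left [simp]: "betw E x x y" and betw_right [simp]: "betw E x y y"
  by (simp_all add: betw_def)

lemma betw_sepD: "betw E x m y \<Longrightarrow> e \<in> E \<Longrightarrow> sep E e x m + sep E e m y = sep E e x y"
  by (simp add: betw_def)

lemma betw_trans:
  assumes "betw E x m y" "betw E x z m"
  shows "betw E x z y" "betw E z m y"
proof -
  have "sep E e x z + sep E e z y = sep E e x y \<and> sep E e z m + sep E e m y = sep E e z y" if "e \<in> E" for e
    using betw_sepD[OF assms(1) that] betw_sepD[OF assms(2) that] sep_triangle[of E e z y m]
      sep_triangle[of E e x y z] by linarith
  then show "betw E x z y" "betw E z m y" by (auto simp: betw_def)
qed

section \<open>Bridges, sides of an edge and coordinates of points\<close>

locale simplicial_tree =
  fixes T :: "('g, 'v) gtree"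
  assumes is_tree: "is_tree (verts T) (edges T)"
begin

abbreviation "V \<equiv> verts T"
abbreviation "E \<equiv> edges T"
abbreviation "P \<equiv> points T"

lemma edge_cases:
  assumes "e \<in> E"
  obtains a b where "e = {a, b}" "a \<in> V" "b \<in> V" "a \<noteq> b"
  using is_tree assms unfolding is_tree_def by blast

lemma finite_edge: "e \<in> E \<Longrightarrow> finite e"
  by (erule edge_cases) simp

lemma edge_verts: "e \<in> E \<Longrightarrow> v \<in> e \<Longrightarrow> v \<in> V"
  by (erule edge_cases) auto

lemma connected: "u \<in> V \<Longrightarrow> v \<in> V \<Longrightarrow> (u, v) \<in> (adj E)\<^sup>*"
  using is_tree unfolding is_tree_def adj_def by blast

text \<open>A simple path from \<open>a\<close> to \<open>b\<close> avoiding their edge has at least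
  three vertices, and the edge closes it to a circuit.\<close>

lemma bridge:
  assumes "{a, b} \<in> E"
  shows "(a, b) \<notin> (adj (E - {{a, b}}))\<^sup>*"
proof
  assume "(a, b) \<in> (adj (E - {{a, b}}))\<^sup>*"
  then obtain xs where xs: "xs \<noteq> []" "hd xs = a" "last xs = b" "distinct xs"
    "successively (\<lambda>c d. {c, d} \<in> E - {{a, b}}) xs"
    by (rule rtrancl_simple_path)
  have "a \<noteq> b" using assms by (auto elim: edge_cases)
  obtain y ys where 1: "xs = y # ys" using xs(1) by (cases xs) auto
  then obtain z zs where 2: "xs = y # z # zs" using xs \<open>a \<noteq> b\<close> by (cases ys) auto
  then have "zs \<noteq> []" using xs by auto
  then have n: "length xs \<ge> 3" using 2 by (cases zs) auto
  have "{xs ! i, xs ! (Suc i mod length xs)} \<in> E" if i: "i < length xs" for i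
  proof (cases "Suc i = length xs")
    \<comment> \<open>The index wraps around here: the closing edge of the circuit is the removed
      edge itself.\<close>
    case True
    then have "xs ! i = b" "xs ! 0 = a"
      using xs by (simp_all add: last_conv_nth hd_conv_nth flip: True)
    then show ?thesis using assms True by (simp add: insert_commute)
  next
    case False
    then have "Suc i < length xs" using i by simp
    moreover have "\<And>j. Suc j < length xs \<Longrightarrow> {xs ! j, xs ! Suc j} \<in> E - {{a, b}}"
      using xs(5) by (simp add: successively_conv_nth)
    ultimately show ?thesis by simp
  qed
  moreover have "inj_on (\<lambda>i. xs ! i) {..<length xs}"
    using xs(4) by (simp add: inj_on_nth)
  ultimately have "\<exists>(n::nat) p. n \<ge> 3 \<and> inj_on p {..<n} \<and> (\<forall>i<n. {p i, p (Suc i mod n)} \<in> E)"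
    using n by (intro exI[of _ "length xs"] exI[of _ "\<lambda>i. xs ! i"]) auto
  then show False using is_tree unfolding is_tree_def by blast
qed

lemma branch_edge_rtrancl:
  assumes "(u, v) \<in> (adj (E - {e}))\<^sup>*"
  shows "u \<in> branch E e \<longleftrightarrow> v \<in> branch E e"
  unfolding branch_def using assms adj_rtrancl_sym rtrancl_trans by fast

lemma branch_ends:
  assumes "{a, b} \<in> E"
  shows "a \<in> branch E {a, b} \<longleftrightarrow> b \<notin> branch E {a, b}"
proof -
  define r where "r = (SOME c. c \<in> {a, b})"
  have "r \<in> {a, b}" unfolding r_def by (rule someI[of _ a]) simp
  then consider "r = a" | "r = b" by blast
  then show ?thesis
  proof cases
    case 1
    then show ?thesis using bridge[OF assms] by (simp add: branch_def r_def)
  next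
    case 2
    moreover have "(b, a) \<notin> (adj (E - {{a, b}}))\<^sup>*"
      using bridge[OF assms] adj_rtrancl_sym by metis
    ultimately show ?thesis by (simp add: branch_def r_def)
  qed
qed

text \<open>On a path from an end of \<open>e\<close> to \<open>v\<close>, each passage through
  \<open>e\<close> can be forgotten by restarting at the end just reached.\<close>

lemma edge_side:
  assumes "e \<in> E" "v \<in> V"
  obtains a where "a \<in> e" "(a, v) \<in> (adj (E - {e}))\<^sup>*"
proof -
  obtain a b where e: "e = {a, b}" "a \<in> V" "b \<in> V" "a \<noteq> b" using assms(1) by (rule edge_cases)
  have "(a, v) \<in> (adj E)\<^sup>*" using connected e assms by blast
  then have "\<exists>c\<in>e. (c, v) \<in> (adj (E - {e}))\<^sup>*"
  proof (induction rule: rtrancl_induct)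
    case base
    then show ?case using e by blast
  next
    case (step y z)
    then obtain c where c: "c \<in> e" "(c, y) \<in> (adj (E - {e}))\<^sup>*" by blast
    show ?case
    proof (cases "{y, z} = e")
      case True
      then show ?thesis by blast
    next
      case False
      then have "(y, z) \<in> adj (E - {e})" using step by (auto simp: adj_def)
      then show ?thesis using c by (meson rtrancl.rtrancl_into_rtrancl)
    qed
  qed
  then show ?thesis using that by blast
qed

lemma branch_other_edge:
  assumes "f \<in> E" "e \<noteq> f" "u \<in> f" "v \<in> f"
  shows "u \<in> branch E e \<longleftrightarrow> v \<in> branch E e"
proof (cases "u = v")
  case False
  obtain a b where "f = {a, b}" using assms(1) by (rule edge_cases)
  then have "f = {u, v}" using assms False by auto
  then have "(u, v) \<in> (adj (E - {e}))\<^sup>*" using assms by (auto simp: adj_def)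
  then show ?thesis by (rule branch_edge_rtrancl)
qed simp

text \<open>If \<open>f\<close> separates \<open>v\<close> from \<open>e\<close>, a path avoiding
  \<open>f\<close> from the end of \<open>f\<close> on the side of \<open>v\<close> stays on that
  side, hence never runs through \<open>e\<close>; so \<open>v\<close> and \<open>f\<close> lie on
  the same side of \<open>e\<close>.\<close>

lemma branch_nested:
  assumes "e \<in> E" "f \<in> E" "e \<noteq> f" "v \<in> V" "a \<in> e" "c \<in> f"
  shows "(v \<in> branch E e \<longleftrightarrow> c \<in> branch E e) \<or> (v \<in> branch E f \<longleftrightarrow> a \<in> branch E f)"
proof (rule disjCI)
  assume nf: "\<not> (v \<in> branch E f \<longleftrightarrow> a \<in> branch E f)"
  obtain d where d: "d \<in> f" "(d, v) \<in> (adj (E - {f}))\<^sup>*" using assms by (metis edge_side)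
  have df: "d \<in> branch E f \<longleftrightarrow> a \<notin> branch E f"
    using branch_edge_rtrancl[OF d(2)] nf by blast
  have "(d, v) \<in> (adj (E - {e}))\<^sup>* \<and> (d \<in> branch E f \<longleftrightarrow> v \<in> branch E f)"
    using d(2)
  proof (induction rule: rtrancl_induct)
    case (step y z)
    have "{y, z} \<noteq> e"
    proof
      assume "{y, z} = e"
      then have "y \<in> branch E f \<longleftrightarrow> a \<in> branch E f"
        using branch_other_edge[of e f y a] assms by auto
      then show False using df step by blast
    qed
    then have "(y, z) \<in> adj (E - {e})" using step by (auto simp: adj_def)
    then have "(d, z) \<in> (adj (E - {e}))\<^sup>*" using step by (meson rtrancl.rtrancl_into_rtrancl)
    moreover have "y \<in> branch E f \<longleftrightarrow> z \<in> branch E f"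
      using branch_edge_rtrancl[of y z f] step(2) by blast
    ultimately show ?case using step by blast
  qed simp
  then have "v \<in> branch E e \<longleftrightarrow> d \<in> branch E e" using branch_edge_rtrancl by blast
  then show "v \<in> branch E e \<longleftrightarrow> c \<in> branch E e"
    using branch_other_edge[of f e d c] assms d by blast
qed

lemma vertex_point_in_points: "v \<in> V \<Longrightarrow> vertex_point v \<in> P"
  by (auto simp: points_def)

lemma cell_subset_points: "e \<in> E \<Longrightarrow> cell e \<subseteq> P"
  by (auto simp: points_def)

lemma points_cases:
  assumes "x \<in> P"
  obtains v where "v \<in> V" "x = vertex_point v" | e where "e \<in> E" "x \<in> cell e"
  using assms by (auto simp: points_def)

lemma coord_edge:
  assumes "e \<in> E" "x \<in> cell e"
  shows "\<exists>a b. e = {a, b} \<and> a \<noteq> b \<and> x a = coord E e x \<and> x b = 1 - coord E e x \<and>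
    a \<in> branch E e \<and> b \<notin> branch E e"
proof -
  obtain a b where e: "e = {a, b}" "a \<in> V" "b \<in> V" "a \<noteq> b" using assms(1) by (rule edge_cases)
  have "\<exists>a b. e = {a, b} \<and> a \<noteq> b \<and> a \<in> branch E e \<and> b \<notin> branch E e"
    using branch_ends[of a b] e assms(1) by (cases "a \<in> branch E e") (auto simp: insert_commute)
  then obtain a b where e: "e = {a, b}" "a \<noteq> b" "a \<in> branch E e" "b \<notin> branch E e" by blast
  have "e \<inter> branch E e = {a}" using e by auto
  then have "coord E e x = x a"
    using coord_cell[of e x E e] assms finite_edge by simp
  moreover have "x a + x b = 1" using assms e by (auto simp: cell_def)
  ultimately show ?thesis using e by force
qed

lemma coord_other_edge:
  assumes "f \<in> E" "e \<noteq> f" "x \<in> cell f" "v \<in> f"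
  shows "coord E e x = coord E e (vertex_point v)"
proof -
  have "f \<inter> branch E e = (if v \<in> branch E e then f else {})"
    using branch_other_edge[OF assms(1,2) _ assms(4)] by auto
  moreover have "sum x f = 1" using assms by (simp add: cell_def)
  ultimately show ?thesis
    using coord_cell[OF finite_edge[OF assms(1)] assms(3), of E e] by (simp add: coord_vertex)
qed

lemma coord_vertex_01: "coord E e (vertex_point v) \<in> {0, 1}"
  by (simp add: coord_vertex)

lemma coord_01_or_cell:
  assumes "x \<in> P" "e \<in> E"
  shows "coord E e x \<in> {0, 1} \<or> x \<in> cell e"
  using assms(1)
proof (cases rule: points_cases)
  case (1 v)
  then show ?thesis using coord_vertex_01 by blast
next
  case (2 f)
  show ?thesis
  proof (cases "f = e")
    case False
    obtain v where "v \<in> f" using edge_cases[OF 2(1)] by blast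
    then have "coord E e x = coord E e (vertex_point v)" using coord_other_edge[of f e] False 2 by blast
    then show ?thesis using coord_vertex_01 by metis
  qed (use 2 in simp)
qed

lemma coord_bounds:
  assumes "x \<in> P" "e \<in> E"
  shows "0 \<le> coord E e x" "coord E e x \<le> 1"
proof -
  have "0 \<le> coord E e x \<and> coord E e x \<le> 1"
    using coord_01_or_cell[OF assms]
  proof
    assume x: "x \<in> cell e"
    then obtain a b where "x a = coord E e x" "x b = 1 - coord E e x"
      using coord_edge[OF assms(2)] by blast
    moreover have "x a \<ge> 0" "x b \<ge> 0" using x by (auto simp: cell_def)
    ultimately show ?thesis by linarith
  qed auto
  then show "0 \<le> coord E e x" "coord E e x \<le> 1" by auto
qed

text \<open>Two distinct edges cut the tree into three parts only, so the image of the tree under their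
  two coordinates is an \<open>L\<close>-shaped subset of the unit square.\<close>

lemma coord_nested:
  assumes "e \<in> E" "f \<in> E" "e \<noteq> f"
  obtains c d where "c \<in> {0, 1}" "d \<in> {0, 1}" "\<And>x. x \<in> cell f \<Longrightarrow> coord E e x = c"
    "\<And>x. x \<in> cell e \<Longrightarrow> coord E f x = d" "\<And>x. x \<in> P \<Longrightarrow> coord E e x = c \<or> coord E f x = d"
proof -
  obtain a where a: "a \<in> e" using edge_cases[OF assms(1)] by blast
  obtain b where b: "b \<in> f" using edge_cases[OF assms(2)] by blast
  let ?c = "coord E e (vertex_point b)" and ?d = "coord E f (vertex_point a)"
  have f: "coord E e x = ?c" if "x \<in> cell f" for x
    using coord_other_edge[OF assms(2,3) that b] .
  have e: "coord E f x = ?d" if "x \<in> cell e" for x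
    using coord_other_edge[OF assms(1) assms(3)[symmetric] that a] .
  have v: "coord E e (vertex_point v) = ?c \<or> coord E f (vertex_point v) = ?d" if "v \<in> V" for v
    using branch_nested[OF assms that a b] by (auto simp: coord_vertex)
  have "coord E e x = ?c \<or> coord E f x = ?d" if "x \<in> P" for x
    using that
  proof (cases rule: points_cases)
    case (1 v)
    then show ?thesis using v by blast
  next
    case (2 h)
    consider "h = e" | "h = f" | "h \<noteq> e" "h \<noteq> f" by blast
    then show ?thesis
    proof cases
      case 3
      obtain w where w: "w \<in> h" using edge_cases[OF 2(1)] by blast
      then have "w \<in> V" using edge_verts 2 by blast
      then show ?thesis
        using v[of w] coord_other_edge[OF 2(1) _ 2(2) w, of e] coord_other_edge[OF 2(1) _ 2(2) w, of f] 3
        by metis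
    qed (use 2 e f in auto)
  qed
  then show ?thesis using that[of ?c ?d] e f coord_vertex_01 by blast
qed

lemma successively_edges_rtrancl:
  "successively (\<lambda>c d. {c, d} \<in> F) (u # xs) \<Longrightarrow> (u, last (u # xs)) \<in> (adj F)\<^sup>*"
proof (induction xs arbitrary: u)
  case (Cons w xs)
  then have "(u, w) \<in> adj F" "(w, last (w # xs)) \<in> (adj F)\<^sup>*" by (auto simp: adj_def)
  then show ?case by (metis converse_rtrancl_into_rtrancl last_ConsR list.distinct(1))
qed simp

lemma betw_path_step:
  assumes "{u, v} \<in> E" "(v, w) \<in> (adj (E - {{u, v}}))\<^sup>*"
  shows "betw E (vertex_point u) (vertex_point v) (vertex_point w)"
  unfolding betw_def
proof
  fix e assume e: "e \<in> E"
  show "sep E e (vertex_point u) (vertex_point v) + sep E e (vertex_point v) (vertex_point w) =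
      sep E e (vertex_point u) (vertex_point w)"
  proof (cases "e = {u, v}")
    case True
    then have "v \<in> branch E e \<longleftrightarrow> w \<in> branch E e" using branch_edge_rtrancl assms(2) by blast
    then show ?thesis by (simp add: sep_def coord_vertex)
  next
    case False
    then have "u \<in> branch E e \<longleftrightarrow> v \<in> branch E e"
      using branch_other_edge[OF assms(1)] by blast
    then show ?thesis by (simp add: sep_def coord_vertex)
  qed
qed

lemma simple_path_betw:
  assumes "successively (\<lambda>c d. {c, d} \<in> E) (u # v # xs)" "distinct (u # v # xs)"
  shows "betw E (vertex_point u) (vertex_point v) (vertex_point (last (v # xs)))"
proof (rule betw_path_step)
  show "{u, v} \<in> E" using assms by simp
  have "successively (\<lambda>c d. {c, d} \<in> E - {{u, v}}) (v # xs)"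
  proof (rule successively_mono)
    show "successively (\<lambda>c d. {c, d} \<in> E) (v # xs)" using assms by simp
    show "{x, y} \<in> E - {{u, v}}" if "x \<in> set (v # xs)" "y \<in> set (v # xs)" "{x, y} \<in> E" for x y
      using that assms(2) by (auto simp: doubleton_eq_iff)
  qed
  then show "(v, last (v # xs)) \<in> (adj (E - {{u, v}}))\<^sup>*" by (rule successively_edges_rtrancl)
qed

text \<open>Outside the cell the coordinate of \<open>y\<close> is 0 or 1, like that of an end of
  \<open>e\<close>; the other edges do not distinguish \<open>x\<close> from that end.\<close>

lemma betw_cell_end:
  assumes "e \<in> E" "x \<in> cell e" "y \<in> P" "y \<notin> cell e"
  obtains a where "a \<in> e" "betw E x (vertex_point a) y"
proof -
  obtain a b where ab: "e = {a, b}" "a \<in> branch E e" "b \<notin> branch E e"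
    using coord_edge[OF assms(1,2)] by blast
  have "coord E e y \<in> {0, 1}" using coord_01_or_cell assms by blast
  then have "\<exists>c\<in>e. coord E e (vertex_point c) = coord E e y"
    using ab coord_vertex[of E e a] coord_vertex[of E e b] by auto
  then obtain c where c: "c \<in> e" "coord E e (vertex_point c) = coord E e y" by blast
  have "betw E x (vertex_point c) y"
    unfolding betw_def
  proof
    fix f assume "f \<in> E"
    show "sep E f x (vertex_point c) + sep E f (vertex_point c) y = sep E f x y"
    proof (cases "f = e")
      case True
      then show ?thesis using c by (simp add: sep_def)
    next
      case False
      then have "coord E f x = coord E f (vertex_point c)"
        using coord_other_edge[OF assms(1) False assms(2) c(1)] by simp
      then show ?thesis by (simp add: sep_def)
    qed
  qed
  then show ?thesis using c that by blast
qed

text \<open>Induction along the simple path from \<open>u\<close> to \<open>w\<close>, peeling off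
  one edge at a time; in a tree the second vertex of a simple path lies between the first and the
  last.\<close>

lemma vertex_points_induct:
  assumes uw: "u \<in> V" "w \<in> V"
    and refl: "\<And>v. v \<in> V \<Longrightarrow> R v v"
    and edge: "\<And>u v. {u, v} \<in> E \<Longrightarrow> R u v"
    and trans: "\<And>u v w. {u, v} \<in> E \<Longrightarrow> w \<in> V \<Longrightarrow> R u v \<Longrightarrow> R v w \<Longrightarrow>
      betw E (vertex_point u) (vertex_point v) (vertex_point w) \<Longrightarrow> R u w"
  shows "R u w"
proof -
  have "(u, w) \<in> (adj E)\<^sup>*" using connected uw by blast
  then obtain xs where xs: "xs \<noteq> []" "hd xs = u" "last xs = w" "distinct xs"
    "successively (\<lambda>a b. {a, b} \<in> E) xs"
    by (rule rtrancl_simple_path)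
  then show ?thesis using uw(1)
  proof (induction xs arbitrary: u)
    case (Cons v xs)
    then have [simp]: "v = u" by simp
    show ?case
    proof (cases xs)
      case Nil
      then show ?thesis using Cons refl by simp
    next
      case (Cons v' ys)
      have uv: "{u, v'} \<in> E" using Cons.prems Cons by simp
      have v': "v' \<in> V" using uv edge_verts by blast
      have "R v' w" using Cons.IH[of v'] Cons.prems Cons v' by simp
      moreover have "betw E (vertex_point u) (vertex_point v') (vertex_point w)"
        using simple_path_betw[of u v' ys] Cons Cons.prems by simp
      ultimately show ?thesis using trans[OF uv uw(2) edge[OF uv]] by blast
    qed
  qed simp
qed

text \<open>Whatever is inherited by concatenation of segments need only be checked inside single
  edges: a segment is cut at the ends of the edges containing its extremities.\<close>

lemma points_induct [consumes 2, case_names vertex cell trans]: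
  assumes xy: "x \<in> P" "y \<in> P"
    and vertex: "\<And>v. v \<in> V \<Longrightarrow> R (vertex_point v) (vertex_point v)"
    and cell: "\<And>e x y. e \<in> E \<Longrightarrow> x \<in> cell e \<Longrightarrow> y \<in> cell e \<Longrightarrow> R x y"
    and trans: "\<And>x m y. x \<in> P \<Longrightarrow> m \<in> P \<Longrightarrow> y \<in> P \<Longrightarrow> betw E x m y \<Longrightarrow> R x m \<Longrightarrow> R m y \<Longrightarrow> R x y"
  shows "R x y"
proof -
  have vv: "R (vertex_point u) (vertex_point w)" if "u \<in> V" "w \<in> V" for u w
  proof (rule vertex_points_induct[OF that, where R = "\<lambda>u w. R (vertex_point u) (vertex_point w)"])
    show "R (vertex_point u) (vertex_point v)" if "{u, v} \<in> E" for u v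
      using that by (intro cell[OF that]) auto
    then show "R (vertex_point u) (vertex_point w)"
      if "{u, v} \<in> E" "w \<in> V" "R (vertex_point u) (vertex_point v)" "R (vertex_point v) (vertex_point w)"
        "betw E (vertex_point u) (vertex_point v) (vertex_point w)" for u v w
      using trans[OF _ _ _ that(5)] that edge_verts vertex_point_in_points by blast
  qed (rule vertex)
  have vx: "R (vertex_point u) y" if u: "u \<in> V" and y: "y \<in> P" for u y
    using y
  proof (cases rule: points_cases)
    case (2 e)
    show ?thesis
    proof (cases "vertex_point u \<in> cell e")
      case True
      then show ?thesis using cell 2 by blast
    next
      case False
      then obtain a where a: "a \<in> e" "betw E y (vertex_point a) (vertex_point u)"
        using betw_cell_end[OF 2] u vertex_point_in_points by blast
      then have aV: "a \<in> V" using 2 edge_verts by blast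
      have "vertex_point a \<in> cell e" using a 2 finite_edge by simp
      then show ?thesis
        using trans[of "vertex_point u" "vertex_point a" y] vv[OF u aV] cell[OF 2(1) _ 2(2)] a u y aV
          vertex_point_in_points betw_commute by blast
    qed
  qed (use vv u in simp)
  show ?thesis
    using xy(1)
  proof (cases rule: points_cases)
    case (2 e)
    show ?thesis
    proof (cases "y \<in> cell e")
      case True
      then show ?thesis using cell 2 by blast
    next
      case False
      then obtain a where a: "a \<in> e" "betw E x (vertex_point a) y"
        using betw_cell_end[OF 2] xy by blast
      then have aV: "a \<in> V" using 2 edge_verts by blast
      have "vertex_point a \<in> cell e" using a 2 finite_edge by simp
      then show ?thesis
        using trans[of x "vertex_point a" y] vx[OF aV xy(2)] cell[OF 2(1,2)] a xy aV
          vertex_point_in_points by blast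
    qed
  qed (use vx xy in simp)
qed

end

section \<open>The distance in coordinates\<close>

text \<open>The weights \<open>l\<close> are arbitrary: the same sum serves for the lengths of a
  tree, for the degenerate lengths of a closed cone and for the indicator of an edge orbit.\<close>

definition wdist :: "'v set set \<Rightarrow> ('v set \<Rightarrow> real) \<Rightarrow> ('v \<Rightarrow> real) \<Rightarrow> ('v \<Rightarrow> real) \<Rightarrow> real" where
  "wdist E l x y = (\<Sum>e | e \<in> E \<and> sep E e x y \<noteq> 0. l e * sep E e x y)"

lemma wdist_commute: "wdist E l x y = wdist E l y x"
  by (simp add: wdist_def sep_commute[of E _ x y])

lemma wdist_self [simp]: "wdist E l x x = 0"
  by (simp add: wdist_def)

lemma wdist_nonneg: "(\<And>e. e \<in> E \<Longrightarrow> 0 \<le> l e) \<Longrightarrow> 0 \<le> wdist E l x y"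
  by (auto simp: wdist_def intro!: sum_nonneg)

lemma wdist_sum:
  assumes "finite F" "{e \<in> E. sep E e x y \<noteq> 0} \<subseteq> F" "F \<subseteq> E"
  shows "wdist E l x y = (\<Sum>e\<in>F. l e * sep E e x y)"
  unfolding wdist_def using assms by (intro sum.mono_neutral_left) auto

lemma sum_lessThan_add: "(\<Sum>i<m + n. f i) = (\<Sum>i<m. f i) + (\<Sum>i<n. f (m + i))"
  for f :: "nat \<Rightarrow> 'a::comm_monoid_add"
  by (induction n) (simp_all add: add.assoc)

text \<open>The four-point condition on a line: if the interval spanned by \<open>a\<close> and
  \<open>b\<close> met the one spanned by \<open>c\<close> and \<open>d\<close>, the first sum could
  not exceed the second.\<close>

lemma separated_pairs_on_line:
  fixes a b c d :: real
  assumes "\<bar>a - c\<bar> + \<bar>b - d\<bar> > \<bar>a - b\<bar> + \<bar>c - d\<bar>"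
  shows "(a < c \<and> a < d \<and> b < c \<and> b < d) \<or> (c < a \<and> c < b \<and> d < a \<and> d < b)"
  using assms by linarith

context simplicial_tree
begin

lemma sep_other_cell:
  assumes "e \<in> E" "x \<in> cell e" "y \<in> cell e" "f \<noteq> e"
  shows "sep E f x y = 0"
proof -
  obtain v where "v \<in> e" using edge_cases[OF assms(1)] by blast
  then show ?thesis
    using coord_other_edge[of e f x v] coord_other_edge[of e f y v] assms by (simp add: sep_def)
qed

lemma cell_coord_eqI:
  assumes "e \<in> E" "x \<in> cell e" "y \<in> cell e" "coord E e x = coord E e y"
  shows "x = y"
proof
  fix v
  obtain a b where a: "e = {a, b}" "a \<noteq> b" "x a = coord E e x" "x b = 1 - coord E e x"
     "a \<in> branch E e" "b \<notin> branch E e"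
    using coord_edge[OF assms(1,2)] by blast
  obtain c d where c: "e = {c, d}" "c \<noteq> d" "y c = coord E e y" "y d = 1 - coord E e y"
     "c \<in> branch E e" "d \<notin> branch E e"
    using coord_edge[OF assms(1,3)] by blast
  have "c = a" "d = b" using a c by (auto simp: doubleton_eq_iff)
  then show "x v = y v" using a c assms by (cases "v \<in> e") (auto simp: cell_def)
qed

lemma seg_length_eq:
  assumes "e \<in> E" "x \<in> cell e" "y \<in> cell e"
  shows "seg_length T e x y = len T e * sep E e x y"
proof -
  obtain a b where a: "e = {a, b}" "a \<noteq> b" "x a = coord E e x" "x b = 1 - coord E e x"
     "a \<in> branch E e" "b \<notin> branch E e"
    using coord_edge[OF assms(1,2)] by blast
  obtain c d where c: "e = {c, d}" "c \<noteq> d" "y c = coord E e y" "y d = 1 - coord E e y"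
     "c \<in> branch E e" "d \<notin> branch E e"
    using coord_edge[OF assms(1,3)] by blast
  have "c = a" "d = b" using a c by (auto simp: doubleton_eq_iff)
  then have "(\<Sum>v\<in>e. \<bar>x v - y v\<bar>) = \<bar>x a - y a\<bar> + \<bar>x b - y b\<bar>" using a by simp
  also have "\<dots> = 2 * sep E e x y" using a c \<open>c = a\<close> \<open>d = b\<close> by (simp add: sep_def abs_minus_commute)
  finally show ?thesis by (simp add: seg_length_def)
qed

lemma finite_sep:
  assumes "x \<in> P" "y \<in> P"
  shows "finite {e \<in> E. sep E e x y \<noteq> 0}"
  using assms
proof (induction rule: points_induct)
  case (cell e x y)
  then have "{f \<in> E. sep E f x y \<noteq> 0} \<subseteq> {e}" using sep_other_cell by blast
  then show ?case by (rule finite_subset) simp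
next
  case (trans x m y)
  have "{e \<in> E. sep E e x y \<noteq> 0} \<subseteq> {e \<in> E. sep E e x m \<noteq> 0} \<union> {e \<in> E. sep E e m y \<noteq> 0}"
    using trans(4) by (force simp: betw_def)
  then show ?case using trans by (meson finite_UnI finite_subset)
qed simp

lemma sep_eq_0_imp_eq:
  assumes "x \<in> P" "y \<in> P" "\<And>e. e \<in> E \<Longrightarrow> sep E e x y = 0"
  shows "x = y"
proof -
  have "(\<forall>e\<in>E. sep E e x y = 0) \<longrightarrow> x = y"
    using assms(1,2)
  proof (induction rule: points_induct)
    case (cell e x y)
    then show ?case using cell_coord_eqI by (auto simp: sep_def)
  next
    case (trans x m y)
    show ?case
    proof
      assume 0: "\<forall>e\<in>E. sep E e x y = 0"
      have "sep E e x m = 0 \<and> sep E e m y = 0" if "e \<in> E" for e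
        using betw_sepD[OF trans(4) that] bspec[OF 0 that] sep_nonneg[of E e x m] sep_nonneg[of E e m y]
        by linarith
      then show "x = y" using trans by blast
    qed
  qed simp
  then show ?thesis using assms by blast
qed

text \<open>A common finite index set, independent of \<open>l\<close>, turns identities and
  inequalities between several distances into statements about each single edge.\<close>

lemma wdist_common_sum:
  assumes "finite X" "X \<subseteq> P" "finite K" "K \<subseteq> E"
  obtains F where "finite F" "K \<subseteq> F" "F \<subseteq> E"
    "\<And>l x y. x \<in> X \<Longrightarrow> y \<in> X \<Longrightarrow> wdist E l x y = (\<Sum>e\<in>F. l e * sep E e x y)"
proof (rule that)
  let ?F = "K \<union> (\<Union>x\<in>X. \<Union>y\<in>X. {e \<in> E. sep E e x y \<noteq> 0})"
  show "finite ?F" using assms finite_sep by blast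
  then show "wdist E l x y = (\<Sum>e\<in>?F. l e * sep E e x y)" if "x \<in> X" "y \<in> X" for l x y
    using that assms(4) by (intro wdist_sum) auto
qed (use assms in auto)

lemma wdist_sep_le:
  assumes "x \<in> P" "y \<in> P" "\<And>e. e \<in> E \<Longrightarrow> 0 \<le> l e" "e \<in> E"
  shows "l e * sep E e x y \<le> wdist E l x y"
proof (cases "sep E e x y = 0")
  case True
  then show ?thesis using assms by (simp add: wdist_nonneg)
next
  case False
  then show ?thesis unfolding wdist_def using assms finite_sep
    by (intro member_le_sum) auto
qed

text \<open>Each edge contributes a nonnegative amount to the defect of the triangle inequality, so
  a small defect bounds the backtracking inside any one edge.\<close>

lemma wdist_defect_ge:
  assumes "x \<in> P" "y \<in> P" "z \<in> P" "\<And>e. e \<in> E \<Longrightarrow> 0 \<le> l e" "e \<in> E"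
  shows "l e * (sep E e x y + sep E e y z - sep E e x z) \<le> wdist E l x y + wdist E l y z - wdist E l x z"
proof -
  obtain F where F: "finite F" "{e} \<subseteq> F" "F \<subseteq> E" and eq: "\<And>l p q. p \<in> {x, y, z} \<Longrightarrow> q \<in> {x, y, z} \<Longrightarrow>
      wdist E l p q = (\<Sum>e\<in>F. l e * sep E e p q)"
    by (rule wdist_common_sum[of "{x, y, z}" "{e}"]) (use assms in auto)
  let ?d = "\<lambda>e. l e * (sep E e x y + sep E e y z - sep E e x z)"
  have "wdist E l x y + wdist E l y z - wdist E l x z = (\<Sum>e\<in>F. ?d e)"
    by (simp add: eq algebra_simps sum.distrib sum_subtractf)
  moreover have "0 \<le> ?d f" if "f \<in> F" for f
  proof (rule mult_nonneg_nonneg)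
    show "0 \<le> l f" using assms(4) F(3) that by blast
    show "0 \<le> sep E f x y + sep E f y z - sep E f x z" using sep_triangle[of E f x z y] by linarith
  qed
  then have "?d e \<le> (\<Sum>e\<in>F. ?d e)" using F(1,2) by (intro member_le_sum) auto
  ultimately show ?thesis by simp
qed

lemma wdist_triangle:
  assumes "x \<in> P" "y \<in> P" "z \<in> P" "\<And>e. e \<in> E \<Longrightarrow> 0 \<le> l e"
  shows "wdist E l x z \<le> wdist E l x y + wdist E l y z"
proof -
  obtain F where F: "F \<subseteq> E" and eq: "\<And>l p q. p \<in> {x, y, z} \<Longrightarrow> q \<in> {x, y, z} \<Longrightarrow>
      wdist E l p q = (\<Sum>e\<in>F. l e * sep E e p q)"
    by (rule wdist_common_sum[of "{x, y, z}" "{}"]) (use assms in auto)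
  have "(\<Sum>e\<in>F. l e * sep E e x z) \<le> (\<Sum>e\<in>F. l e * sep E e x y + l e * sep E e y z)"
    using F assms(4) by (intro sum_mono) (metis distrib_left mult_left_mono sep_triangle subsetD)
  then show ?thesis by (simp add: eq sum.distrib)
qed

lemma wdist_add_cong:
  assumes P: "x \<in> P" "y \<in> P" "z \<in> P" "w \<in> P"
    and eq: "\<And>e. e \<in> E \<Longrightarrow> sep E e x w + sep E e y z = sep E e x z + sep E e y w"
  shows "wdist E l x w + wdist E l y z = wdist E l x z + wdist E l y w"
proof -
  obtain F where F: "F \<subseteq> E" and d: "\<And>l p q. p \<in> {x, y, z, w} \<Longrightarrow> q \<in> {x, y, z, w} \<Longrightarrow>
      wdist E l p q = (\<Sum>e\<in>F. l e * sep E e p q)"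
    by (rule wdist_common_sum[of "{x, y, z, w}" "{}"]) (use P in auto)
  have "(\<Sum>e\<in>F. l e * (sep E e x w + sep E e y z)) = (\<Sum>e\<in>F. l e * (sep E e x z + sep E e y w))"
    using F by (intro sum.cong refl) (metis eq subsetD)
  then show ?thesis by (simp add: d distrib_left sum.distrib)
qed

lemma wdist_betw:
  assumes "x \<in> P" "m \<in> P" "y \<in> P" "betw E x m y"
  shows "wdist E l x y = wdist E l x m + wdist E l m y"
  using wdist_add_cong[of x m m y l] assms betw_sepD[OF assms(4)] by simp

lemma wdist_eq_0_iff:
  assumes "x \<in> P" "y \<in> P" "\<And>e. e \<in> E \<Longrightarrow> 0 < l e"
  shows "wdist E l x y = 0 \<longleftrightarrow> x = y"
proof
  assume 0: "wdist E l x y = 0"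
  show "x = y"
  proof (rule sep_eq_0_imp_eq[OF assms(1,2)])
    fix e assume e: "e \<in> E"
    then have "l e * sep E e x y \<le> 0" using wdist_sep_le[OF assms(1,2), of l e] assms(3) 0
      by (metis less_eq_real_def)
    then show "sep E e x y = 0"
      using assms(3)[OF e] sep_nonneg[of E e x y] by (simp add: mult_le_0_iff)
  qed
qed simp

text \<open>Positive lengths let equality of distances descend to every edge; an edge of length 0
  would go unnoticed.\<close>

lemma wdist_additive_imp_betw:
  assumes "x \<in> P" "m \<in> P" "y \<in> P" "\<And>e. e \<in> E \<Longrightarrow> 0 < l e"
    and "wdist E l x m + wdist E l m y \<le> wdist E l x y"
  shows "betw E x m y"
  unfolding betw_def
proof
  fix e assume e: "e \<in> E"
  have "l e * (sep E e x m + sep E e m y - sep E e x y) \<le> 0"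
    using wdist_defect_ge[of x m y l e] assms e by (simp add: less_imp_le)
  then have "sep E e x m + sep E e m y - sep E e x y \<le> 0"
    using assms(4)[OF e] by (simp add: mult_le_0_iff)
  then show "sep E e x m + sep E e m y = sep E e x y" using sep_triangle[of E e x y m] by linarith
qed

lemma wdist_cell:
  assumes "e \<in> E" "x \<in> cell e" "y \<in> cell e"
  shows "wdist E l x y = l e * sep E e x y"
proof -
  have "{f \<in> E. sep E f x y \<noteq> 0} \<subseteq> {e}" using sep_other_cell[OF assms] by blast
  then show ?thesis using wdist_sum[of "{e}" E x y l] assms by simp
qed

lemma tdist_chain:
  assumes "x \<in> P" "y \<in> P"
  shows "\<exists>n p e. wdist E (len T) x y = (\<Sum>i<n. seg_length T (e i) (p i) (p (Suc i))) \<and>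
    p 0 = x \<and> p n = y \<and> (\<forall>i<n. e i \<in> E \<and> p i \<in> cell (e i) \<and> p (Suc i) \<in> cell (e i))"
  using assms
proof (induction rule: points_induct)
  case (vertex v)
  show ?case by (intro exI[of _ "0::nat"] exI[of _ "\<lambda>_. vertex_point v"]) simp
next
  case (cell e x y)
  show ?case using cell
    by (intro exI[of _ "1::nat"] exI[of _ "\<lambda>i. if i = 0 then x else y"] exI[of _ "\<lambda>_. e"])
      (simp add: seg_length_eq wdist_cell)
next
  case (trans x m y)
  obtain n p e n' p' e' where
    1: "wdist E (len T) x m = (\<Sum>i<n. seg_length T (e i) (p i) (p (Suc i)))" "p 0 = x" "p n = m"
      "\<And>i. i < n \<Longrightarrow> e i \<in> E \<and> p i \<in> cell (e i) \<and> p (Suc i) \<in> cell (e i)" and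
    2: "wdist E (len T) m y = (\<Sum>i<n'. seg_length T (e' i) (p' i) (p' (Suc i)))" "p' 0 = m" "p' n' = y"
      "\<And>i. i < n' \<Longrightarrow> e' i \<in> E \<and> p' i \<in> cell (e' i) \<and> p' (Suc i) \<in> cell (e' i)"
    using trans(5,6) by blast
  define q where "q i = (if i \<le> n then p i else p' (i - n))" for i
  define f where "f i = (if i < n then e i else e' (i - n))" for i
  have q: "q (n + i) = p' i" for i using 1(3) 2(2) by (auto simp: q_def)
  have q': "q (Suc (n + i)) = p' (Suc i)" for i using q[of "Suc i"] by simp
  have "(\<Sum>i<n + n'. seg_length T (f i) (q i) (q (Suc i))) = wdist E (len T) x m + wdist E (len T) m y"
    unfolding sum_lessThan_add 1(1) 2(1) q q' by (simp add: f_def q_def)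
  also have "\<dots> = wdist E (len T) x y" using wdist_betw[OF trans(1-4)] by simp
  finally have "wdist E (len T) x y = (\<Sum>i<n + n'. seg_length T (f i) (q i) (q (Suc i)))" by simp
  moreover have "f i \<in> E \<and> q i \<in> cell (f i) \<and> q (Suc i) \<in> cell (f i)" if "i < n + n'" for i
  proof (cases "i < n")
    case True
    then show ?thesis using 1(4)[of i] by (simp add: f_def q_def)
  next
    case False
    then obtain j where "i = n + j" "j < n'" using \<open>i < n + n'\<close> by (metis add_diff_inverse_nat nat_add_left_cancel_less)
    then show ?thesis using 2(4)[of j] q[of j] q'[of j] by (simp add: f_def)
  qed
  moreover have "q 0 = x" "q (n + n') = y" using 1(2) 2(3) q[of n'] by (simp_all add: q_def)
  ultimately show ?case by (intro exI[of _ "n + n'"] exI[of _ q] exI[of _ f]) blast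
qed

text \<open>The broken line along the segment attains the value, and by the triangle inequality no
  broken line is shorter. Lengths may vanish, so the formula also computes the pseudo-distances of
  closed cones.\<close>

lemma tdist_eq_wdist:
  assumes "x \<in> P" "y \<in> P" "\<And>e. e \<in> E \<Longrightarrow> 0 \<le> len T e"
  shows "tdist T x y = wdist E (len T) x y"
  unfolding tdist_def
proof (rule cInf_eq_minimum)
  show "wdist E (len T) x y \<in> {(\<Sum>i<n. seg_length T (e i) (p i) (p (Suc i))) | (n::nat) p e.
            p 0 = x \<and> p n = y \<and> (\<forall>i<n. e i \<in> E \<and> p i \<in> cell (e i) \<and> p (Suc i) \<in> cell (e i))}"
    using tdist_chain[OF assms(1,2)] by blast
  fix s assume "s \<in> {(\<Sum>i<n. seg_length T (e i) (p i) (p (Suc i))) | (n::nat) p e.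
            p 0 = x \<and> p n = y \<and> (\<forall>i<n. e i \<in> E \<and> p i \<in> cell (e i) \<and> p (Suc i) \<in> cell (e i))}"
  then obtain n p e where s: "s = (\<Sum>i<n. seg_length T (e i) (p i) (p (Suc i)))" "p 0 = x" "p n = y"
    "\<forall>i<n. e i \<in> E \<and> p i \<in> cell (e i) \<and> p (Suc i) \<in> cell (e i)" by blast
  have "p m \<in> P \<and> wdist E (len T) x (p m) \<le> (\<Sum>i<m. seg_length T (e i) (p i) (p (Suc i)))"
    if "m \<le> n" for m
    using that
  proof (induction m)
    case (Suc m)
    have e: "e m \<in> E" "p m \<in> cell (e m)" "p (Suc m) \<in> cell (e m)" using s(4) Suc by auto
    then have "wdist E (len T) (p m) (p (Suc m)) = seg_length T (e m) (p m) (p (Suc m))"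
      by (simp add: seg_length_eq wdist_cell)
    moreover have "p (Suc m) \<in> P" using e cell_subset_points by blast
    ultimately show ?case
      using wdist_triangle[of x "p m" "p (Suc m)" "len T"] Suc assms by simp
  qed (use assms s in simp)
  then show "wdist E (len T) x y \<le> s" using s by blast
qed

section \<open>Segments, projections and the four-point condition\<close>

lemma segment_point:
  assumes "x \<in> P" "y \<in> P" "\<And>e. e \<in> E \<Longrightarrow> 0 \<le> l e" "0 \<le> t" "t \<le> wdist E l x y"
  obtains z where "z \<in> P" "betw E x z y" "wdist E l x z = t"
proof -
  have "\<forall>t. 0 \<le> t \<and> t \<le> wdist E l x y \<longrightarrow> (\<exists>z\<in>P. betw E x z y \<and> wdist E l x z = t)"
    using assms(1,2)
  proof (induction rule: points_induct)
    case (vertex v)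
    then show ?case using vertex_point_in_points betw_left by fastforce
  next
    case (cell e x y)
    show ?case
    proof (intro allI impI)
      fix t assume t: "0 \<le> t \<and> t \<le> wdist E l x y"
      have w: "wdist E l p q = l e * sep E e p q" if "p \<in> cell e" "q \<in> cell e" for p q
        using wdist_cell[OF cell(1) that] .
      have xP: "x \<in> P" "y \<in> P" using cell cell_subset_points by blast+
      show "\<exists>z\<in>P. betw E x z y \<and> wdist E l x z = t"
      proof (cases "wdist E l x y = 0")
        case True
        then show ?thesis using xP t by (intro bexI[of _ x]) auto
      next
        case False
        \<comment> \<open>Inside one edge the point is an affine combination of barycentric
          coordinates; the fraction \<open>s\<close> requires a nonzero distance.\<close>
        define s where "s = t / wdist E l x y"
        have s: "0 \<le> s" "s \<le> 1" using t False by (auto simp: s_def divide_simps)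
        define z where "z v = (1 - s) * x v + s * y v" for v
        have z: "z \<in> cell e"
          using cell(2,3) s by (auto simp: cell_def z_def sum.distrib simp flip: sum_distrib_left)
        have "coord E e z = (1 - s) * coord E e x + s * coord E e y"
          unfolding coord_cell[OF finite_edge[OF cell(1)] z] coord_cell[OF finite_edge[OF cell(1)] cell(2)]
            coord_cell[OF finite_edge[OF cell(1)] cell(3)] z_def
          by (simp add: sum.distrib sum_distrib_left)
        then have c: "coord E e x - coord E e z = s * (coord E e x - coord E e y)"
          "coord E e z - coord E e y = (1 - s) * (coord E e x - coord E e y)"
          by (simp_all add: algebra_simps)
        then have sp: "sep E e x z = s * sep E e x y" "sep E e z y = (1 - s) * sep E e x y"
          unfolding sep_def c abs_mult using s by simp_all
        have "betw E x z y"
          unfolding betw_def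
        proof
          fix f assume "f \<in> E"
          show "sep E f x z + sep E f z y = sep E f x y"
            using sep_other_cell[of e _ _ f] cell z sp by (cases "f = e") (auto simp: algebra_simps)
        qed
        moreover have "wdist E l x z = t"
          using w[OF cell(2) z] w[OF cell(2,3)] sp s_def False by (simp add: field_simps)
        ultimately show ?thesis using z cell_subset_points cell by blast
      qed
    qed
  next
    case (trans x m y)
    show ?case
    proof (intro allI impI)
      fix t assume t: "0 \<le> t \<and> t \<le> wdist E l x y"
      have s: "wdist E l x y = wdist E l x m + wdist E l m y" using wdist_betw[OF trans(1-4)] .
      show "\<exists>z\<in>P. betw E x z y \<and> wdist E l x z = t"
      proof (cases "t \<le> wdist E l x m")
        case True
        then obtain z where "z \<in> P" "betw E x z m" "wdist E l x z = t" using trans(5) t by blast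
        then show ?thesis using betw_trans(1)[OF trans(4)] by blast
      next
        case False
        then obtain z where z: "z \<in> P" "betw E m z y" "wdist E l m z = t - wdist E l x m"
          using trans(6)[rule_format, of "t - wdist E l x m"] t s by auto
        have b: "betw E y z x" "betw E z m x"
          using betw_trans[of E y m x z] trans(4) z betw_commute by blast+
        then have "wdist E l x z = t"
          using wdist_betw[of z m x l] z trans wdist_commute[of E l] by simp
        then show ?thesis using z b betw_commute by blast
      qed
    qed
  qed
  then show ?thesis using assms that by blast
qed

text \<open>No path joins \<open>s\<close> to \<open>t\<close> without passing \<open>x\<close>, so
  \<open>x\<close> cuts \<open>u\<close> off from one of them. In coordinates: an edge
  \<open>e\<close> violating the first alternative and an edge \<open>f\<close> violating the second
  cannot coexist, because the image under two distinct edge coordinates is L-shaped.\<close>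

lemma betw_split:
  assumes P: "s \<in> P" "x \<in> P" "t \<in> P" "u \<in> P" and b: "betw E s x t"
  shows "betw E s x u \<or> betw E u x t"
proof (rule ccontr)
  assume "\<not> (betw E s x u \<or> betw E u x t)"
  then obtain e f where e: "e \<in> E" "sep E e s x + sep E e x u \<noteq> sep E e s u"
    and f: "f \<in> E" "sep E f u x + sep E f x t \<noteq> sep E f u t"
    by (auto simp: betw_def)
  have be: "sep E e s x + sep E e x t = sep E e s t" and bf: "sep E f s x + sep E f x t = sep E f s t"
    using betw_sepD[OF b] e f by auto
  show False
  proof (cases "e = f")
    case True
    show ?thesis using e f be unfolding True sep_def by linarith
  next
    case False
    then obtain c d where c: "c \<in> {0, 1}" "d \<in> {0, 1}"
      "\<And>x. x \<in> P \<Longrightarrow> coord E e x = c \<or> coord E f x = d"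
      using coord_nested[OF e(1) f(1)] by metis
    have e0: "(coord E e s < coord E e x \<and> coord E e u < coord E e x) \<or>
      (coord E e s > coord E e x \<and> coord E e u > coord E e x)"
      using e(2) unfolding sep_def by linarith
    have f0: "(coord E f t < coord E f x \<and> coord E f u < coord E f x) \<or>
      (coord E f t > coord E f x \<and> coord E f u > coord E f x)"
      using f(2) unfolding sep_def by linarith
    show False
    proof (cases "coord E e x = c")
      case True
      then have "coord E f u = d" "coord E f s = d" using c(3)[OF P(4)] c(3)[OF P(1)] e0 by auto
      then show False using f0 bf unfolding sep_def by linarith
    next
      case False
      then have "coord E f x = d" using c(3)[OF P(2)] by blast
      then have "coord E e u = c" "coord E e t = c" using c(3)[OF P(4)] c(3)[OF P(3)] f0 by auto
      then show False using e0 be unfolding sep_def by linarith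
    qed
  qed
qed

text \<open>Otherwise \<open>z\<close> lies on the segments from \<open>v\<close> to
  \<open>s\<close> and from \<open>v\<close> to \<open>t\<close>, which meet only in
  \<open>v\<close>; so \<open>z\<close> is \<open>v\<close>, and \<open>betw_split\<close> at
  \<open>v\<close> concludes.\<close>

lemma betw_hull:
  assumes P: "s \<in> P" "v \<in> P" "t \<in> P" "z \<in> P" "w \<in> P" and b: "betw E s v t" "betw E v z w"
  shows "betw E s z w \<or> betw E t z w"
proof (rule ccontr)
  assume n: "\<not> (betw E s z w \<or> betw E t z w)"
  then have z: "betw E v z s" "betw E v z t"
    using betw_split[OF P(2,4,5,1) b(2)] betw_split[OF P(2,4,5,3) b(2)] by blast+
  have "sep E e v z = 0" if "e \<in> E" for e
    using betw_sepD[OF b(1) that] betw_sepD[OF z(1) that] betw_sepD[OF z(2) that]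
    unfolding sep_def by linarith
  then have "v = z" using sep_eq_0_imp_eq P by blast
  then show False using n betw_split[OF P(1,2,3,5) b(1)] betw_commute by metis
qed

text \<open>By \<open>betw_split\<close> the point \<open>x\<close> lies on the way from
  \<open>u\<close> to \<open>s\<close> or to \<open>t\<close>, so one of the two triangle
  inequalities is sharp. Hence the distances of \<open>u\<close> to the ends of a segment determine
  those to all its points.\<close>

lemma wdist_to_segment:
  assumes P: "s \<in> P" "x \<in> P" "t \<in> P" "u \<in> P" and b: "betw E s x t"
    and l: "\<And>e. e \<in> E \<Longrightarrow> 0 \<le> l e"
  shows "wdist E l x u = max (wdist E l s u - wdist E l s x) (wdist E l t u - wdist E l t x)"
proof -
  have "wdist E l s u \<le> wdist E l s x + wdist E l x u" "wdist E l t u \<le> wdist E l t x + wdist E l x u"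
    using wdist_triangle P l by auto
  moreover have "wdist E l s u = wdist E l s x + wdist E l x u \<or> wdist E l t u = wdist E l t x + wdist E l x u"
    using betw_split[OF P b] wdist_betw P betw_commute by metis
  ultimately show ?thesis by (auto simp: max_def)
qed

lemma betw_unique:
  assumes P: "x \<in> P" "y \<in> P" "z \<in> P" "z' \<in> P" and b: "betw E x z y" "betw E x z' y"
    and l: "\<And>e. e \<in> E \<Longrightarrow> 0 < l e" and eq: "wdist E l x z = wdist E l x z'"
  shows "z = z'"
proof -
  have "wdist E l y z = wdist E l y z'"
    using wdist_betw[OF P(1,3,2) b(1), of l] wdist_betw[OF P(1,4,2) b(2), of l] eq
    by (simp add: wdist_commute[of E l y])
  then have "wdist E l z z' = 0"
    using wdist_to_segment[OF P(1,3,2,4) b(1), of l] l eq by (simp add: less_imp_le)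
  then show ?thesis using wdist_eq_0_iff P l by blast
qed

text \<open>The last hypothesis bounds the distance from \<open>q\<close> by the Gromov product of
  \<open>x\<close> and \<open>y\<close> at \<open>q\<close>, which is the length of the common
  beginning of the two segments.\<close>

lemma common_initial_segment:
  assumes P: "q \<in> P" "x \<in> P" "y \<in> P" "z \<in> P" "z' \<in> P" and b: "betw E q z x" "betw E q z' y"
    and l: "\<And>e. e \<in> E \<Longrightarrow> 0 < l e" and eq: "wdist E l q z = wdist E l q z'"
    and le: "2 * wdist E l q z \<le> wdist E l q x + wdist E l q y - wdist E l x y"
  shows "z = z'"
proof -
  have "betw E q z y"
    using betw_split[OF P(1,4,2,3) b(1)]
  proof
    assume "betw E y z x"
    then have "wdist E l x y = wdist E l x z + wdist E l z y"
      using wdist_betw[OF P(3,4,2), of l] wdist_commute[of E l y x] wdist_commute[of E l y z]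
        wdist_commute[of E l z x] by linarith
    moreover have "wdist E l q x = wdist E l q z + wdist E l z x" using wdist_betw[OF P(1,4,2) b(1)] .
    ultimately have "wdist E l q z + wdist E l z y \<le> wdist E l q y"
      using le wdist_commute[of E l x z] by linarith
    then show ?thesis using l by (intro wdist_additive_imp_betw[OF P(1,4,3), where l = l])
  qed
  then show ?thesis
    by (rule betw_unique[OF P(1,3,4,5) _ b(2), where l = l]) (use l eq in auto)
qed

lemma strictly_separated_pairs:
  assumes P: "x \<in> P" "y \<in> P" "z \<in> P" "w \<in> P" and f: "f \<in> E"
    and gt: "sep E f x z + sep E f y w > sep E f x y + sep E f z w" and e: "e \<in> E"
  shows "sep E e x w + sep E e y z = sep E e x z + sep E e y w"
    and "e \<noteq> f \<Longrightarrow> sep E e x y = 0 \<or> sep E e z w = 0"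
proof -
  have f': "(coord E f x < coord E f z \<and> coord E f x < coord E f w \<and> coord E f y < coord E f z \<and> coord E f y < coord E f w) \<or>
    (coord E f z < coord E f x \<and> coord E f z < coord E f y \<and> coord E f w < coord E f x \<and> coord E f w < coord E f y)"
    using separated_pairs_on_line[where a = "coord E f x" and b = "coord E f y" and c = "coord E f z"
        and d = "coord E f w"] gt
    unfolding sep_def by blast
  have ne: "(coord E e x = coord E e y) \<or> (coord E e z = coord E e w)" if ef: "e \<noteq> f"
  proof -
    obtain c d where c: "c \<in> {0, 1}" "d \<in> {0, 1}" "\<And>x. x \<in> P \<Longrightarrow> coord E e x = c \<or> coord E f x = d"
      by (rule coord_nested[OF e f ef]) blast
    \<comment> \<open>The exceptional value \<open>d\<close> of the coordinate along
      \<open>f\<close> cannot be taken in both pairs.\<close>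
    consider "coord E f x \<noteq> d" "coord E f y \<noteq> d" | "coord E f z \<noteq> d" "coord E f w \<noteq> d"
      using f' by linarith
    then show ?thesis using c(3)[OF P(1)] c(3)[OF P(2)] c(3)[OF P(3)] c(3)[OF P(4)] by cases auto
  qed
  then show "e \<noteq> f \<Longrightarrow> sep E e x y = 0 \<or> sep E e z w = 0" by (auto simp: sep_def)
  show "sep E e x w + sep E e y z = sep E e x z + sep E e y w"
  proof (cases "e = f")
    case True
    show ?thesis using f' unfolding True sep_def by linarith
  qed (use ne in \<open>auto simp: sep_def\<close>)
qed

lemma wdist_separated_pairs:
  assumes P: "x \<in> P" "y \<in> P" "z \<in> P" "w \<in> P" and l: "\<And>e. e \<in> E \<Longrightarrow> 0 \<le> l e"
    and gt: "wdist E l x z + wdist E l y w > wdist E l x y + wdist E l z w"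
  obtains f where "f \<in> E" "sep E f x z + sep E f y w > sep E f x y + sep E f z w"
proof -
  obtain F where F: "F \<subseteq> E" and eq: "\<And>l p q. p \<in> {x, y, z, w} \<Longrightarrow> q \<in> {x, y, z, w} \<Longrightarrow>
      wdist E l p q = (\<Sum>e\<in>F. l e * sep E e p q)"
    by (rule wdist_common_sum[of "{x, y, z, w}" "{}"]) (use P in auto)
  have "(\<Sum>e\<in>F. l e * (sep E e x y + sep E e z w)) < (\<Sum>e\<in>F. l e * (sep E e x z + sep E e y w))"
    using gt by (simp add: eq distrib_left sum.distrib)
  then obtain f where "f \<in> F" "l f * (sep E f x y + sep E f z w) < l f * (sep E f x z + sep E f y w)"
    by (meson sum_mono not_le)
  moreover from this have "0 < l f" using l F by (metis less_eq_real_def mult_zero_left order_less_irrefl subsetD)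
  ultimately show ?thesis using that F by auto
qed

text \<open>An edge \<open>f\<close> other than \<open>e\<close> sees all of \<open>e\<close> at one
  coordinate, and since \<open>e\<close> distinguishes \<open>x\<close> from \<open>y\<close>, one
  of these has that coordinate too. So only \<open>e\<close> itself has to be tested.\<close>

lemma edge_end_betw:
  assumes P: "x \<in> P" "y \<in> P" and e: "e \<in> E" "a \<in> e"
    and ne: "coord E e x \<noteq> coord E e y" and b: "sep E e x (vertex_point a) + sep E e (vertex_point a) y = sep E e x y"
  shows "betw E x (vertex_point a) y"
  unfolding betw_def
proof
  fix f assume f: "f \<in> E"
  show "sep E f x (vertex_point a) + sep E f (vertex_point a) y = sep E f x y"
  proof (cases "f = e")
    case False
    obtain c d where c: "\<And>x. x \<in> cell e \<Longrightarrow> coord E f x = c" "\<And>x. x \<in> P \<Longrightarrow> coord E f x = c \<or> coord E e x = d"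
      by (rule coord_nested[OF f e(1) False]) blast
    have "vertex_point a \<in> cell e" using e finite_edge by simp
    then have "coord E f (vertex_point a) = c" using c by blast
    moreover have "coord E f x = c \<or> coord E f y = c" using c(2)[OF P(1)] c(2)[OF P(2)] ne by auto
    ultimately show ?thesis by (auto simp: sep_def)
  qed (use b in simp)
qed

end

section \<open>The action\<close>

locale metric_tree = group G for G :: "('g, 'b) monoid_scheme" (structure) +
  fixes T :: "('g, 'v) gtree"
  assumes metric: "metric_gtree G T"
begin

sublocale simplicial_tree T
  using metric by unfold_locales (simp add: metric_gtree_def)

sublocale va: group_action G "verts T" "act T"
  using metric by (simp add: metric_gtree_def)

abbreviation "pact \<equiv> point_act G T"

lemma act_closed [simp]: "g \<in> carrier G \<Longrightarrow> v \<in> V \<Longrightarrow> act T g v \<in> V"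
  by (rule va.element_image) auto

lemma act_mult: "g \<in> carrier G \<Longrightarrow> h \<in> carrier G \<Longrightarrow> v \<in> V \<Longrightarrow> act T (g \<otimes> h) v = act T g (act T h v)"
  by (rule va.composition_rule)

lemma act_one [simp]: "v \<in> V \<Longrightarrow> act T \<one> v = v"
  using va.id_eq_one by (metis restrict_apply')

lemma act_inv [simp]:
  "g \<in> carrier G \<Longrightarrow> v \<in> V \<Longrightarrow> act T (inv g) (act T g v) = v"
  "g \<in> carrier G \<Longrightarrow> v \<in> V \<Longrightarrow> act T g (act T (inv g) v) = v"
  by (simp_all flip: act_mult)

lemma act_eq_iff [simp]: "g \<in> carrier G \<Longrightarrow> v \<in> V \<Longrightarrow> w \<in> V \<Longrightarrow> act T g v = act T g w \<longleftrightarrow> v = w"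
  by (metis act_inv(1))

lemma edge_act_closed: "g \<in> carrier G \<Longrightarrow> e \<in> E \<Longrightarrow> edge_act T g e \<in> E"
  using metric by (simp add: metric_gtree_def)

lemma edge_subset_verts: "e \<in> E \<Longrightarrow> e \<subseteq> V"
  using edge_verts by blast

lemma edge_act_mult:
  "g \<in> carrier G \<Longrightarrow> h \<in> carrier G \<Longrightarrow> e \<in> E \<Longrightarrow> edge_act T (g \<otimes> h) e = edge_act T g (edge_act T h e)"
  using edge_subset_verts by (force simp: edge_act_def image_image act_mult)

lemma edge_act_one: "e \<in> E \<Longrightarrow> edge_act T \<one> e = e"
  using edge_subset_verts by (force simp: edge_act_def)

lemma edge_act_inv:
  assumes "g \<in> carrier G" "e \<in> E"
  shows "edge_act T (inv g) (edge_act T g e) = e" "edge_act T g (edge_act T (inv g) e) = e"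
  using assms by (simp_all add: edge_act_one flip: edge_act_mult)

lemma edge_act_doubleton: "edge_act T g {a, b} = {act T g a, act T g b}"
  by (simp add: edge_act_def)

lemma edge_act_bij: "g \<in> carrier G \<Longrightarrow> bij_betw (edge_act T g) E E"
  by (rule bij_betw_byWitness[where f' = "edge_act T (inv g)"]) (auto simp: edge_act_inv edge_act_closed)

lemma edge_orbit_act: "g \<in> carrier G \<Longrightarrow> e \<in> E \<Longrightarrow> orbit G (edge_act T) (edge_act T g e) = orbit G (edge_act T) e"
proof -
  assume g: "g \<in> carrier G" and e: "e \<in> E"
  have "edge_act T h (edge_act T g e) \<in> orbit G (edge_act T) e" if "h \<in> carrier G" for h
    using that g e unfolding orbit_def by (auto intro!: exI[of _ "h \<otimes> g"] simp: edge_act_mult)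
  moreover have "edge_act T h e \<in> orbit G (edge_act T) (edge_act T g e)" if "h \<in> carrier G" for h
    using that g e unfolding orbit_def
    by (auto intro!: exI[of _ "h \<otimes> inv g"] simp: edge_act_mult edge_act_closed edge_act_inv)
  ultimately show ?thesis unfolding orbit_def by blast
qed

lemma edge_in_orbit: "e \<in> E \<Longrightarrow> e \<in> orbit G (edge_act T) e"
  unfolding orbit_def using edge_act_one by force

lemma edge_orbit_in: "e \<in> E \<Longrightarrow> orbit G (edge_act T) e \<in> edge_orbits G T"
  by (auto simp: edge_orbits_def orbits_def)

lemma edge_orbit_eqI:
  assumes "e \<in> E" "f \<in> orbit G (edge_act T) e"
  shows "orbit G (edge_act T) f = orbit G (edge_act T) e"
proof -
  obtain g where "g \<in> carrier G" "f = edge_act T g e" using assms(2) unfolding orbit_def by blast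
  then show ?thesis using edge_orbit_act assms(1) by simp
qed

lemma len_edge_act [simp]: "g \<in> carrier G \<Longrightarrow> e \<in> E \<Longrightarrow> len T (edge_act T g e) = len T e"
  using metric by (simp add: metric_gtree_def)

lemma len_pos [simp]: "e \<in> E \<Longrightarrow> 0 < len T e"
  using metric by (simp add: metric_gtree_def)

lemma len_nonneg [simp]: "e \<in> E \<Longrightarrow> 0 \<le> len T e"
  using len_pos by (simp add: less_imp_le)

lemma no_inversion:
  assumes "{u, v} \<in> E" "g \<in> carrier G" "edge_act T g {u, v} = {u, v}"
  shows "act T g u = u" "act T g v = v"
proof -
  have "u \<noteq> v" using assms(1) by (auto elim: edge_cases)
  moreover have "\<not> (act T g u = v \<and> act T g v = u)"
    using metric assms(1,2) \<open>u \<noteq> v\<close> unfolding metric_gtree_def no_inversions_def by blast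
  ultimately show "act T g u = u" "act T g v = v"
    using assms(3) by (auto simp: edge_act_doubleton doubleton_eq_iff)
qed

lemma point_outside: "x \<in> P \<Longrightarrow> v \<notin> V \<Longrightarrow> x v = 0"
  by (erule points_cases) (use edge_subset_verts in \<open>auto simp: vertex_point_def cell_def\<close>)

lemma point_support:
  assumes "x \<in> P"
  obtains s where "finite s" "s \<subseteq> V" "x \<in> cell s"
  using assms
proof (cases rule: points_cases)
  case (1 v)
  then show ?thesis using that[of "{v}"] by simp
next
  case (2 e)
  then show ?thesis using that[of e] finite_edge edge_subset_verts by simp
qed

lemma pact_cell:
  assumes "g \<in> carrier G" "s \<subseteq> V" "x \<in> cell s"
  shows "pact g x \<in> cell (act T g ` s)"
proof -
  have inj: "inj_on (act T g) s" using assms by (auto simp: inj_on_def subset_iff)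
  have "(\<Sum>v\<in>act T g ` s. pact g x v) = (\<Sum>v\<in>s. x v)"
    unfolding sum.reindex[OF inj] using assms
    by (intro sum.cong) (auto simp: point_act_def)
  moreover have "pact g x v = 0" if "v \<notin> act T g ` s" for v
  proof (cases "v \<in> V")
    case True
    then have "act T (inv g) v \<notin> s" using that assms act_inv(2)[of g v] by (metis image_eqI)
    then show ?thesis using assms by (simp add: point_act_def cell_def)
  qed (simp add: point_act_def)
  ultimately show ?thesis using assms by (auto simp: cell_def point_act_def)
qed

lemma pact_edge_cell: "g \<in> carrier G \<Longrightarrow> e \<in> E \<Longrightarrow> x \<in> cell e \<Longrightarrow> pact g x \<in> cell (edge_act T g e)"
  using pact_cell edge_subset_verts unfolding edge_act_def by blast

lemma pact_vertex: "g \<in> carrier G \<Longrightarrow> v \<in> V \<Longrightarrow> pact g (vertex_point v) = vertex_point (act T g v)"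
  using pact_cell[of g "{v}" "vertex_point v"] by simp

lemma pact_closed:
  assumes "g \<in> carrier G" "x \<in> P"
  shows "pact g x \<in> P"
  using assms(2)
proof (cases rule: points_cases)
  case (1 v)
  then show ?thesis using assms pact_vertex vertex_point_in_points by simp
next
  case (2 e)
  then show ?thesis
    using assms pact_edge_cell[of g e x] edge_act_closed[of g e] cell_subset_points by blast
qed

lemma pact_mult: "g \<in> carrier G \<Longrightarrow> h \<in> carrier G \<Longrightarrow> pact (g \<otimes> h) x = pact g (pact h x)"
  by (auto simp: point_act_def fun_eq_iff inv_mult_group act_mult)

lemma pact_one: "x \<in> P \<Longrightarrow> pact \<one> x = x"
  by (auto simp: point_act_def fun_eq_iff point_outside)

lemma pact_inv:
  assumes "g \<in> carrier G" "x \<in> P"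
  shows "pact (inv g) (pact g x) = x" "pact g (pact (inv g) x) = x"
  using assms by (simp_all add: pact_one flip: pact_mult)

lemma act_rtrancl:
  assumes "(u, v) \<in> (adj (E - {e}))\<^sup>*" "g \<in> carrier G" "e \<in> E"
  shows "(act T g u, act T g v) \<in> (adj (E - {edge_act T g e}))\<^sup>*"
  using assms(1)
proof (induction rule: rtrancl_induct)
  case (step y z)
  have yz: "{y, z} \<in> E" "{y, z} \<noteq> e" using step by (auto simp: adj_def)
  then have "edge_act T g {y, z} \<in> E" "edge_act T g {y, z} \<noteq> edge_act T g e"
    using assms edge_act_closed edge_act_bij[of g] by (auto simp: bij_betw_def inj_on_def)
  then have "(act T g y, act T g z) \<in> adj (E - {edge_act T g e})"
    by (simp add: adj_def edge_act_doubleton)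
  then show ?case using step by (meson rtrancl.rtrancl_into_rtrancl)
qed simp

text \<open>\<open>branch\<close> selects an arbitrary end of each edge, so it is not equivariant;
  what the action preserves is the relation of lying on the same side of an edge.\<close>

lemma same_branch_act:
  assumes "g \<in> carrier G" "e \<in> E" "v \<in> V" "w \<in> V"
  shows "(act T g v \<in> branch E (edge_act T g e) \<longleftrightarrow> act T g w \<in> branch E (edge_act T g e)) \<longleftrightarrow>
    (v \<in> branch E e \<longleftrightarrow> w \<in> branch E e)"
proof -
  obtain a where a: "a \<in> e" "(a, v) \<in> (adj (E - {e}))\<^sup>*" using edge_side[OF assms(2,3)] .
  obtain b where b: "b \<in> e" "(b, w) \<in> (adj (E - {e}))\<^sup>*" using edge_side[OF assms(2,4)] .
  note ga = branch_edge_rtrancl[OF act_rtrancl[OF a(2) assms(1,2)]] branch_edge_rtrancl[OF a(2)]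
  note gb = branch_edge_rtrancl[OF act_rtrancl[OF b(2) assms(1,2)]] branch_edge_rtrancl[OF b(2)]
  show ?thesis
  proof (cases "a = b")
    case True
    then show ?thesis using ga gb by blast
  next
    case False
    then have e: "e = {a, b}" using a b assms(2) by (auto elim!: edge_cases)
    have "{act T g a, act T g b} \<in> E" using edge_act_closed assms e by (metis edge_act_doubleton)
    then show ?thesis using branch_ends[of a b] branch_ends[of "act T g a" "act T g b"] ga gb assms(2)
      unfolding e edge_act_doubleton by blast
  qed
qed

text \<open>An edge may be carried to its image with the selected end reversed; a single vertex
  decides which case occurs, and the answer is the same for all points. \<open>sep\<close> does not
  notice the reversal.\<close>

lemma coord_act:
  assumes "g \<in> carrier G" "e \<in> E"
  shows "(\<forall>x\<in>P. coord E (edge_act T g e) (pact g x) = coord E e x) \<or>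
    (\<forall>x\<in>P. coord E (edge_act T g e) (pact g x) = 1 - coord E e x)"
proof -
  let ?B = "branch E (edge_act T g e)"
  have c: "coord E (edge_act T g e) (pact g x) = (\<Sum>v\<in>{v \<in> s. act T g v \<in> ?B}. x v)"
    if s: "finite s" "s \<subseteq> V" "x \<in> cell s" for x s
  proof -
    have inj: "inj_on (act T g) s" using assms s by (auto simp: inj_on_def subset_iff)
    have "coord E (edge_act T g e) (pact g x) = (\<Sum>v\<in>act T g ` s \<inter> ?B. pact g x v)"
      using coord_cell[OF _ pact_cell[OF assms(1) s(2,3)]] s(1) by blast
    also have "act T g ` s \<inter> ?B = act T g ` {v \<in> s. act T g v \<in> ?B}" by blast
    also have "(\<Sum>v\<in>\<dots>. pact g x v) = (\<Sum>v\<in>{v \<in> s. act T g v \<in> ?B}. pact g x (act T g v))"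
      using inj by (intro sum.reindex_cong[of "act T g"]) (auto simp: inj_on_def)
    also have "\<dots> = (\<Sum>v\<in>{v \<in> s. act T g v \<in> ?B}. x v)"
      using s assms by (intro sum.cong) (auto simp: point_act_def)
    finally show ?thesis .
  qed
  obtain a where a: "a \<in> V" using assms edge_cases by blast
  show ?thesis
  proof (cases "act T g a \<in> ?B \<longleftrightarrow> a \<in> branch E e")
    case True
    have "coord E (edge_act T g e) (pact g x) = coord E e x" if x: "x \<in> P" for x
    proof -
      obtain s where s: "finite s" "s \<subseteq> V" "x \<in> cell s" using point_support[OF x] .
      have "{v \<in> s. act T g v \<in> ?B} = s \<inter> branch E e"
        using same_branch_act[OF assms _ a] True s by blast
      then show ?thesis using c[OF s] coord_cell[OF s(1,3)] by simp
    qed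
    then show ?thesis by blast
  next
    case False
    have "coord E (edge_act T g e) (pact g x) = 1 - coord E e x" if x: "x \<in> P" for x
    proof -
      obtain s where s: "finite s" "s \<subseteq> V" "x \<in> cell s" using point_support[OF x] .
      have "{v \<in> s. act T g v \<in> ?B} = s - branch E e"
        using same_branch_act[OF assms _ a] False s by blast
      moreover have "(\<Sum>v\<in>s - branch E e. x v) + (\<Sum>v\<in>s \<inter> branch E e. x v) = (\<Sum>v\<in>s. x v)"
        using s(1) by (subst sum.union_disjoint[symmetric]) (auto intro!: sum.cong)
      ultimately show ?thesis using c[OF s] coord_cell[OF s(1,3), of E e] s(3) by (simp add: cell_def)
    qed
    then show ?thesis by blast
  qed
qed

lemma sep_act:
  assumes "g \<in> carrier G" "e \<in> E" "x \<in> P" "y \<in> P"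
  shows "sep E (edge_act T g e) (pact g x) (pact g y) = sep E e x y"
  using coord_act[OF assms(1,2)] assms(3,4) by (auto simp: sep_def)

lemma betw_act:
  assumes "g \<in> carrier G" "x \<in> P" "m \<in> P" "y \<in> P" "betw E x m y"
  shows "betw E (pact g x) (pact g m) (pact g y)"
  unfolding betw_def
proof
  fix e assume e: "e \<in> E"
  let ?f = "edge_act T (inv g) e"
  have f: "?f \<in> E" "edge_act T g ?f = e" using e assms edge_act_closed edge_act_inv by auto
  show "sep E e (pact g x) (pact g m) + sep E e (pact g m) (pact g y) = sep E e (pact g x) (pact g y)"
    using sep_act[OF assms(1) f(1)] assms betw_sepD[OF assms(5) f(1)] unfolding f(2) by simp
qed

lemma wdist_act:
  assumes "g \<in> carrier G" "x \<in> P" "y \<in> P" "\<And>e. e \<in> E \<Longrightarrow> l (edge_act T g e) = l e"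
  shows "wdist E l (pact g x) (pact g y) = wdist E l x y"
proof -
  let ?S = "{e \<in> E. sep E e x y \<noteq> 0}"
  have inj: "inj_on (edge_act T g) ?S"
    using edge_act_bij[OF assms(1)] by (auto simp: bij_betw_def intro: inj_on_subset)
  have img: "{e \<in> E. sep E e (pact g x) (pact g y) \<noteq> 0} = edge_act T g ` ?S"
  proof (intro equalityI subsetI)
    fix e assume e: "e \<in> {e \<in> E. sep E e (pact g x) (pact g y) \<noteq> 0}"
    let ?f = "edge_act T (inv g) e"
    have f: "?f \<in> E" "edge_act T g ?f = e" using e assms edge_act_closed edge_act_inv by auto
    then show "e \<in> edge_act T g ` ?S"
      using sep_act[OF assms(1) f(1) assms(2,3)] e by (intro image_eqI[of _ _ ?f]) auto
  qed (use assms sep_act edge_act_closed in auto)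
  show ?thesis unfolding wdist_def img sum.reindex[OF inj]
    using assms sep_act by (intro sum.cong) auto
qed

end

section \<open>Convex hulls and closed cones\<close>

context simplicial_tree
begin

lemma edge_betw:
  assumes "{a, b} \<in> E" "x \<in> cell {a, b}"
  shows "betw E (vertex_point a) x (vertex_point b)"
  unfolding betw_def
proof
  fix f assume f: "f \<in> E"
  have ab: "vertex_point a \<in> cell {a, b}" "vertex_point b \<in> cell {a, b}" by auto
  show "sep E f (vertex_point a) x + sep E f x (vertex_point b) = sep E f (vertex_point a) (vertex_point b)"
  proof (cases "f = {a, b}")
    case True
    have "a \<in> branch E f \<longleftrightarrow> b \<notin> branch E f" using branch_ends assms(1) True by blast
    moreover have "0 \<le> coord E f x" "coord E f x \<le> 1"
      using coord_bounds f assms cell_subset_points by blast+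
    ultimately show ?thesis by (auto simp: sep_def coord_vertex)
  next
    case False
    then have "sep E f p q = 0" if "p \<in> cell {a, b}" "q \<in> cell {a, b}" for p q
      using sep_other_cell[OF assms(1) that] by blast
    then show ?thesis using ab assms(2) by simp
  qed
qed

text \<open>A vertex between \<open>x\<close> and \<open>y\<close> is determined by which of the
  finitely many edges separating \<open>x\<close> from \<open>y\<close> have it in their
  branch.\<close>

lemma finite_betw_vertices:
  assumes "x \<in> P" "y \<in> P"
  shows "finite {v \<in> V. betw E x (vertex_point v) y}"
proof -
  let ?F = "{e \<in> E. sep E e x y \<noteq> 0}" and ?\<phi> = "\<lambda>v. {e \<in> E. sep E e x y \<noteq> 0 \<and> v \<in> branch E e}"
  have "inj_on ?\<phi> {v \<in> V. betw E x (vertex_point v) y}"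
  proof (rule inj_onI)
    fix v w assume v: "v \<in> {v \<in> V. betw E x (vertex_point v) y}" and w: "w \<in> {v \<in> V. betw E x (vertex_point v) y}"
      and eq: "?\<phi> v = ?\<phi> w"
    have "vertex_point v = vertex_point w"
    proof (rule sep_eq_0_imp_eq)
      fix e assume e: "e \<in> E"
      have bv: "sep E e x (vertex_point v) + sep E e (vertex_point v) y = sep E e x y"
        and bw: "sep E e x (vertex_point w) + sep E e (vertex_point w) y = sep E e x y"
        using v w betw_sepD e by blast+
      show "sep E e (vertex_point v) (vertex_point w) = 0"
      proof (cases "sep E e x y = 0")
        case True
        then show ?thesis using bv bw unfolding sep_def by linarith
      next
        case False
        then have "v \<in> branch E e \<longleftrightarrow> w \<in> branch E e" using eq e by blast
        then show ?thesis by (simp add: sep_def coord_vertex)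
      qed
    qed (use v w vertex_point_in_points in auto)
    then show "v = w" by simp
  qed
  moreover have "?\<phi> ` {v \<in> V. betw E x (vertex_point v) y} \<subseteq> Pow ?F" by blast
  ultimately show ?thesis using finite_sep[OF assms] by (meson finite_Pow_iff inj_on_finite)
qed

end

context metric_tree
begin

lemma tdist_eq: "x \<in> P \<Longrightarrow> y \<in> P \<Longrightarrow> tdist T x y = wdist E (len T) x y"
  by (rule tdist_eq_wdist) auto

lemma tdist_eq_0_iff: "x \<in> P \<Longrightarrow> y \<in> P \<Longrightarrow> tdist T x y = 0 \<longleftrightarrow> x = y"
  using wdist_eq_0_iff by (simp add: tdist_eq)

text \<open>A convex invariant set of vertices, together with the edges joining them, is an
  invariant subtree, so minimality applies.\<close>

lemma vertex_in_hull:
  assumes W: "W \<subseteq> V" "W \<noteq> {}" and inv: "\<And>g w. g \<in> carrier G \<Longrightarrow> w \<in> W \<Longrightarrow> act T g w \<in> W"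
    and conv: "\<And>u v w. u \<in> W \<Longrightarrow> w \<in> W \<Longrightarrow> v \<in> V \<Longrightarrow>
      betw E (vertex_point u) (vertex_point v) (vertex_point w) \<Longrightarrow> v \<in> W"
  shows "W = V"
proof -
  define F where "F = {e \<in> E. e \<subseteq> W}"
  have "F \<subseteq> E" by (auto simp: F_def)
  have conn: "(u, w) \<in> (adj F)\<^sup>*" if "u \<in> W" "w \<in> W" for u w
  proof -
    have "u \<in> W \<longrightarrow> w \<in> W \<longrightarrow> (u, w) \<in> (adj F)\<^sup>*"
    proof (rule vertex_points_induct[where R = "\<lambda>u w. u \<in> W \<longrightarrow> w \<in> W \<longrightarrow> (u, w) \<in> (adj F)\<^sup>*"])
      show "u \<in> V" "w \<in> V" using that W by auto
      show "u \<in> W \<longrightarrow> v \<in> W \<longrightarrow> (u, v) \<in> (adj F)\<^sup>*" if "{u, v} \<in> E" for u v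
        using that by (auto simp: adj_def F_def intro!: r_into_rtrancl)
      show "u \<in> W \<longrightarrow> w \<in> W \<longrightarrow> (u, w) \<in> (adj F)\<^sup>*"
        if "{u, v} \<in> E" "w \<in> V" "u \<in> W \<longrightarrow> v \<in> W \<longrightarrow> (u, v) \<in> (adj F)\<^sup>*"
          "v \<in> W \<longrightarrow> w \<in> W \<longrightarrow> (v, w) \<in> (adj F)\<^sup>*"
          "betw E (vertex_point u) (vertex_point v) (vertex_point w)" for u v w
        using conv[of u w v] that edge_verts by (meson insertCI rtrancl_trans)
    qed simp
    then show ?thesis using that by blast
  qed
  have "is_tree W F"
    unfolding is_tree_def
  proof (intro conjI)
    show "F \<subseteq> {{u, v} | u v. u \<in> W \<and> v \<in> W \<and> u \<noteq> v}"
    proof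
      fix e assume "e \<in> F"
      then have e: "e \<in> E" "e \<subseteq> W" by (auto simp: F_def)
      obtain a b where "e = {a, b}" "a \<noteq> b" using edge_cases[OF e(1)] by metis
      with e(2) show "e \<in> {{u, v} | u v. u \<in> W \<and> v \<in> W \<and> u \<noteq> v}" by blast
    qed
    show "\<forall>u\<in>W. \<forall>v\<in>W. (u, v) \<in> {(a, b). {a, b} \<in> F}\<^sup>*" using conn by (simp add: adj_def)
    show "\<not> (\<exists>(n::nat) p. n \<ge> 3 \<and> inj_on p {..<n} \<and> (\<forall>i<n. {p i, p (Suc i mod n)} \<in> F))"
    proof
      assume "\<exists>(n::nat) p. n \<ge> 3 \<and> inj_on p {..<n} \<and> (\<forall>i<n. {p i, p (Suc i mod n)} \<in> F)"
      then obtain n p where "(n::nat) \<ge> 3 \<and> inj_on p {..<n} \<and> (\<forall>i<n. {p i, p (Suc i mod n)} \<in> E)"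
        by (auto simp: F_def)
      then have "\<exists>(n::nat) p. n \<ge> 3 \<and> inj_on p {..<n} \<and> (\<forall>i<n. {p i, p (Suc i mod n)} \<in> E)"
        by (intro exI)
      then show False using is_tree unfolding is_tree_def by simp
    qed
  qed (rule W)
  moreover have "edge_act T g e \<in> F" if "g \<in> carrier G" "e \<in> F" for g e
    using that edge_act_closed[of g e] inv[OF that(1)] by (auto simp: F_def edge_act_def subset_iff)
  moreover have "W \<subseteq> V \<and> F \<subseteq> E \<and> is_tree W F \<and>
      (\<forall>g\<in>carrier G. (\<forall>w\<in>W. act T g w \<in> W) \<and> (\<forall>e\<in>F. edge_act T g e \<in> F)) \<longrightarrow> W = V \<and> F = E"
    using metric unfolding metric_gtree_def minimal_gtree_def by (elim conjE allE)
  ultimately have "W = V \<and> F = E"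
    using W(1) inv \<open>F \<subseteq> E\<close> by blast
  then show ?thesis by blast
qed

lemma hull_convex:
  assumes S: "S \<subseteq> P" and x: "x \<in> P" "s \<in> S" "t \<in> S" "betw E s x t"
    and y: "y \<in> P" "s' \<in> S" "t' \<in> S" "betw E s' y t'" and z: "z \<in> P" "betw E x z y"
  shows "\<exists>p\<in>S. \<exists>q\<in>S. betw E p z q"
proof -
  obtain p where p: "p \<in> S" "betw E p z y"
    using betw_hull[of s x t z y] assms by blast
  then have "betw E y z p" by (simp add: betw_commute)
  then obtain q where "q \<in> S" "betw E q z p"
    using betw_hull[of s' y t' z p] assms p by blast
  then show ?thesis using p by blast
qed

text \<open>The vertices between two elements of \<open>S\<close> form an invariant set, convex by
  \<open>hull_convex\<close>: in a tree, joining points by segments once already gives the convex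
  hull.\<close>

lemma minimal_spanning:
  assumes S: "S \<subseteq> vertex_point ` V" "S \<noteq> {}"
    and inv: "\<And>g x. g \<in> carrier G \<Longrightarrow> x \<in> S \<Longrightarrow> pact g x \<in> S" and x: "x \<in> P"
  shows "\<exists>s\<in>S. \<exists>t\<in>S. betw E s x t"
proof -
  have SP: "S \<subseteq> P" using S vertex_point_in_points by blast
  define W where "W = {v \<in> V. \<exists>s\<in>S. \<exists>t\<in>S. betw E s (vertex_point v) t}"
  have "W = V"
  proof (rule vertex_in_hull)
    show "W \<noteq> {}" using S unfolding W_def by fastforce
    show "act T g w \<in> W" if "g \<in> carrier G" "w \<in> W" for g w
    proof -
      obtain s t where st: "w \<in> V" "s \<in> S" "t \<in> S" "betw E s (vertex_point w) t" using \<open>w \<in> W\<close> W_def by blast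
      then have "betw E (pact g s) (vertex_point (act T g w)) (pact g t)"
        using betw_act[OF that(1) _ _ _ st(4)] SP vertex_point_in_points pact_vertex that(1) by fastforce
      then show ?thesis using st that inv unfolding W_def by auto
    qed
    show "v \<in> W" if "u \<in> W" "w \<in> W" "v \<in> V"
      "betw E (vertex_point u) (vertex_point v) (vertex_point w)" for u v w
      using that hull_convex[OF SP, of "vertex_point u" _ _ "vertex_point w" _ _ "vertex_point v"]
        vertex_point_in_points unfolding W_def by blast
  qed (auto simp: W_def)
  then have vert: "\<exists>s\<in>S. \<exists>t\<in>S. betw E s (vertex_point v) t" if "v \<in> V" for v
    using that W_def by blast
  show ?thesis
    using x
  proof (cases rule: points_cases)
    case (2 e)
    then obtain a b where e: "e = {a, b}" "a \<in> V" "b \<in> V" by (auto elim: edge_cases)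
    then have "betw E (vertex_point a) x (vertex_point b)" using edge_betw 2 by blast
    then show ?thesis
      using hull_convex[OF SP _ _ _ _ _ _ _ _ x] vert[OF e(2)] vert[OF e(3)] vertex_point_in_points e by blast
  qed (use vert in blast)
qed

section \<open>Recognition of the points of a closed cone\<close>

lemma with_lengths_simps [simp]:
  "verts (with_lengths G T l) = V" "edges (with_lengths G T l) = E" "points (with_lengths G T l) = P"
  "len (with_lengths G T l) = (\<lambda>e. l (orbit G (edge_act T) e))"
  by (simp_all add: with_lengths_def points_def)

lemma with_lengths_tree: "simplicial_tree (with_lengths G T l)"
  by unfold_locales (simp add: is_tree)

lemma tdist_with_lengths:
  assumes "x \<in> P" "y \<in> P" "\<And>k. k \<in> edge_orbits G T \<Longrightarrow> 0 \<le> l k"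
  shows "tdist (with_lengths G T l) x y = wdist E (\<lambda>e. l (orbit G (edge_act T) e)) x y"
  using simplicial_tree.tdist_eq_wdist[OF with_lengths_tree, of x l y] assms edge_orbit_in by simp

text \<open>\<open>A\<close> indexes two equivariant configurations, one spanning \<open>T\<close>
  and one spanning \<open>T'\<close>. A point of a segment is located by its distances to the ends,
  so equality of the distances within the configurations determines the whole collapse map from
  \<open>T\<close> to \<open>T'\<close>.\<close>

lemma cone_pointI:
  fixes T' :: "('g, 'v) gtree" and f f' :: "'i \<Rightarrow> 'v \<Rightarrow> real"
  assumes T': "metric_tree G T'"
    and l: "\<And>k. k \<in> edge_orbits G T \<Longrightarrow> 0 \<le> l k"
    and A: "\<And>g u. g \<in> carrier G \<Longrightarrow> u \<in> A \<Longrightarrow> \<alpha> g u \<in> A"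
    and f: "\<And>u. u \<in> A \<Longrightarrow> f u \<in> P" "\<And>g u. g \<in> carrier G \<Longrightarrow> u \<in> A \<Longrightarrow> f (\<alpha> g u) = pact g (f u)"
      "\<And>x. x \<in> P \<Longrightarrow> \<exists>u\<in>A. \<exists>w\<in>A. betw E (f u) x (f w)"
    and f': "\<And>u. u \<in> A \<Longrightarrow> f' u \<in> points T'"
      "\<And>g u. g \<in> carrier G \<Longrightarrow> u \<in> A \<Longrightarrow> f' (\<alpha> g u) = point_act G T' g (f' u)"
      "\<And>x. x \<in> points T' \<Longrightarrow> \<exists>u\<in>A. \<exists>w\<in>A. betw (edges T') (f' u) x (f' w)"
    and eq: "\<And>u w. u \<in> A \<Longrightarrow> w \<in> A \<Longrightarrow> tdist T' (f' u) (f' w) = tdist (with_lengths G T l) (f u) (f w)"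
  shows "T' \<in> cone_point G T l"
proof -
  interpret T': metric_tree G T' by (rule T')
  define lam where "lam e = l (orbit G (edge_act T) e)" for e
  have lam0: "0 \<le> lam e" if "e \<in> E" for e using that edge_orbit_in l by (auto simp: lam_def)
  have lamg: "lam (edge_act T g e) = lam e" if "g \<in> carrier G" "e \<in> E" for g e
    using that edge_orbit_act by (simp add: lam_def)
  let ?d = "wdist E lam" and ?d' = "wdist (edges T') (len T')"
  have d: "tdist (with_lengths G T l) x y = ?d x y" if "x \<in> P" "y \<in> P" for x y
    using tdist_with_lengths[OF that] l by (simp add: lam_def[abs_def])
  have eq: "?d' (f' u) (f' w) = ?d (f u) (f w)" if "u \<in> A" "w \<in> A" for u w
    using eq[OF that] d f(1) f'(1) that by (simp add: T'.tdist_eq)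
  \<comment> \<open>\<open>R\<close> pairs points at the same position on corresponding segments. It
    turns out to be the graph of the collapse map, which is many-to-one when \<open>l\<close>
    vanishes on some orbit.\<close>
  define R where "R x p \<longleftrightarrow> x \<in> P \<and> p \<in> points T' \<and> (\<exists>u\<in>A. \<exists>w\<in>A. betw E (f u) x (f w) \<and>
    betw (edges T') (f' u) p (f' w) \<and> ?d' (f' u) p = ?d (f u) x)" for x p
  have to_vertex: "?d' p (f' a) = ?d x (f a)" if "R x p" "a \<in> A" for x p a
  proof -
    obtain u w where uw: "x \<in> P" "p \<in> points T'" "u \<in> A" "w \<in> A" "betw E (f u) x (f w)"
      "betw (edges T') (f' u) p (f' w)" "?d' (f' u) p = ?d (f u) x" using \<open>R x p\<close> R_def by blast
    have "?d (f u) (f w) = ?d (f u) x + ?d x (f w)" using wdist_betw uw f by blast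
    moreover have "?d' (f' u) (f' w) = ?d' (f' u) p + ?d' p (f' w)" using T'.wdist_betw uw f' by blast
    ultimately have "?d' (f' w) p = ?d (f w) x"
      using eq[OF uw(3,4)] uw(7) wdist_commute[of E lam x "f w"]
        wdist_commute[of "edges T'" "len T'" p "f' w"] by linarith
    then show ?thesis
      using wdist_to_segment[OF f(1)[OF uw(3)] uw(1) f(1)[OF uw(4)] f(1)[OF that(2)] uw(5) lam0]
        T'.wdist_to_segment[OF f'(1)[OF uw(3)] uw(2) f'(1)[OF uw(4)] f'(1)[OF that(2)] uw(6) T'.len_nonneg]
        uw(7) eq[OF uw(3) that(2)] eq[OF uw(4) that(2)] by simp
  qed
  have key: "?d' p q = ?d x y" if "R x p" "R y q" for x y p q
  proof -
    obtain u w where uw: "x \<in> P" "p \<in> points T'" "u \<in> A" "w \<in> A" "betw E (f u) x (f w)"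
      "betw (edges T') (f' u) p (f' w)" using \<open>R x p\<close> R_def by blast
    have y: "y \<in> P" "q \<in> points T'" using \<open>R y q\<close> R_def by blast+
    show ?thesis
      using wdist_to_segment[OF f(1)[OF uw(3)] uw(1) f(1)[OF uw(4)] y(1) uw(5) lam0]
        T'.wdist_to_segment[OF f'(1)[OF uw(3)] uw(2) f'(1)[OF uw(4)] y(2) uw(6) T'.len_nonneg]
        to_vertex[OF that(2) uw(3)] to_vertex[OF that(2) uw(4)]
        to_vertex[OF that(1) uw(3)] to_vertex[OF that(1) uw(4)]
      by (simp add: wdist_commute[of E lam "f _"] wdist_commute[of "edges T'" "len T'" "f' _"])
  qed
  have total: "\<exists>p. R x p" if x: "x \<in> P" for x
  proof -
    obtain u w where uw: "u \<in> A" "w \<in> A" "betw E (f u) x (f w)" using f(3) x by blast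
    have "?d (f u) (f w) = ?d (f u) x + ?d x (f w)" using wdist_betw uw f x by blast
    then have "?d (f u) x \<le> ?d' (f' u) (f' w)" using eq[OF uw(1,2)] wdist_nonneg[of E lam x] lam0 by simp
    then obtain p where "p \<in> points T'" "betw (edges T') (f' u) p (f' w)" "?d' (f' u) p = ?d (f u) x"
      using T'.segment_point[of "f' u" "f' w" "len T'" "?d (f u) x"] f' uw wdist_nonneg[of E lam] lam0
      by (metis T'.len_nonneg)
    then show ?thesis using x uw R_def by blast
  qed
  have onto: "\<exists>x. R x p" if p: "p \<in> points T'" for p
  proof -
    obtain u w where uw: "u \<in> A" "w \<in> A" "betw (edges T') (f' u) p (f' w)" using f'(3) p by blast
    have "?d' (f' u) (f' w) = ?d' (f' u) p + ?d' p (f' w)" using T'.wdist_betw uw f' p by blast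
    then have "?d' (f' u) p \<le> ?d (f u) (f w)" using eq[OF uw(1,2)]
        wdist_nonneg[of "edges T'" "len T'" p] by simp
    then obtain x where "x \<in> P" "betw E (f u) x (f w)" "?d (f u) x = ?d' (f' u) p"
      using segment_point[of "f u" "f w" lam "?d' (f' u) p"] f uw wdist_nonneg[of "edges T'" "len T'"] lam0
      by (metis T'.len_nonneg)
    then show ?thesis using p uw R_def by metis
  qed
  \<comment> \<open>Lengths in \<open>T'\<close> are positive, so distance 0 means equality there,
    whereas \<open>lam\<close> may vanish.\<close>
  have unique: "p = q" if "R x p" "R x q" for x p q
    using key[OF that] T'.wdist_eq_0_iff[of p q "len T'"] that R_def by simp
  have equiv: "R (pact g x) (point_act G T' g p)" if g: "g \<in> carrier G" and "R x p" for g x p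
  proof -
    obtain u w where uw: "x \<in> P" "p \<in> points T'" "u \<in> A" "w \<in> A" "betw E (f u) x (f w)"
      "betw (edges T') (f' u) p (f' w)" "?d' (f' u) p = ?d (f u) x" using \<open>R x p\<close> R_def by blast
    have "?d (f (\<alpha> g u)) (pact g x) = ?d (f u) x" using wdist_act[OF g _ uw(1)] lamg g f uw(3) by simp
    moreover have "?d' (f' (\<alpha> g u)) (point_act G T' g p) = ?d' (f' u) p"
      using T'.wdist_act[OF g _ uw(2)] g f' uw(3) by simp
    moreover have "betw E (f (\<alpha> g u)) (pact g x) (f (\<alpha> g w))"
      using betw_act[OF g _ _ _ uw(5)] f uw g by simp
    moreover have "betw (edges T') (f' (\<alpha> g u)) (point_act G T' g p) (f' (\<alpha> g w))"
      using T'.betw_act[OF g _ _ _ uw(6)] f' uw g by simp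
    ultimately show ?thesis unfolding R_def using pact_closed T'.pact_closed A uw g by metis
  qed
  define \<phi> where "\<phi> x = (SOME p. R x p)" for x
  have \<phi>: "R x (\<phi> x)" if "x \<in> P" for x using total[OF that] unfolding \<phi>_def by (rule someI_ex)
  have "\<phi> ` P = points T'"
  proof
    show "\<phi> ` P \<subseteq> points T'" using \<phi> R_def by blast
    show "points T' \<subseteq> \<phi> ` P"
    proof
      fix p assume "p \<in> points T'"
      then obtain x where "R x p" using onto by blast
      then have "\<phi> x = p" "x \<in> P" using unique \<phi> R_def by blast+
      then show "p \<in> \<phi> ` P" by blast
    qed
  qed
  moreover have "tdist T' (\<phi> x) (\<phi> y) = tdist (with_lengths G T l) x y" if "x \<in> P" "y \<in> P" for x y
  proof -
    have "\<phi> x \<in> points T'" "\<phi> y \<in> points T'" using \<phi> that R_def by blast+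
    then show ?thesis using key[OF \<phi> \<phi>] that d T'.tdist_eq by simp
  qed
  moreover have "\<phi> (pact g x) = point_act G T' g (\<phi> x)" if "g \<in> carrier G" "x \<in> P" for g x
    using unique[OF \<phi> equiv] \<phi> that pact_closed by blast
  ultimately show ?thesis unfolding cone_point_def using T'.metric by blast
qed

end

section \<open>Deformation spaces\<close>

context group
begin

lemma metric_treeI: "metric_gtree G T \<Longrightarrow> metric_tree G T"
  by unfold_locales

lemma equivariant_isometryD:
  assumes "(T, T') \<in> equivariant_isometry G"
  shows "metric_tree G T" "metric_tree G T'"
  using assms metric_treeI by (auto simp: equivariant_isometry_def)

lemma equivariant_isometry_refl: "metric_gtree G T \<Longrightarrow> (T, T) \<in> equivariant_isometry G"
  unfolding equivariant_isometry_def by (auto intro!: exI[of _ "\<lambda>x. x"] simp: bij_betw_def)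

lemma equivariant_isometry_sym:
  assumes "(T, T') \<in> equivariant_isometry G"
  shows "(T', T) \<in> equivariant_isometry G"
proof -
  interpret T: metric_tree G T using assms by (rule equivariant_isometryD)
  interpret T': metric_tree G T' using assms by (rule equivariant_isometryD)
  obtain f where f: "bij_betw f (points T) (points T')"
    "\<And>x y. x \<in> points T \<Longrightarrow> y \<in> points T \<Longrightarrow> tdist T' (f x) (f y) = tdist T x y"
    "\<And>g x. g \<in> carrier G \<Longrightarrow> x \<in> points T \<Longrightarrow> f (point_act G T g x) = point_act G T' g (f x)"
    using assms unfolding equivariant_isometry_def by blast
  let ?h = "inv_into (points T) f"
  have h: "?h y \<in> points T" "f (?h y) = y" if "y \<in> points T'" for y
    using that f(1) by (auto simp: bij_betw_def inv_into_into f_inv_into_f)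
  have "bij_betw ?h (points T') (points T)" using f(1) by (rule bij_betw_inv_into)
  moreover have "tdist T (?h x) (?h y) = tdist T' x y" if "x \<in> points T'" "y \<in> points T'" for x y
    using f(2)[of "?h x" "?h y"] h that by simp
  moreover have "?h (point_act G T' g x) = point_act G T g (?h x)"
    if "g \<in> carrier G" "x \<in> points T'" for g x
  proof -
    have "f (point_act G T g (?h x)) = point_act G T' g x" using f(3) h that by simp
    then show ?thesis using f(1) h T.pact_closed that by (metis bij_betw_inv_into_left)
  qed
  ultimately show ?thesis unfolding equivariant_isometry_def using T.metric T'.metric by blast
qed

lemma equivariant_isometry_trans:
  assumes "(T, T') \<in> equivariant_isometry G" "(T', T'') \<in> equivariant_isometry G"
  shows "(T, T'') \<in> equivariant_isometry G"
proof -
  obtain f where f: "bij_betw f (points T) (points T')"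
    "\<And>x y. x \<in> points T \<Longrightarrow> y \<in> points T \<Longrightarrow> tdist T' (f x) (f y) = tdist T x y"
    "\<And>g x. g \<in> carrier G \<Longrightarrow> x \<in> points T \<Longrightarrow> f (point_act G T g x) = point_act G T' g (f x)"
    using assms(1) unfolding equivariant_isometry_def by blast
  obtain h where h: "bij_betw h (points T') (points T'')"
    "\<And>x y. x \<in> points T' \<Longrightarrow> y \<in> points T' \<Longrightarrow> tdist T'' (h x) (h y) = tdist T' x y"
    "\<And>g x. g \<in> carrier G \<Longrightarrow> x \<in> points T' \<Longrightarrow> h (point_act G T' g x) = point_act G T'' g (h x)"
    using assms(2) unfolding equivariant_isometry_def by blast
  have fP: "f x \<in> points T'" if "x \<in> points T" for x using f(1) that by (auto simp: bij_betw_def)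
  have "bij_betw (h \<circ> f) (points T) (points T'')" using f(1) h(1) by (rule bij_betw_trans)
  moreover have "tdist T'' ((h \<circ> f) x) ((h \<circ> f) y) = tdist T x y" if "x \<in> points T" "y \<in> points T" for x y
    using f(2) h(2) fP that by simp
  moreover have "(h \<circ> f) (point_act G T g x) = point_act G T'' g ((h \<circ> f) x)"
    if "g \<in> carrier G" "x \<in> points T" for g x
    using f(3) h(3) fP that by simp
  moreover have "metric_gtree G T" "metric_gtree G T''"
    using assms unfolding equivariant_isometry_def by auto
  ultimately show ?thesis unfolding equivariant_isometry_def by blast
qed

lemma elliptic_subgroups_mono:
  assumes "(T, T') \<in> equivariant_isometry G"
  shows "elliptic_subgroups G T \<subseteq> elliptic_subgroups G T'"
proof
  fix H assume "H \<in> elliptic_subgroups G T"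
  then obtain x where H: "subgroup H G" "x \<in> points T" "\<And>h. h \<in> H \<Longrightarrow> point_act G T h x = x"
    unfolding elliptic_subgroups_def by blast
  obtain f where f: "bij_betw f (points T) (points T')"
    "\<And>g x. g \<in> carrier G \<Longrightarrow> x \<in> points T \<Longrightarrow> f (point_act G T g x) = point_act G T' g (f x)"
    using assms(1) unfolding equivariant_isometry_def by blast
  have "f x \<in> points T'" using f(1) H by (auto simp: bij_betw_def)
  moreover have "point_act G T' h (f x) = f x" if "h \<in> H" for h
    using f(2)[of h x] H that subgroup.mem_carrier[OF H(1)] by simp
  ultimately show "H \<in> elliptic_subgroups G T'" unfolding elliptic_subgroups_def using H(1) by blast
qed

lemma elliptic_subgroups_eq:
  "(T, T') \<in> equivariant_isometry G \<Longrightarrow> elliptic_subgroups G T = elliptic_subgroups G T'"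
  using elliptic_subgroups_mono equivariant_isometry_sym by blast

text \<open>A metric quotient is unique up to equivariant isometry: two collapse maps identify the
  same points, those at pseudo-distance 0. Thus one member of \<open>cone_point\<close> decides
  which element of a deformation space it is.\<close>

lemma cone_point_eq_class:
  assumes T: "metric_tree G T" and T': "T' \<in> cone_point G T l"
  shows "cone_point G T l = equivariant_isometry G `` {T'}"
proof -
  interpret T: metric_tree G T by (rule T)
  interpret T': metric_tree G T' using T' by (intro metric_treeI) (simp add: cone_point_def)
  let ?d = "tdist (with_lengths G T l)"
  obtain f where f: "f ` points T = points T'"
    "\<And>x y. x \<in> points T \<Longrightarrow> y \<in> points T \<Longrightarrow> tdist T' (f x) (f y) = ?d x y"
    "\<And>g x. g \<in> carrier G \<Longrightarrow> x \<in> points T \<Longrightarrow> f (point_act G T g x) = point_act G T' g (f x)"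
    using T' unfolding cone_point_def by blast
  have fP: "f x \<in> points T'" if "x \<in> points T" for x using f(1) that by blast
  show ?thesis
  proof (intro equalityI subsetI)
    fix S assume S: "S \<in> cone_point G T l"
    interpret S: metric_tree G S using S by (intro metric_treeI) (simp add: cone_point_def)
    obtain h where h: "h ` points T = points S"
      "\<And>x y. x \<in> points T \<Longrightarrow> y \<in> points T \<Longrightarrow> tdist S (h x) (h y) = ?d x y"
      "\<And>g x. g \<in> carrier G \<Longrightarrow> x \<in> points T \<Longrightarrow> h (point_act G T g x) = point_act G S g (h x)"
      using S unfolding cone_point_def by blast
    have hP: "h x \<in> points S" if "x \<in> points T" for x using h(1) that by blast
    \<comment> \<open>A section of the collapse map \<open>f\<close>; since \<open>h\<close> is
      constant on the fibres of \<open>f\<close>, the choice is immaterial.\<close>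
    define j where "j y = inv_into (points T) f y" for y
    have j: "j y \<in> points T" "f (j y) = y" if "y \<in> points T'" for y
      using that f(1) by (auto simp: j_def inv_into_into f_inv_into_f)
    have eq: "h x = h y" if "x \<in> points T" "y \<in> points T" "f x = f y" for x y
    proof -
      have "tdist S (h x) (h y) = 0"
        using f(2)[OF that(1,2)] h(2)[OF that(1,2)] that(3) T'.tdist_eq_0_iff[of "f y" "f y"] fP[OF that(2)]
        by simp
      then show ?thesis using S.tdist_eq_0_iff hP that by simp
    qed
    have dj: "tdist S (h (j x)) (h (j y)) = tdist T' x y" if "x \<in> points T'" "y \<in> points T'" for x y
      using f(2)[of "j x" "j y"] h(2)[of "j x" "j y"] j that by simp
    have "bij_betw (h \<circ> j) (points T') (points S)"
      unfolding bij_betw_def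
    proof
      show "inj_on (h \<circ> j) (points T')"
      proof (rule inj_onI)
        fix x y assume xy: "x \<in> points T'" "y \<in> points T'" "(h \<circ> j) x = (h \<circ> j) y"
        then have "tdist T' x y = 0" 
          using dj[of x y] S.tdist_eq_0_iff[of "h (j y)" "h (j y)"] hP[OF j(1)] by simp
        then show "x = y" using T'.tdist_eq_0_iff xy by simp
      qed
      show "(h \<circ> j) ` points T' = points S"
      proof
        show "(h \<circ> j) ` points T' \<subseteq> points S" using hP j by auto
        show "points S \<subseteq> (h \<circ> j) ` points T'"
        proof
          fix s assume "s \<in> points S"
          then obtain x where x: "x \<in> points T" "s = h x" using h(1) by blast
          then have "h (j (f x)) = s" using eq[of "j (f x)" x] j fP by simp
          then show "s \<in> (h \<circ> j) ` points T'" using fP[OF x(1)] by (metis comp_apply image_eqI)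
        qed
      qed
    qed
    moreover have "(h \<circ> j) (point_act G T' g x) = point_act G S g ((h \<circ> j) x)"
      if "g \<in> carrier G" "x \<in> points T'" for g x
      using eq[of "j (point_act G T' g x)" "point_act G T g (j x)"] that j T.pact_closed T'.pact_closed f(3) h(3)
      by simp
    ultimately show "S \<in> equivariant_isometry G `` {T'}"
      unfolding equivariant_isometry_def using S.metric T'.metric dj by auto
  next
    fix S assume "S \<in> equivariant_isometry G `` {T'}"
    then obtain h where h: "metric_gtree G S" "bij_betw h (points T') (points S)"
      "\<And>x y. x \<in> points T' \<Longrightarrow> y \<in> points T' \<Longrightarrow> tdist S (h x) (h y) = tdist T' x y"
      "\<And>g x. g \<in> carrier G \<Longrightarrow> x \<in> points T' \<Longrightarrow> h (point_act G T' g x) = point_act G S g (h x)"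
      unfolding equivariant_isometry_def by blast
    have "(h \<circ> f) ` points T = points S" using h(2) f(1) by (simp add: bij_betw_def flip: image_image image_comp)
    moreover have "tdist S ((h \<circ> f) x) ((h \<circ> f) y) = ?d x y" if "x \<in> points T" "y \<in> points T" for x y
      using f(2) h(3) fP that by simp
    moreover have "(h \<circ> f) (point_act G T g x) = point_act G S g ((h \<circ> f) x)"
      if "g \<in> carrier G" "x \<in> points T" for g x
      using f(3) h(4) fP that by simp
    ultimately show "S \<in> cone_point G T l" unfolding cone_point_def using h(1) by blast
  qed
qed

end

locale deformation_space = group G for G :: "('g, 'b) monoid_scheme" (structure) +
  fixes D :: "('g, 'v) gtree set set"
  assumes space: "is_deformation_space G D \<or> is_restricted_deformation_space G D"
begin

text \<open>What the two kinds of space share, so that they can be treated together from here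
  on.\<close>

lemma representatives:
  obtains R where "D = R // equivariant_isometry G" "\<And>T. T \<in> R \<Longrightarrow> metric_gtree G T"
    "\<And>T T'. T \<in> R \<Longrightarrow> T' \<in> R \<Longrightarrow> elliptic_subgroups G T = elliptic_subgroups G T'"
  using space
proof
  assume "is_deformation_space G D"
  then obtain T0 :: "('g, 'v) gtree" where
    "D = {T. metric_gtree G T \<and> elliptic_subgroups G T = elliptic_subgroups G T0} // equivariant_isometry G"
    unfolding is_deformation_space_def by blast
  then show ?thesis using that by (metis (mono_tags, lifting) mem_Collect_eq)
next
  assume "is_restricted_deformation_space G D"
  then obtain T0 :: "('g, 'v) gtree" and \<A> where
    "D = {T. metric_gtree G T \<and> elliptic_subgroups G T = elliptic_subgroups G T0 \<and>
                (\<forall>e\<in>edges T. stabilizer G (edge_act T) e \<in> \<A>)} // equivariant_isometry G"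
    unfolding is_restricted_deformation_space_def by blast
  then show ?thesis using that by (metis (mono_tags, lifting) mem_Collect_eq)
qed

lemma
  assumes "c \<in> D"
  shows class_nonempty: "c \<noteq> {}"
    and class_tree: "T \<in> c \<Longrightarrow> metric_tree G T"
    and class_eq: "T \<in> c \<Longrightarrow> c = equivariant_isometry G `` {T}"
proof -
  obtain R where R: "D = R // equivariant_isometry G" "\<And>T. T \<in> R \<Longrightarrow> metric_gtree G T"
    using representatives by metis
  then obtain S where S: "S \<in> R" "c = equivariant_isometry G `` {S}"
    using assms by (auto elim: quotientE)
  show "c \<noteq> {}" using S equivariant_isometry_refl[OF R(2)[OF S(1)]] by blast
  assume T: "T \<in> c"
  then have ST: "(S, T) \<in> equivariant_isometry G" using S(2) by blast
  then show "metric_tree G T" by (rule equivariant_isometryD)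
  show "c = equivariant_isometry G `` {T}"
    unfolding S(2)
    by (auto intro: equivariant_isometry_trans[OF ST] equivariant_isometry_trans[OF equivariant_isometry_sym[OF ST]])
qed

lemma same_elliptic_subgroups:
  assumes "c \<in> D" "T \<in> c" "c' \<in> D" "T' \<in> c'"
  shows "elliptic_subgroups G T = elliptic_subgroups G T'"
proof -
  obtain R where R: "D = R // equivariant_isometry G"
    "\<And>T T'. T \<in> R \<Longrightarrow> T' \<in> R \<Longrightarrow> elliptic_subgroups G T = elliptic_subgroups G T'"
    using representatives by metis
  obtain S S' where "S \<in> R" "(S, T) \<in> equivariant_isometry G" "S' \<in> R" "(S', T') \<in> equivariant_isometry G"
    using assms R(1) by (auto elim!: quotientE)
  then show ?thesis using R(2) elliptic_subgroups_eq by metis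
qed

lemma cone_point_eq:
  assumes "c \<in> D" "T' \<in> c" "metric_tree G T" "T' \<in> cone_point G T l"
  shows "cone_point G T l = c"
  using cone_point_eq_class[OF assms(3,4)] class_eq[OF assms(1,2)] by simp

text \<open>The set \<open>points\<close> does not depend on the lengths, so \<open>x\<close> and
  \<open>y\<close> stay fixed while \<open>l\<close> varies, and the distance is a linear form in
  finitely many of the parameters.\<close>

lemma continuous_map_tdist:
  assumes "metric_tree G T" "x \<in> points T" "y \<in> points T"
  shows "continuous_map (subtopology (powertop_real (edge_orbits G T)) (closed_cone_params G D T))
    euclideanreal (\<lambda>l. tdist (with_lengths G T l) x y)"
proof -
  interpret metric_tree G T by (rule assms(1))
  let ?X = "subtopology (powertop_real (edge_orbits G T)) (closed_cone_params G D T)"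
  have "continuous_map ?X euclideanreal (\<lambda>l. wdist E (\<lambda>e. l (orbit G (edge_act T) e)) x y)"
    unfolding wdist_def using finite_sep assms edge_orbit_in
    by (intro continuous_map_sum continuous_map_real_mult continuous_map_from_subtopology
        continuous_map_product_projection continuous_map_const[THEN iffD2]) auto
  moreover have "tdist (with_lengths G T l) x y = wdist E (\<lambda>e. l (orbit G (edge_act T) e)) x y"
    if "l \<in> topspace ?X" for l
    using that assms by (intro tdist_with_lengths) (auto simp: closed_cone_params_def cone_params_def PiE_iff)
  ultimately show ?thesis by (rule continuous_map_eq[OF _ sym])
qed

lemma gromov_openE:
  assumes "openin (gromov_topology G D) U" "c \<in> U" "T \<in> c"
  obtains X A \<epsilon> where "finite X" "X \<subseteq> points T" "finite A" "A \<subseteq> carrier G" "\<epsilon> > 0"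
    "gromov_nbhd G D T X A \<epsilon> \<subseteq> U"
proof -
  have "\<forall>c\<in>U. \<forall>T\<in>c. \<exists>X A \<epsilon>. finite X \<and> X \<subseteq> points T \<and> finite A \<and> A \<subseteq> carrier G \<and> \<epsilon> > 0 \<and>
        gromov_nbhd G D T X A \<epsilon> \<subseteq> U"
    using assms(1) unfolding openin_gromov_topology by (rule conjunct2)
  from bspec[OF bspec[OF this assms(2)] assms(3)] show ?thesis by (elim exE conjE) (rule that)
qed

lemma gromov_open_imp_weak_open:
  assumes "openin (gromov_topology G D) U"
  shows "openin (weak_topology G D) U"
proof -
  have U: "U \<subseteq> D" using assms openin_subset[of "gromov_topology G D" U] by (simp add: topspace_gromov_topology)
  have "closedin (subtopology (powertop_real (edge_orbits G T)) (closed_cone_params G D T))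
      {l \<in> closed_cone_params G D T. cone_point G T l \<in> D - U}"
    if c: "c \<in> D" "T \<in> c" for c T
  proof -
    interpret metric_tree G T using c by (rule class_tree)
    let ?P = "closed_cone_params G D T"
    let ?X = "subtopology (powertop_real (edge_orbits G T)) ?P"
    have "?P \<subseteq> topspace (powertop_real (edge_orbits G T))"
      by (auto simp: closed_cone_params_def cone_params_def PiE_iff extensional_def)
    then have X: "topspace ?X = ?P" by (rule topspace_subtopology_subset)
    have op: "openin ?X {l \<in> ?P. cone_point G T l \<in> U}"
      unfolding openin_subopen[of ?X "{l \<in> ?P. cone_point G T l \<in> U}"]
    proof
      fix l\<^sub>0 assume l0: "l\<^sub>0 \<in> {l \<in> ?P. cone_point G T l \<in> U}"
      then obtain T\<^sub>0 where T0: "T\<^sub>0 \<in> cone_point G T l\<^sub>0" using class_nonempty U by blast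
      obtain X A \<epsilon> where XA: "finite X" "X \<subseteq> points T\<^sub>0" "finite A" "A \<subseteq> carrier G" "\<epsilon> > 0"
        "gromov_nbhd G D T\<^sub>0 X A \<epsilon> \<subseteq> U"
        by (rule gromov_openE[OF assms]) (use l0 T0 in auto)
      obtain f where f: "f ` P = points T\<^sub>0"
        "\<And>x y. x \<in> P \<Longrightarrow> y \<in> P \<Longrightarrow> tdist T\<^sub>0 (f x) (f y) = tdist (with_lengths G T l\<^sub>0) x y"
        "\<And>g x. g \<in> carrier G \<Longrightarrow> x \<in> P \<Longrightarrow> f (pact g x) = point_act G T\<^sub>0 g (f x)"
        using T0 unfolding cone_point_def by blast
      \<comment> \<open>Preimages of the test points under the collapse map; in every tree of the
        cone, their images serve as approximating points.\<close>
      define j where "j = inv_into P f"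
      have j: "j x \<in> P" "f (j x) = x" if "x \<in> X" for x
        using that XA f(1) unfolding j_def by (metis inv_into_into f_inv_into_f subsetD)+
      define N where "N x y g = {l \<in> topspace ?X. tdist (with_lengths G T l) (j x) (pact g (j y)) \<in>
        {tdist (with_lengths G T l\<^sub>0) (j x) (pact g (j y)) - \<epsilon> <..<
         tdist (with_lengths G T l\<^sub>0) (j x) (pact g (j y)) + \<epsilon>}}" for x y g
      \<comment> \<open>The factor \<open>?P\<close> covers the case of empty \<open>X\<close> or
        \<open>A\<close>, where the other intersection is the universal set.\<close>
      define W where "W = ?P \<inter> (\<Inter>(x, y, g)\<in>X \<times> X \<times> A. N x y g)"
      have "openin ?X (N x y g)" if "x \<in> X" "y \<in> X" "g \<in> A" for x y g
        unfolding N_def using that XA j pact_closed metric_tree_axioms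
        by (intro openin_continuous_map_preimage[OF continuous_map_tdist]) auto
      then have "openin ?X (\<Inter>(insert ?P ((\<lambda>(x, y, g). N x y g) ` (X \<times> X \<times> A))))"
        using XA(1,3) openin_topspace[of ?X] unfolding X by (intro openin_Inter) auto
      then have "openin ?X W" by (simp add: W_def)
      moreover have "l\<^sub>0 \<in> W" using l0 XA(5) X by (auto simp: W_def N_def)
      moreover have "W \<subseteq> {l \<in> ?P. cone_point G T l \<in> U}"
      proof
        fix l assume l: "l \<in> W"
        then have lP: "l \<in> ?P" "cone_point G T l \<in> D" by (auto simp: W_def closed_cone_params_def)
        then obtain T' where T': "T' \<in> cone_point G T l" using class_nonempty by blast
        then obtain f' where f': "f' ` P = points T'"
          "\<And>x y. x \<in> P \<Longrightarrow> y \<in> P \<Longrightarrow> tdist T' (f' x) (f' y) = tdist (with_lengths G T l) x y"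
          "\<And>g x. g \<in> carrier G \<Longrightarrow> x \<in> P \<Longrightarrow> f' (pact g x) = point_act G T' g (f' x)"
          unfolding cone_point_def by blast
        have "\<bar>tdist T\<^sub>0 x (point_act G T\<^sub>0 g y) - tdist T' (f' (j x)) (point_act G T' g (f' (j y)))\<bar> < \<epsilon>"
          if xy: "x \<in> X" "y \<in> X" and gA: "g \<in> A" for x y g
        proof -
          have g: "g \<in> carrier G" using gA XA by blast
          have "tdist T\<^sub>0 x (point_act G T\<^sub>0 g y) = tdist (with_lengths G T l\<^sub>0) (j x) (pact g (j y))"
            using f(2)[of "j x" "pact g (j y)"] f(3)[OF g, of "j y"] j xy pact_closed[OF g] by simp
          moreover have "tdist T' (f' (j x)) (point_act G T' g (f' (j y))) = tdist (with_lengths G T l) (j x) (pact g (j y))"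
            using f'(2)[of "j x" "pact g (j y)"] f'(3)[OF g, of "j y"] j xy pact_closed[OF g] by simp
          moreover have "l \<in> N x y g" using l xy gA unfolding W_def by blast
          ultimately show ?thesis by (auto simp: N_def)
        qed
        moreover have "(\<lambda>x. f' (j x)) ` X \<subseteq> points T'" using f'(1) j by blast
        ultimately have "cone_point G T l \<in> gromov_nbhd G D T\<^sub>0 X A \<epsilon>"
          unfolding gromov_nbhd_def using lP T' by blast
        then show "l \<in> {l \<in> ?P. cone_point G T l \<in> U}" using XA lP by blast
      qed
      ultimately show "\<exists>W. openin ?X W \<and> l\<^sub>0 \<in> W \<and> W \<subseteq> {l \<in> ?P. cone_point G T l \<in> U}" by blast
    qed
    have eq: "?P - {l \<in> ?P. cone_point G T l \<in> U} = {l \<in> ?P. cone_point G T l \<in> D - U}"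
      by (auto simp: closed_cone_params_def)
    show ?thesis using closedin_diff[OF closedin_topspace op] unfolding X eq .
  qed
  then show ?thesis unfolding openin_weak_topology weakly_closed_def using U by blast
qed

end

section \<open>Finiteness and fixed points\<close>

context simplicial_tree
begin

lemma betw_same_ends: "x \<in> P \<Longrightarrow> m \<in> P \<Longrightarrow> betw E x m x \<Longrightarrow> m = x"
proof -
  assume P: "x \<in> P" "m \<in> P" and b: "betw E x m x"
  have "sep E e m x = 0" if "e \<in> E" for e
    using betw_sepD[OF b that] sep_commute[of E e x m] by simp
  then show ?thesis using sep_eq_0_imp_eq P by blast
qed

text \<open>Removing the only edge at \<open>x\<close> leaves \<open>x\<close> alone in its
  component.\<close>

lemma leaf_branch:
  assumes "{x, y} \<in> E" "\<And>z. {x, z} \<in> E \<Longrightarrow> z = y" "z \<in> V" "z \<noteq> x"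
  shows "z \<in> branch E {x, y} \<longleftrightarrow> y \<in> branch E {x, y}"
proof -
  obtain c where c: "c \<in> {x, y}" "(c, z) \<in> (adj (E - {{x, y}}))\<^sup>*"
    by (rule edge_side[OF assms(1,3)])
  have "c \<noteq> x"
  proof
    assume "c = x"
    then obtain w where "(x, w) \<in> adj (E - {{x, y}})"
      using c(2) assms(4) by (metis converse_rtranclE)
    then show False using assms(2)[of w] by (auto simp: adj_def)
  qed
  then show ?thesis using branch_edge_rtrancl[OF c(2)] c(1) by blast
qed

end

context metric_tree
begin

lemma betw_act_iff:
  assumes "g \<in> carrier G" "x \<in> P" "m \<in> P" "y \<in> P"
  shows "betw E (pact g x) (pact g m) (pact g y) \<longleftrightarrow> betw E x m y"
  using betw_act[OF assms] betw_act[of "inv g" "pact g x" "pact g m" "pact g y"] assms pact_closed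
  by (auto simp: pact_inv)

lemma tdist_act:
  assumes "g \<in> carrier G" "x \<in> P" "y \<in> P"
  shows "tdist T (pact g x) (pact g y) = tdist T x y"
  using wdist_act[OF assms] assms pact_closed by (simp add: tdist_eq)

lemma edge_act_vertices: "g \<in> carrier G \<Longrightarrow> {u, v} \<in> E \<Longrightarrow> {act T g u, act T g v} \<in> E"
  using edge_act_closed by (metis edge_act_doubleton)

lemma generate_fixes:
  assumes "S \<subseteq> carrier G" "p \<in> P" "\<And>s. s \<in> S \<Longrightarrow> pact s p = p" "g \<in> generate G S"
  shows "pact g p = p"
  using assms(4)
proof (induction rule: generate.induct)
  case one
  then show ?case using pact_one assms by simp
next
  case (incl h)
  then show ?case using assms by simp
next
  case (inv h)
  then show ?case using pact_inv(1)[of h p] assms by auto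
next
  case (eng h k)
  then show ?case using pact_mult[of h k p] generate_in_carrier[OF assms(1)] by simp
qed

text \<open>\<open>p\<close> is the point at distance \<delta>/2 from \<open>x\<close> on the
  segment from \<open>q\<close> to \<open>x\<close>, or \<open>q\<close> if that is nearer. Each
  \<open>s\<close> fixes \<open>q\<close> and moves \<open>x\<close> by at most \<delta>, so the
  segments from \<open>q\<close> to \<open>x\<close> and to its image agree up to \<open>p\<close>.
  As \<open>p\<close> and its image are equally far from \<open>q\<close>, they coincide.\<close>

lemma near_fixed_point:
  assumes S: "S \<subseteq> carrier G" and q: "q \<in> P" "\<And>s. s \<in> S \<Longrightarrow> pact s q = q"
    and x: "x \<in> P" "\<And>s. s \<in> S \<Longrightarrow> tdist T x (pact s x) \<le> \<delta>" and "0 \<le> \<delta>"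
  obtains p where "p \<in> P" "\<And>g. g \<in> generate G S \<Longrightarrow> pact g p = p" "tdist T x p \<le> \<delta> / 2"
proof -
  let ?d = "wdist E (len T)"
  have x': "?d x (pact s x) \<le> \<delta>" if "s \<in> S" for s
    using x(2)[OF that] tdist_eq[OF x(1) pact_closed[OF _ x(1)], of s] S that by auto
  have nn: "0 \<le> ?d q x" by (rule wdist_nonneg) simp
  obtain p where p: "p \<in> P" "betw E q p x" "?d q p = max 0 (?d q x - \<delta> / 2)"
    using segment_point[OF q(1) x(1), of "len T" "max 0 (?d q x - \<delta> / 2)"] nn assms(6) by auto
  have "pact s p = p" if s: "s \<in> S" for s
  proof (rule common_initial_segment[symmetric, where l = "len T"])
    have sG: "s \<in> carrier G" using S s by blast
    show "q \<in> P" "x \<in> P" "pact s x \<in> P" "p \<in> P" "pact s p \<in> P" "betw E q p x" "\<And>e. e \<in> E \<Longrightarrow> 0 < len T e"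
      using q x p sG pact_closed by auto
    show "betw E q (pact s p) (pact s x)" using betw_act[OF sG q(1) p(1) x(1) p(2)] q(2)[OF s] by simp
    show "?d q p = ?d q (pact s p)" using wdist_act[OF sG q(1) p(1), of "len T"] q(2)[OF s] sG by simp
    have qs: "?d q (pact s x) = ?d q x" using wdist_act[OF sG q(1) x(1), of "len T"] q(2)[OF s] sG by simp
    have "?d x (pact s x) \<le> ?d x q + ?d q (pact s x)"
      using wdist_triangle x(1) q(1) pact_closed[OF sG x(1)] by simp
    then show "2 * ?d q p \<le> ?d q x + ?d q (pact s x) - ?d x (pact s x)"
      using p(3) x'[OF s] qs wdist_commute[of E "len T" x q] by (auto simp: max_def)
  qed
  moreover have "?d q x = ?d q p + ?d p x" using wdist_betw[OF q(1) p(1) x(1) p(2)] .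
  then have "tdist T x p \<le> \<delta> / 2"
    using p(3) tdist_eq[OF x(1) p(1)] wdist_commute[of E "len T" x p]
    by (simp add: max_def split: if_splits)
  ultimately show ?thesis using that p(1) generate_fixes[OF S p(1)] by blast
qed

text \<open>A terminal vertex could be removed together with its orbit, leaving a proper invariant
  subtree, against minimality.\<close>

lemma second_neighbour:
  assumes "{v, u} \<in> E"
  obtains u' where "{v, u'} \<in> E" "u' \<noteq> u"
proof (rule ccontr)
  assume "\<not> thesis"
  then have leaf: "z = u" if "{v, z} \<in> E" for z using that \<open>\<not> thesis\<close> \<open>\<And>u'. {v, u'} \<in> E \<Longrightarrow> u' \<noteq> u \<Longrightarrow> thesis\<close> by blast
  have uv: "u \<in> V" "v \<in> V" "u \<noteq> v" using edge_verts[OF assms] edge_cases[OF assms] by (auto simp: doubleton_eq_iff)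
  have leaf_g: "z = act T g u" if g: "g \<in> carrier G" and z: "{act T g v, z} \<in> E" for g z
  proof -
    have "z \<in> V" using edge_verts z by blast
    then have "{v, act T (inv g) z} \<in> E" using edge_act_vertices[of "inv g" "act T g v" z] g z uv by simp
    then have "act T (inv g) z = u" by (rule leaf)
    then show ?thesis using act_inv(2)[OF g \<open>z \<in> V\<close>] by simp
  qed
  define W where "W = {w \<in> V. \<forall>g\<in>carrier G. w \<noteq> act T g v}"
  have "W = V"
  proof (rule vertex_in_hull)
    show "W \<subseteq> V" by (auto simp: W_def)
    \<comment> \<open>If \<open>u\<close> were a translate of \<open>v\<close>, it would be terminal
      too, and the element carrying \<open>v\<close> to \<open>u\<close> would invert their
      edge.\<close>
    have "u \<in> W"
    proof (rule ccontr)
      assume "u \<notin> W"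
      then obtain g where g: "g \<in> carrier G" "u = act T g v" using uv by (auto simp: W_def)
      then have "v = act T g u" using leaf_g[of g v] assms by (simp add: insert_commute)
      then have "edge_act T g {v, u} = {v, u}" using g by (auto simp: edge_act_doubleton)
      then have "act T g v = v" using no_inversion assms g by blast
      then show False using g uv by simp
    qed
    then show "W \<noteq> {}" by blast
    show "act T h w \<in> W" if h: "h \<in> carrier G" and w: "w \<in> W" for h w
    proof -
      have "act T h w \<noteq> act T g v" if g: "g \<in> carrier G" for g
      proof
        assume "act T h w = act T g v"
        then have "w = act T (inv h \<otimes> g) v" using act_mult[of "inv h" g v] h g uv w act_inv(1)[OF h, of w]
          by (auto simp: W_def)
        then show False using w h g by (auto simp: W_def)
      qed
      then show ?thesis using h w by (simp add: W_def)
    qed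
    show "x \<in> W" if a: "a \<in> W" "b \<in> W" "x \<in> V" "betw E (vertex_point a) (vertex_point x) (vertex_point b)" for a x b
    proof (rule ccontr)
      assume "x \<notin> W"
      then obtain g where g: "g \<in> carrier G" "x = act T g v" using a by (auto simp: W_def)
      define y where "y = act T g u"
      have e: "{x, y} \<in> E" unfolding y_def g(2) using edge_act_vertices g(1) assms by blast
      have un: "z = y" if "{x, z} \<in> E" for z using leaf_g[OF g(1)] that unfolding y_def g(2) by blast
      have "a \<noteq> x" "b \<noteq> x" using a \<open>x \<notin> W\<close> by auto
      then have "(a \<in> branch E {x, y} \<longleftrightarrow> y \<in> branch E {x, y})" "(b \<in> branch E {x, y} \<longleftrightarrow> y \<in> branch E {x, y})"
        using leaf_branch[OF e un] a(1,2) by (auto simp: W_def)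
      moreover have "x \<in> branch E {x, y} \<longleftrightarrow> y \<notin> branch E {x, y}" by (rule branch_ends[OF e])
      ultimately show False using betw_sepD[OF a(4) e] by (auto simp: sep_def coord_vertex split: if_splits)
    qed
  qed
  moreover have "v \<notin> W" using uv act_one by (force simp: W_def)
  ultimately show False using uv by blast
qed

text \<open>Uses the absence of redundant vertices: at a vertex of degree 2, some element fixing the
  vertex exchanges its two neighbours.\<close>

lemma same_side_neighbours:
  assumes v: "v \<in> V" and ne: "E \<noteq> {}"
    and side: "\<And>g u. g \<in> carrier G \<Longrightarrow> act T g v = v \<Longrightarrow> {v, u} \<in> E \<Longrightarrow> side (act T g u) = (side u :: bool)"
  obtains u u' where "u \<noteq> u'" "{v, u} \<in> E" "{v, u'} \<in> E" "side u = side u'"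
proof -
  obtain w where w: "w \<in> V" "w \<noteq> v" using ne edge_cases by (metis ex_in_conv)
  have "(v, w) \<in> (adj E)\<^sup>*" using connected v w by blast
  then obtain u where u: "{v, u} \<in> E" using w(2) by (metis adj_iff converse_rtranclE)
  obtain u' where u': "{v, u'} \<in> E" "u' \<noteq> u" using second_neighbour[OF u] .
  show ?thesis
  \<comment> \<open>With a third neighbour the pigeonhole principle applies, as \<open>side\<close>
    takes only two values.\<close>
  proof (cases "\<exists>z. {v, z} \<in> E \<and> z \<noteq> u \<and> z \<noteq> u'")
    case True
    then obtain z where "{v, z} \<in> E" "z \<noteq> u" "z \<noteq> u'" by blast
    then show ?thesis using that u u' by metis
  next
    case False
    have vu: "v \<noteq> u" "v \<noteq> u'" using u u' edge_cases[of "{v, u}"] edge_cases[of "{v, u'}"] by (auto simp: doubleton_eq_iff)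
    have "incident T v = {{v, u}, {v, u'}}"
    proof (intro equalityI subsetI)
      fix e assume e: "e \<in> incident T v"
      then have "e \<in> E" "v \<in> e" by (auto simp: incident_def)
      moreover from this obtain a b where "e = {a, b}" using edge_cases by metis
      ultimately have "\<exists>z. e = {v, z} \<and> {v, z} \<in> E" by (auto simp: insert_commute)
      then show "e \<in> {{v, u}, {v, u'}}" using False by blast
    qed (use u u' in \<open>auto simp: incident_def\<close>)
    moreover have "{v, u} \<noteq> {v, u'}" using u' by (auto simp: doubleton_eq_iff)
    ultimately obtain g where g: "g \<in> carrier G" "act T g v = v" "edge_act T g {v, u} = {v, u'}"
      using metric v unfolding metric_gtree_def no_redundant_vertex_def by meson
    then have "act T g u = u'" using vu by (auto simp: edge_act_doubleton doubleton_eq_iff)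
    then show ?thesis using that u u' g side by metis
  qed
qed

text \<open>For generators \<open>s\<close>, the translates of the segment from \<open>o'\<close> to
  its image under \<open>s\<close> cover all segments between translates of \<open>o'\<close>, by
  induction on words; these cover the tree by minimality. Each segment contains finitely many
  vertices.\<close>

lemma finite_orbits:
  assumes "finitely_generated G (carrier G)"
  obtains R where "finite R" "R \<subseteq> V" "\<And>v. v \<in> V \<Longrightarrow> \<exists>g\<in>carrier G. \<exists>r\<in>R. v = act T g r"
proof -
  obtain S where S: "finite S" "S \<subseteq> carrier G" "carrier G = generate G S"
    using assms unfolding finitely_generated_def by blast
  have "V \<noteq> {}" using is_tree by (simp add: is_tree_def)
  then obtain o' where o': "o' \<in> V" by blast
  define B where "B g = {v \<in> V. betw E (vertex_point o') (vertex_point v) (vertex_point (act T g o'))}" for g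
  define R where "R = insert o' (\<Union>s\<in>S. B s)"
  define X where "X = {v \<in> V. \<exists>g\<in>carrier G. \<exists>r\<in>R. v = act T g r}"
  have RV: "R \<subseteq> V" using o' by (auto simp: R_def B_def)
  have fin: "finite (B g)" if "g \<in> carrier G" for g
    unfolding B_def using that o' by (intro finite_betw_vertices vertex_point_in_points) auto
  have RX: "R \<subseteq> X" using RV act_one by (force simp: X_def)
  have Xg: "v \<in> X" if "g \<in> carrier G" "v \<in> V" "act T g v \<in> X" for g v
  proof -
    obtain h r where h: "h \<in> carrier G" "r \<in> R" "act T g v = act T h r" using \<open>act T g v \<in> X\<close> by (auto simp: X_def)
    then have "v = act T (inv g \<otimes> h) r" using act_mult[of "inv g" h r] RV that act_inv(1)[of g v] by auto
    then show ?thesis using h that by (auto simp: X_def)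
  qed
  have shift: "betw E (vertex_point (act T g u)) (vertex_point (act T g v)) (vertex_point (act T g w))"
    if "g \<in> carrier G" "u \<in> V" "v \<in> V" "w \<in> V" "betw E (vertex_point u) (vertex_point v) (vertex_point w)" for g u v w
    using betw_act[OF that(1) _ _ _ that(5)] that vertex_point_in_points pact_vertex by simp
  have BX: "B g \<subseteq> X" if "g \<in> carrier G" for g
  proof -
    have "g \<in> generate G S" using S(3) that by simp
    then show ?thesis
    proof (induction rule: generate.induct)
      case one
      have "B \<one> \<subseteq> {o'}" using o' betw_same_ends vertex_point_in_points by (fastforce simp: B_def)
      then show ?case using RX by (auto simp: R_def)
    next
      case (incl s)
      then show ?case using RX by (auto simp: R_def)
    next
      case (inv s)
      show ?case
      proof
        fix v assume v: "v \<in> B (inv s)"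
        have s: "s \<in> carrier G" using S inv by blast
        have "betw E (vertex_point (act T s o')) (vertex_point (act T s v)) (vertex_point (act T s (act T (inv s) o')))"
          using v s o' by (intro shift) (auto simp: B_def)
        then have "act T s v \<in> B s" using v s o' betw_commute by (auto simp: B_def)
        then have "act T s v \<in> X" using inv RX by (auto simp: R_def)
        then show "v \<in> X" using Xg[OF s] v by (auto simp: B_def)
      qed
    next
      case (eng g h)
      have gh: "g \<in> carrier G" "h \<in> carrier G" using eng S(2) generate_in_carrier by blast+
      show ?case
      proof
        fix v assume v: "v \<in> B (g \<otimes> h)"
        then have vV: "v \<in> V" by (simp add: B_def)
        \<comment> \<open>The segment belonging to \<open>g \<otimes> h\<close> is covered by the
          one belonging to \<open>g\<close> and the translate by \<open>g\<close> of the one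
          belonging to \<open>h\<close>.\<close>
        have "betw E (vertex_point o') (vertex_point v) (vertex_point (act T g o')) \<or>
          betw E (vertex_point (act T g o')) (vertex_point v) (vertex_point (act T (g \<otimes> h) o'))"
          using v o' gh by (intro betw_split vertex_point_in_points) (auto simp: B_def)
        then show "v \<in> X"
        proof
          assume "betw E (vertex_point o') (vertex_point v) (vertex_point (act T g o'))"
          then show ?thesis using eng(3) vV by (auto simp: B_def)
        next
          assume "betw E (vertex_point (act T g o')) (vertex_point v) (vertex_point (act T (g \<otimes> h) o'))"
          then have "betw E (vertex_point (act T (inv g) (act T g o'))) (vertex_point (act T (inv g) v))
             (vertex_point (act T (inv g) (act T (g \<otimes> h) o')))"
            using gh o' vV by (intro shift) auto
          then have "act T (inv g) v \<in> B h" using gh o' vV by (simp add: B_def act_mult)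
          then show ?thesis using eng(4) Xg[of "inv g" v] gh vV by blast
        qed
      qed
    qed
  qed
  have "v \<in> X" if v: "v \<in> V" for v
  proof -
    let ?S = "{vertex_point (act T g o') | g. g \<in> carrier G}"
    have "\<exists>s\<in>?S. \<exists>t\<in>?S. betw E s (vertex_point v) t"
    proof (rule minimal_spanning)
      show "?S \<noteq> {}" by blast
      show "pact g x \<in> ?S" if "g \<in> carrier G" "x \<in> ?S" for g x
        using that o' by (auto simp: pact_vertex simp flip: act_mult)
    qed (use o' v vertex_point_in_points in auto)
    then obtain g h where gh: "g \<in> carrier G" "h \<in> carrier G"
      "betw E (vertex_point (act T g o')) (vertex_point v) (vertex_point (act T h o'))" by blast
    then have "betw E (vertex_point (act T (inv g) (act T g o'))) (vertex_point (act T (inv g) v))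
             (vertex_point (act T (inv g) (act T h o')))"
      using o' v by (intro shift) auto
    then have "act T (inv g) v \<in> B (inv g \<otimes> h)" using gh o' v by (simp add: B_def act_mult)
    then show ?thesis using BX Xg[of "inv g" v] gh v by blast
  qed
  moreover have "finite R" using S fin by (auto simp: R_def)
  ultimately show ?thesis using that[of R] RV by (auto simp: X_def)
qed

text \<open>The value at \<open>act T g r\<close> has to be \<open>\<beta> g (p r)\<close>, which is
  unambiguous because \<open>p r\<close> is fixed by the stabilizer of \<open>r\<close>. The target
  is abstract so that it can be the set of points of a tree or that of its vertices.\<close>

lemma equivariant_extension:
  fixes \<beta> :: "'g \<Rightarrow> 'x \<Rightarrow> 'x" and p :: "'v \<Rightarrow> 'x"
  assumes R: "R \<subseteq> V" "\<And>v. v \<in> V \<Longrightarrow> \<exists>g\<in>carrier G. \<exists>r\<in>R. v = act T g r"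
    "\<And>r s g. r \<in> R \<Longrightarrow> s \<in> R \<Longrightarrow> g \<in> carrier G \<Longrightarrow> act T g r = s \<Longrightarrow> r = s"
    and p: "\<And>r. r \<in> R \<Longrightarrow> p r \<in> X" "\<And>r g. r \<in> R \<Longrightarrow> g \<in> carrier G \<Longrightarrow> act T g r = r \<Longrightarrow> \<beta> g (p r) = p r"
    and \<beta>: "\<And>g x. g \<in> carrier G \<Longrightarrow> x \<in> X \<Longrightarrow> \<beta> g x \<in> X"
      "\<And>g h x. g \<in> carrier G \<Longrightarrow> h \<in> carrier G \<Longrightarrow> x \<in> X \<Longrightarrow> \<beta> (g \<otimes> h) x = \<beta> g (\<beta> h x)"
  obtains f where "\<And>v. v \<in> V \<Longrightarrow> f v \<in> X" "\<And>g v. g \<in> carrier G \<Longrightarrow> v \<in> V \<Longrightarrow> f (act T g v) = \<beta> g (f v)"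
    "\<And>r. r \<in> R \<Longrightarrow> f r = p r"
proof -
  have "\<exists>g r. g \<in> carrier G \<and> r \<in> R \<and> v = act T g r" if "v \<in> V" for v using R(2)[OF that] by blast
  then obtain \<gamma> \<rho> where \<gamma>: "\<And>v. v \<in> V \<Longrightarrow> \<gamma> v \<in> carrier G \<and> \<rho> v \<in> R \<and> v = act T (\<gamma> v) (\<rho> v)"
    by metis
  define f where "f v = \<beta> (\<gamma> v) (p (\<rho> v))" for v
  have eq: "f (act T g r) = \<beta> g (p r)" if g: "g \<in> carrier G" and r: "r \<in> R" for g r
  proof -
    let ?v = "act T g r"
    have rV: "r \<in> V" using r R by blast
    then have v: "\<gamma> ?v \<in> carrier G" "\<rho> ?v \<in> R" "?v = act T (\<gamma> ?v) (\<rho> ?v)" using \<gamma> g act_closed by blast+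
    have \<rho>V: "\<rho> ?v \<in> V" using v R by blast
    have "act T (inv g \<otimes> \<gamma> ?v) (\<rho> ?v) = act T (inv g) ?v" using v(3) act_mult \<rho>V v(1) g by (metis inv_closed)
    also have "\<dots> = r" using g rV by simp
    finally have 1: "act T (inv g \<otimes> \<gamma> ?v) (\<rho> ?v) = r" .
    then have [simp]: "\<rho> ?v = r" using R(3)[OF v(2) r _ 1] g v(1) by simp
    have "\<beta> (inv g \<otimes> \<gamma> ?v) (p r) = p r" using p(2)[OF r _] 1 g v(1) by simp
    then have "\<beta> g (p r) = \<beta> (g \<otimes> (inv g \<otimes> \<gamma> ?v)) (p r)" using \<beta>(2)[of g "inv g \<otimes> \<gamma> ?v" "p r"] p(1)[OF r] g v(1) by simp
    also have "g \<otimes> (inv g \<otimes> \<gamma> ?v) = \<gamma> ?v" using g v(1) by (simp flip: m_assoc)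
    finally show ?thesis by (simp add: f_def)
  qed
  show ?thesis
  proof (rule that[of f])
    show "f v \<in> X" if "v \<in> V" for v using \<gamma>[OF that] p \<beta> by (simp add: f_def)
    show "f r = p r" if r: "r \<in> R" for r
      using eq[OF one_closed r] p(2)[OF r one_closed] R r by (simp add: subset_iff)
    show "f (act T g v) = \<beta> g (f v)" if g: "g \<in> carrier G" and v: "v \<in> V" for g v
    proof -
      note \<gamma>v = \<gamma>[OF v]
      then have "\<rho> v \<in> V" using R by blast
      then have "act T g v = act T (g \<otimes> \<gamma> v) (\<rho> v)" using act_mult[of g "\<gamma> v" "\<rho> v"] \<gamma>v g by simp
      then have "f (act T g v) = \<beta> (g \<otimes> \<gamma> v) (p (\<rho> v))" using eq[of "g \<otimes> \<gamma> v" "\<rho> v"] \<gamma>v g by simp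
      also have "\<dots> = \<beta> g (f v)" using \<beta>(2) \<gamma>v g p by (simp add: f_def)
      finally show ?thesis .
    qed
  qed
qed

text \<open>The choice \<rho> depends on the orbit alone, so it thins a finite set of
  representatives to one per orbit.\<close>

lemma orbit_transversal:
  assumes "finitely_generated G (carrier G)"
  obtains R where "finite R" "R \<subseteq> V" "\<And>v. v \<in> V \<Longrightarrow> \<exists>g\<in>carrier G. \<exists>r\<in>R. v = act T g r"
    "\<And>r s g. r \<in> R \<Longrightarrow> s \<in> R \<Longrightarrow> g \<in> carrier G \<Longrightarrow> act T g r = s \<Longrightarrow> r = s"
proof -
  obtain R\<^sub>0 where R0: "finite R\<^sub>0" "R\<^sub>0 \<subseteq> V" "\<And>v. v \<in> V \<Longrightarrow> \<exists>g\<in>carrier G. \<exists>r\<in>R\<^sub>0. v = act T g r"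
    by (rule finite_orbits[OF assms]) blast
  define \<rho> where "\<rho> v = (SOME w. w \<in> orbit G (act T) v)" for v
  have orb: "orbit G (act T) (act T g v) = orbit G (act T) v" if "g \<in> carrier G" "v \<in> V" for g v
  proof -
    have "act T h (act T g v) \<in> orbit G (act T) v" if "h \<in> carrier G" for h
      using that \<open>g \<in> carrier G\<close> \<open>v \<in> V\<close> unfolding orbit_def by (auto intro!: exI[of _ "h \<otimes> g"] simp: act_mult)
    moreover have "act T h v \<in> orbit G (act T) (act T g v)" if "h \<in> carrier G" for h
      using that \<open>g \<in> carrier G\<close> \<open>v \<in> V\<close> unfolding orbit_def
      by (auto intro!: exI[of _ "h \<otimes> inv g"] simp: act_mult)
    ultimately show ?thesis unfolding orbit_def by blast
  qed
  have \<rho>: "\<exists>g\<in>carrier G. \<rho> v = act T g v" if "v \<in> V" for v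
  proof -
    have "v \<in> orbit G (act T) v" using that act_one unfolding orbit_def by force
    then have "\<rho> v \<in> orbit G (act T) v" unfolding \<rho>_def by (rule someI)
    then show ?thesis unfolding orbit_def by blast
  qed
  show ?thesis
  proof (rule that[of "\<rho> ` R\<^sub>0"])
    show "finite (\<rho> ` R\<^sub>0)" using R0 by simp
    show "\<rho> ` R\<^sub>0 \<subseteq> V"
    proof (rule image_subsetI)
      fix v assume "v \<in> R\<^sub>0"
      then have v: "v \<in> V" using R0(2) by blast
      then obtain g where "g \<in> carrier G" "\<rho> v = act T g v" using \<rho> by blast
      then show "\<rho> v \<in> V" using v by simp
    qed
    show "\<exists>g\<in>carrier G. \<exists>r\<in>\<rho> ` R\<^sub>0. v = act T g r" if v: "v \<in> V" for v
    proof -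
      obtain g r where g: "g \<in> carrier G" "r \<in> R\<^sub>0" "v = act T g r" using R0(3)[OF v] by blast
      then have rV: "r \<in> V" using R0(2) by blast
      then obtain h where h: "h \<in> carrier G" "\<rho> r = act T h r" using \<rho> by blast
      have "v = act T (g \<otimes> inv h) (\<rho> r)"
        using act_mult[of g "inv h" "\<rho> r"] g h rV by simp
      moreover have "g \<otimes> inv h \<in> carrier G" using g h by simp
      ultimately show ?thesis using g(2) by blast
    qed
    show "r = s" if "r \<in> \<rho> ` R\<^sub>0" "s \<in> \<rho> ` R\<^sub>0" "g \<in> carrier G" "act T g r = s" for r s g
    proof -
      obtain r0 s0 where r0: "r0 \<in> R\<^sub>0" "r = \<rho> r0" "s0 \<in> R\<^sub>0" "s = \<rho> s0" using \<open>r \<in> _\<close> \<open>s \<in> _\<close> by blast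
      then obtain h k where hk: "h \<in> carrier G" "r = act T h r0" "k \<in> carrier G" "s = act T k s0"
        using \<rho>[of r0] \<rho>[of s0] R0(2) by auto
      have V: "r0 \<in> V" "s0 \<in> V" using r0 R0(2) by auto
      then have "r \<in> V" using hk by simp
      then have "orbit G (act T) r0 = orbit G (act T) s0"
        using orb[OF hk(1) V(1)] orb[OF hk(3) V(2)] orb[OF that(3), of r]
        unfolding that(4) hk(2)[symmetric] hk(4)[symmetric] by simp
      then show ?thesis using r0 by (simp add: \<rho>_def)
    qed
  qed
qed

end

section \<open>Approximation of one tree by another\<close>

text \<open>Two steps are the shortest range that sees a pair of consecutive edges, hence the
  backtracking of their images.\<close>

definition near :: "('g, 'v) gtree \<Rightarrow> ('v \<times> 'v) set" where
  "near T = {(u, w). u \<in> verts T \<and> w \<in> verts T \<and>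
     (u = w \<or> {u, w} \<in> edges T \<or> (\<exists>v. {u, v} \<in> edges T \<and> {v, w} \<in> edges T))}"

definition simple_path :: "'v set set \<Rightarrow> 'v list \<Rightarrow> bool" where
  "simple_path E xs \<longleftrightarrow> xs \<noteq> [] \<and> distinct xs \<and> successively (\<lambda>a b. {a, b} \<in> E) xs"

lemma simple_path_Cons_Cons:
  "simple_path E (a # b # xs) \<longleftrightarrow> a \<notin> set (b # xs) \<and> {a, b} \<in> E \<and> simple_path E (b # xs)"
  by (auto simp: simple_path_def)

lemma simple_path_rev: "simple_path E (rev xs) \<longleftrightarrow> simple_path E xs"
  by (auto simp: simple_path_def insert_commute)

context simplicial_tree
begin

lemma simple_path_exists:
  assumes "u \<in> V" "w \<in> V"
  obtains xs where "simple_path E xs" "hd xs = w" "last xs = u"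
  using rtrancl_simple_path[OF connected[OF assms(2,1)]] unfolding simple_path_def by metis

lemma simple_path_verts:
  assumes "simple_path E xs" "last xs \<in> V"
  shows "set xs \<subseteq> V"
  using assms
proof (induction xs)
  case (Cons a xs)
  then show ?case
    by (cases xs) (use edge_verts in \<open>auto simp: simple_path_Cons_Cons\<close>)
qed simp

lemma tdist_edge:
  assumes "{u, w} \<in> E" "\<And>e. e \<in> E \<Longrightarrow> 0 \<le> len T e"
  shows "tdist T (vertex_point u) (vertex_point w) = len T {u, w}"
proof -
  have c: "vertex_point u \<in> cell {u, w}" "vertex_point w \<in> cell {u, w}" by auto
  then have "tdist T (vertex_point u) (vertex_point w) = wdist E (len T) (vertex_point u) (vertex_point w)"
    using tdist_eq_wdist assms cell_subset_points by blast
  also have "\<dots> = len T {u, w} * sep E {u, w} (vertex_point u) (vertex_point w)"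
    using wdist_cell[OF assms(1) c] .
  also have "sep E {u, w} (vertex_point u) (vertex_point w) = 1"
    using branch_ends[OF assms(1)] by (simp add: sep_def coord_vertex)
  finally show ?thesis by simp
qed

lemma sep_vertex_01: "sep E e (vertex_point v) (vertex_point w) \<in> {0, 1}"
  by (simp add: sep_def coord_vertex)

end

text \<open>\<open>m\<close> bounds the edge lengths of \<open>T\<close> from below and \<delta> is
  the error; the factor 4 leaves room for the losses of 2 \<delta> along paths and for the
  comparison of \<open>m - \<delta>\<close> with 3/2 \<delta> near vertices. Images may still lie
  inside edges of \<open>T'\<close>, as approximating points do.\<close>

locale approximation = T: metric_tree G T + T': metric_tree G T'
  for G :: "('g, 'b) monoid_scheme" (structure) and T T' :: "('g, 'v) gtree" +
  fixes f :: "'v \<Rightarrow> 'v \<Rightarrow> real" and \<delta> m :: real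
  assumes f_closed [simp]: "v \<in> verts T \<Longrightarrow> f v \<in> points T'"
    and f_act: "g \<in> carrier G \<Longrightarrow> v \<in> verts T \<Longrightarrow> f (act T g v) = point_act G T' g (f v)"
    and f_near: "(u, w) \<in> near T \<Longrightarrow>
      \<bar>tdist T' (f u) (f w) - tdist T (vertex_point u) (vertex_point w)\<bar> \<le> \<delta>"
    and len_ge: "e \<in> edges T \<Longrightarrow> m \<le> len T e"
    and \<delta>: "0 \<le> \<delta>" "4 * \<delta> < m"
begin

abbreviation "d u w \<equiv> wdist T'.E (len T') (f u) (f w)"

lemma d_edge:
  assumes "{u, w} \<in> T.E"
  shows "d u w \<le> len T {u, w} + \<delta>" "len T {u, w} - \<delta> \<le> d u w"
proof -
  have "(u, w) \<in> near T" "u \<in> T.V" "w \<in> T.V" using assms T.edge_verts by (auto simp: near_def)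
  then show "d u w \<le> len T {u, w} + \<delta>" "len T {u, w} - \<delta> \<le> d u w"
    using f_near[of u w] T.tdist_edge[OF assms] by (simp_all add: T'.tdist_eq abs_le_iff)
qed

lemma d_two_edges:
  assumes "{y, z} \<in> T.E" "{z, w} \<in> T.E" "y \<noteq> w"
  shows "len T {y, z} + len T {z, w} - \<delta> \<le> d y w"
proof -
  have V: "y \<in> T.V" "z \<in> T.V" "w \<in> T.V" using assms T.edge_verts by auto
  have n: "(y, w) \<in> near T" using assms V by (auto simp: near_def)
  have "y \<noteq> z" "z \<noteq> w" using assms T.edge_cases[OF assms(1)] T.edge_cases[OF assms(2)] by (auto simp: doubleton_eq_iff)
  then have b: "betw T.E (vertex_point y) (vertex_point z) (vertex_point w)"
    using T.simple_path_betw[of y z "[w]"] assms by simp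
  have "tdist T (vertex_point y) (vertex_point w) = len T {y, z} + len T {z, w}"
    using T.wdist_betw[OF _ _ _ b, of "len T"] V T.tdist_edge[OF assms(1)] T.tdist_edge[OF assms(2)]
      T.vertex_point_in_points by (simp add: T.tdist_eq)
  then show ?thesis using f_near[OF n] V by (simp add: T'.tdist_eq abs_le_iff)
qed

text \<open>The backtracking at each vertex is a fraction of the lengths of the edges, so along a path
  of \<open>T\<close> it does not accumulate in \<open>T'\<close>.\<close>

lemma path_step_grows:
  assumes "simple_path T.E (w # z # xs)"
  shows "d (last (z # xs)) z + len T {z, w} - 2 * \<delta> \<le> d (last (z # xs)) w"
    and "xs = y # ys \<Longrightarrow> d (last xs) y + d z w < d (last xs) z + d y w"
proof -
  \<comment> \<open>Paths are listed backwards: the moving end is the head and the base point is the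
    last element, so a path is prolonged at its head.\<close>
  have "d (last (z # xs)) z + len T {z, w} - 2 * \<delta> \<le> d (last (z # xs)) w \<and>
    (\<forall>y ys. xs = y # ys \<longrightarrow> d (last xs) y + d z w < d (last xs) z + d y w)"
    using assms
  proof (induction xs arbitrary: z w)
    case Nil
    then have "{z, w} \<in> T.E" by (simp add: simple_path_Cons_Cons insert_commute)
    then show ?case using d_edge(2)[of z w] \<delta> by simp
  next
    case (Cons y ys)
    let ?x = "last (y # ys)"
    have e: "{y, z} \<in> T.E" "{z, w} \<in> T.E" "y \<noteq> w" and p: "simple_path T.E (z # y # ys)"
      using Cons.prems by (auto simp: simple_path_Cons_Cons insert_commute)
    have V: "?x \<in> T.V" "y \<in> T.V" "z \<in> T.V" "w \<in> T.V"
    proof -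
      show "y \<in> T.V" "z \<in> T.V" "w \<in> T.V" using e T.edge_verts by auto
      then show "?x \<in> T.V"
      proof (cases ys rule: rev_cases)
        case (snoc zs a)
        have "successively (\<lambda>a b. {a, b} \<in> T.E) (y # ys)" using p by (auto simp: simple_path_def)
        then have "{last (y # zs), a} \<in> T.E" unfolding snoc
          by (simp add: successively_append_iff flip: append_Cons)
        then show ?thesis using T.edge_verts snoc by simp
      qed simp
    qed
    have IH: "d ?x y + len T {y, z} - 2 * \<delta> \<le> d ?x z" using Cons.IH[OF p] by simp
    have l: "m \<le> len T {y, z}" using len_ge e by blast
    \<comment> \<open>The difference of the two sides is at least twice the length of
      \<open>{y, z}\<close> minus 4 \<delta>.\<close>
    have gt: "d ?x y + d z w < d ?x z + d y w"
      using IH d_two_edges[OF e] d_edge(1)[OF e(2)] \<delta> l by linarith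
    obtain h where h: "h \<in> T'.E" "sep T'.E h (f ?x) (f z) + sep T'.E h (f y) (f w) >
        sep T'.E h (f ?x) (f y) + sep T'.E h (f z) (f w)"
      by (rule T'.wdist_separated_pairs[of "f ?x" "f y" "f z" "f w" "len T'"]) (use V gt in auto)
    \<comment> \<open>The increase of distance from \<open>z\<close> to \<open>w\<close> is the same
      seen from \<open>?x\<close> as seen from \<open>y\<close>. The latter involves two edges only,
      so the loss is 2 \<delta> however long the path is.\<close>
    have "wdist T'.E (len T') (f ?x) (f w) + d y z = d ?x z + d y w"
      using T'.strictly_separated_pairs(1)[OF f_closed[OF V(1)] f_closed[OF V(2)] f_closed[OF V(3)] f_closed[OF V(4)] h]
      by (intro T'.wdist_add_cong) (use V in auto)
    then show ?case using gt d_two_edges[OF e] d_edge(1)[OF e(1)] by auto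
  qed
  then show "d (last (z # xs)) z + len T {z, w} - 2 * \<delta> \<le> d (last (z # xs)) w"
    "xs = y # ys \<Longrightarrow> d (last xs) y + d z w < d (last xs) z + d y w" by auto
qed

lemma path_separated:
  assumes "simple_path T.E (w # z # y # ys)"
  obtains h where "h \<in> T'.E"
    "sep T'.E h (f (last (y # ys))) (f z) + sep T'.E h (f y) (f w) >
     sep T'.E h (f (last (y # ys))) (f y) + sep T'.E h (f z) (f w)"
proof -
  have "w \<in> T.V" using assms T.edge_verts by (auto simp: simple_path_Cons_Cons)
  then have "set (rev (w # z # y # ys)) \<subseteq> T.V"
    using assms by (intro T.simple_path_verts) (auto simp: simple_path_rev simp del: rev.simps simp: last_rev)
  then have V: "last (y # ys) \<in> T.V" "y \<in> T.V" "z \<in> T.V" "w \<in> T.V" by auto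
  show ?thesis
    by (rule T'.wdist_separated_pairs[of "f (last (y # ys))" "f y" "f z" "f w" "len T'"])
      (use V path_step_grows(2)[OF assms refl] that in auto)
qed

text \<open>Hence all the distances between images are determined by those at combinatorial distance
  at most 2, for every length function on \<open>T'\<close>.\<close>

lemma path_recursion:
  assumes p: "simple_path T.E (w # z # y # ys)"
  shows "wdist T'.E l (f (last (y # ys))) (f w) + wdist T'.E l (f y) (f z) =
    wdist T'.E l (f (last (y # ys))) (f z) + wdist T'.E l (f y) (f w)"
proof -
  have "w \<in> T.V" using p T.edge_verts by (auto simp: simple_path_Cons_Cons)
  then have "set (rev (w # z # y # ys)) \<subseteq> T.V"
    using p by (intro T.simple_path_verts) (auto simp: simple_path_rev simp del: rev.simps simp: last_rev)
  then have V: "last (y # ys) \<in> T.V" "y \<in> T.V" "z \<in> T.V" "w \<in> T.V" by auto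
  obtain h where h: "h \<in> T'.E"
    "sep T'.E h (f (last (y # ys))) (f z) + sep T'.E h (f y) (f w) >
     sep T'.E h (f (last (y # ys))) (f y) + sep T'.E h (f z) (f w)"
    using path_separated[OF p] .
  show ?thesis
    using T'.strictly_separated_pairs(1)[OF f_closed[OF V(1)] f_closed[OF V(2)] f_closed[OF V(3)] f_closed[OF V(4)] h]
    by (intro T'.wdist_add_cong) (use V in auto)
qed

text \<open>Each further edge adds at least its length minus 2 \<delta>, which is positive.\<close>

lemma path_monotone:
  assumes "simple_path T.E (ys @ [b, a])"
  shows "d a b \<le> d a (hd (ys @ [b, a]))" "ys \<noteq> [] \<Longrightarrow> d a b < d a (hd (ys @ [b, a]))"
proof -
  have "d a b \<le> d a (hd (ys @ [b, a])) \<and> (ys \<noteq> [] \<longrightarrow> d a b < d a (hd (ys @ [b, a])))"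
    using assms
  proof (induction ys)
    case (Cons w ys)
    obtain z xs where zx: "ys @ [b, a] = z # xs" by (cases "ys @ [b, a]") auto
    then have "last (z # xs) = a" by (metis last_appendR last.simps list.distinct(1))
    moreover have "simple_path T.E (w # z # xs)" using Cons.prems zx by simp
    ultimately have "d a z + len T {z, w} - 2 * \<delta> \<le> d a w" "{z, w} \<in> T.E" "simple_path T.E (z # xs)"
      using path_step_grows(1)[of w z xs] by (auto simp: simple_path_Cons_Cons insert_commute)
    then show ?case using Cons.IH zx len_ge[of "{z, w}"] \<delta> by auto
  qed simp
  then show "d a b \<le> d a (hd (ys @ [b, a]))" "ys \<noteq> [] \<Longrightarrow> d a b < d a (hd (ys @ [b, a]))" by auto
qed

end

text \<open>The recursion computes the value for a path from that for a shorter path and from two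
  near pairs. \<open>N\<close> and \<open>N'\<close> may come from different trees, which is the
  point of the statement.\<close>

lemma near_determines:
  fixes N N' :: "'v \<Rightarrow> 'v \<Rightarrow> real"
  assumes T: "simplicial_tree T"
    and near: "\<And>u w. (u, w) \<in> near T \<Longrightarrow> N u w = N' u w"
    and rec: "\<And>w z y ys. simple_path (edges T) (w # z # y # ys) \<Longrightarrow> N (last (y # ys)) w + N y z = N (last (y # ys)) z + N y w"
      "\<And>w z y ys. simple_path (edges T) (w # z # y # ys) \<Longrightarrow> N' (last (y # ys)) w + N' y z = N' (last (y # ys)) z + N' y w"
    and uw: "u \<in> verts T" "w \<in> verts T"
  shows "N u w = N' u w"
proof -
  interpret simplicial_tree T by (rule T)
  have "N (last xs) (hd xs) = N' (last xs) (hd xs)" if "simple_path E xs" "set xs \<subseteq> V" for xs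
    using that
  proof (induction xs)
    case (Cons w xs)
    show ?case
    proof (cases xs)
      case Nil
      then show ?thesis using Cons near by (simp add: near_def)
    next
      case z: (Cons z xs')
      then have zw: "{z, w} \<in> E" using Cons.prems by (simp add: simple_path_Cons_Cons insert_commute)
      show ?thesis
      proof (cases xs')
        case Nil
        then show ?thesis using z zw Cons.prems near by (simp add: near_def)
      next
        case y: (Cons y ys)
        have p: "simple_path E (w # z # y # ys)" and yz: "{y, z} \<in> E"
          using Cons.prems z y by (auto simp: simple_path_Cons_Cons insert_commute)
        have V: "y \<in> V" "z \<in> V" "w \<in> V" using Cons.prems z y by auto
        have "N y z = N' y z" "N y w = N' y w" using V yz zw by (auto intro!: near simp: near_def)
        moreover have "N (last (y # ys)) z = N' (last (y # ys)) z"
          using Cons.IH Cons.prems z y by (simp add: simple_path_Cons_Cons)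
        ultimately show ?thesis using rec(1)[OF p] rec(2)[OF p] z y by simp
      qed
    qed
  qed (simp add: simple_path_def)
  moreover obtain xs where xs: "simple_path E xs" "hd xs = w" "last xs = u" using simple_path_exists[OF uw] .
  ultimately show ?thesis using simple_path_verts[OF xs(1)] uw xs by blast
qed

section \<open>Moving the approximating images to vertices\<close>

lemma overlap_on_line:
  fixes b p u w :: real
  assumes "\<bar>b - p\<bar> + \<bar>p - u\<bar> = \<bar>b - u\<bar>" "\<bar>b - p\<bar> + \<bar>p - w\<bar> = \<bar>b - w\<bar>" "\<bar>b - p\<bar> \<noteq> 0"
  shows "\<bar>u - p\<bar> + \<bar>p - w\<bar> - \<bar>u - w\<bar> = 2 * min \<bar>p - u\<bar> \<bar>p - w\<bar>"
proof -
  have "(b < p \<and> p \<le> u) \<or> (p < b \<and> u \<le> p)" "(b < p \<and> p \<le> w) \<or> (p < b \<and> w \<le> p)"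
    using assms by linarith+
  then show ?thesis by (auto simp: min_def abs_if)
qed

context metric_tree
begin

text \<open>The support of an interior point is the whole edge, so \<open>g\<close> preserves the
  edge, and it cannot invert it.\<close>

lemma stabilizer_fixes_cell:
  assumes e: "{a, b} \<in> E" and p: "p \<in> cell {a, b}" "p \<noteq> vertex_point a" "p \<noteq> vertex_point b"
    and g: "g \<in> carrier G" "pact g p = p"
  shows "act T g a = a" "act T g b = b"
proof -
  have ne: "a \<noteq> b" using edge_cases[OF e] by (auto simp: doubleton_eq_iff)
  have pab: "p a \<ge> 0" "p b \<ge> 0" "p a + p b = 1" "\<And>v. v \<noteq> a \<Longrightarrow> v \<noteq> b \<Longrightarrow> p v = 0"
    using p(1) ne by (auto simp: cell_def)
  have "p a \<noteq> 0"
  proof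
    assume "p a = 0"
    then have "p = vertex_point b" using pab by (fastforce simp: fun_eq_iff vertex_point_def)
    then show False using p by blast
  qed
  moreover have "p b \<noteq> 0"
  proof
    assume "p b = 0"
    then have "p = vertex_point a" using pab by (fastforce simp: fun_eq_iff vertex_point_def)
    then show False using p by blast
  qed
  moreover have "p \<in> cell (edge_act T g {a, b})" using pact_edge_cell[OF g(1) e p(1)] g(2) by simp
  ultimately have "a \<in> edge_act T g {a, b}" "b \<in> edge_act T g {a, b}" by (auto simp: cell_def)
  then have "edge_act T g {a, b} = {a, b}" using ne by (auto simp: edge_act_doubleton)
  then show "act T g a = a" "act T g b = b" using no_inversion[OF e g(1)] by auto
qed

end

context approximation
begin

text \<open>The images of two neighbours of \<open>v\<close> both lie in the direction of
  \<open>a\<close>, so the segments leading to them overlap inside the edge. This overlap is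
  backtracking at \<open>f v\<close>, hence small, and little room is left between
  \<open>f v\<close> and \<open>a\<close>.\<close>

lemma edge_end_near:
  assumes e: "{a, b} \<in> T'.E" and p: "f v \<in> cell {a, b}" "f v \<noteq> vertex_point b"
    and u: "u \<noteq> u'" "{v, u} \<in> T.E" "{v, u'} \<in> T.E"
    and b: "betw T'.E (vertex_point b) (f v) (f u)" "betw T'.E (vertex_point b) (f v) (f u')"
  shows "wdist T'.E (len T') (f v) (vertex_point a) \<le> 2 * \<delta>"
proof -
  let ?e = "{a, b}" and ?a = "vertex_point a" and ?b = "vertex_point b"
  let ?s = "sep T'.E {a, b}"
  have ne: "a \<noteq> b" using T'.edge_cases[OF e] by (auto simp: doubleton_eq_iff)
  have V: "v \<in> T.V" "u \<in> T.V" "u' \<in> T.V" using u T.edge_verts by auto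
  have abP: "?a \<in> T'.P" "?b \<in> T'.P" using T'.edge_verts[OF e] T'.vertex_point_in_points by auto
  have abc: "?a \<in> cell ?e" "?b \<in> cell ?e" by auto
  have l: "0 < len T' ?e" using e by simp
  have dl: "m - \<delta> \<le> d v w" "d v w \<le> len T {v, w} + \<delta>" if "{v, w} \<in> T.E" for w
    using d_edge[OF that] len_ge[OF that] by auto
  \<comment> \<open>One error \<delta> for each of the two edges and one for the pair two steps
    apart.\<close>
  have defect: "d u v + d v u' - d u u' \<le> 3 * \<delta>"
    using d_two_edges[of u v u'] d_edge(1)[of u v] d_edge(1)[of v u'] u by (simp add: insert_commute)
  have sb: "?s ?b (f v) \<noteq> 0"
    using T'.cell_coord_eqI[OF e abc(2) p(1)] p(2) by (auto simp: sep_def)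
  have be: "?s ?b (f v) + ?s (f v) (f u) = ?s ?b (f u)" "?s ?b (f v) + ?s (f v) (f u') = ?s ?b (f u')"
    using betw_sepD[OF b(1) e] betw_sepD[OF b(2) e] by auto
  have same: "?s (f u) (f v) + ?s (f v) (f u') - ?s (f u) (f u') = 2 * min (?s (f v) (f u)) (?s (f v) (f u'))"
    using be sb unfolding sep_def by (intro overlap_on_line)
  have "len T' ?e * (2 * min (?s (f v) (f u)) (?s (f v) (f u'))) \<le> 3 * \<delta>"
    using T'.wdist_defect_ge[of "f u" "f v" "f u'" "len T'" ?e] V e defect same by simp
  then have "\<exists>w\<in>{u, u'}. len T' ?e * ?s (f v) (f w) \<le> 3 / 2 * \<delta>"
    by (cases "?s (f v) (f u) \<le> ?s (f v) (f u')") (auto simp: min_def)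
  then obtain w where w: "w \<in> {u, u'}" "len T' ?e * ?s (f v) (f w) \<le> 3 / 2 * \<delta>" by blast
  have wE: "{v, w} \<in> T.E" and wV: "w \<in> T.V" using w u V by auto
  \<comment> \<open>Adjacent vertices have images at distance at least \<open>m - \<delta>\<close>,
    which exceeds 3 \<delta>; so \<open>f w\<close> has left the edge, necessarily through
    \<open>a\<close>.\<close>
  have "f w \<notin> cell ?e"
  proof
    assume c: "f w \<in> cell ?e"
    have "d v w = len T' ?e * ?s (f v) (f w)" using T'.wdist_cell[OF e p(1) c] .
    then show False using w(2) dl(1)[OF wE] \<delta> by linarith
  qed
  then have "coord T'.E ?e (f w) \<in> {0, 1}" using T'.coord_01_or_cell[OF f_closed[OF wV] e] by blast
  moreover have "?s ?b (f v) + ?s (f v) (f w) = ?s ?b (f w)" using w be by auto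
  moreover have "coord T'.E ?e ?a = 1 - coord T'.E ?e ?b" "coord T'.E ?e ?b \<in> {0, 1}"
    using T'.branch_ends[OF e] by (auto simp: coord_vertex)
  moreover have "0 \<le> coord T'.E ?e (f v)" "coord T'.E ?e (f v) \<le> 1"
    using T'.coord_bounds f_closed[OF V(1)] e by auto
  ultimately have "?s (f v) ?a = ?s (f v) (f w)" using sb unfolding sep_def by auto
  then have "wdist T'.E (len T') (f v) ?a = len T' ?e * ?s (f v) (f w)"
    using T'.wdist_cell[OF e p(1) abc(1)] by simp
  then show ?thesis using w(2) \<delta> by linarith
qed

text \<open>If \<open>f v\<close> is not a vertex, the stabilizer of \<open>v\<close> fixes both
  ends of the edge containing it, hence preserves the side on which the image of a neighbour lies.
  Two neighbours share a side, and the end of the edge on that side is the required vertex.\<close>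

lemma near_fixed_vertex:
  assumes v: "v \<in> T.V" and ne: "T.E \<noteq> {}"
  shows "\<exists>q\<in>T'.V. tdist T' (f v) (vertex_point q) \<le> 2 * \<delta> \<and>
    (\<forall>g\<in>carrier G. act T g v = v \<longrightarrow> act T' g q = q)"
proof (cases "\<exists>q\<in>T'.V. f v = vertex_point q")
  case True
  then obtain q where q: "q \<in> T'.V" "f v = vertex_point q" by blast
  have "act T' g q = q" if "g \<in> carrier G" "act T g v = v" for g
    using f_act[OF that(1) v] that q T'.pact_vertex[of g q] by simp
  moreover have "tdist T' (f v) (vertex_point q) = 0" using T'.tdist_eq_0_iff q T'.vertex_point_in_points by simp
  ultimately show ?thesis using q(1) \<delta>(1) by (intro bexI[of _ q]) auto
next
  case False
  then obtain e where "e \<in> T'.E" "f v \<in> cell e" using T'.points_cases[OF f_closed[OF v]] by metis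
  moreover from this obtain a b where "e = {a, b}" "a \<in> T'.V" "b \<in> T'.V" by (auto elim: T'.edge_cases)
  ultimately have e: "{a, b} \<in> T'.E" "f v \<in> cell {a, b}" and ab: "a \<in> T'.V" "b \<in> T'.V" by auto
  have n: "f v \<noteq> vertex_point a" "f v \<noteq> vertex_point b" using False ab by auto
  have abP: "vertex_point a \<in> T'.P" "vertex_point b \<in> T'.P" using ab T'.vertex_point_in_points by auto
  have fix_ab: "act T' g a = a \<and> act T' g b = b" if "g \<in> carrier G" "act T g v = v" for g
    using T'.stabilizer_fixes_cell[OF e n that(1)] f_act[OF that(1) v] that(2) by simp
  define side where "side u = betw T'.E (vertex_point b) (f v) (f u)" for u
  have inv: "side (act T g u) = side u" if g: "g \<in> carrier G" "act T g v = v" "{v, u} \<in> T.E" for g u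
  proof -
    have u: "u \<in> T.V" using g T.edge_verts by blast
    have "betw T'.E (point_act G T' g (vertex_point b)) (point_act G T' g (f v)) (point_act G T' g (f u)) \<longleftrightarrow> side u"
      unfolding side_def using T'.betw_act_iff[OF g(1) abP(2) f_closed[OF v] f_closed[OF u]] .
    moreover have "point_act G T' g (vertex_point b) = vertex_point b"
      using T'.pact_vertex[OF g(1) ab(2)] fix_ab g by simp
    moreover have "point_act G T' g (f v) = f v" using f_act[OF g(1) v] g(2) by simp
    ultimately show ?thesis using f_act[OF g(1) u] by (simp add: side_def)
  qed
  obtain u u' where u: "u \<noteq> u'" "{v, u} \<in> T.E" "{v, u'} \<in> T.E" "side u = side u'"
    by (rule T.same_side_neighbours[OF v ne, of side]) (rule inv, assumption+)
  have uV: "u \<in> T.V" "u' \<in> T.V" using u T.edge_verts by auto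
  have split: "betw T'.E (vertex_point b) (f v) (f w) \<or> betw T'.E (vertex_point a) (f v) (f w)" if "w \<in> T.V" for w
    using T'.betw_split[OF abP(1) f_closed[OF v] abP(2) f_closed[OF that] T'.edge_betw[OF e]] betw_commute by blast
  show ?thesis
  proof (cases "side u")
    case True
    then have "wdist T'.E (len T') (f v) (vertex_point a) \<le> 2 * \<delta>"
      using edge_end_near[OF e n(2) u(1,2,3)] u(4) by (simp add: side_def)
    then show ?thesis using T'.tdist_eq[OF f_closed[OF v] abP(1)] fix_ab ab by (intro bexI[of _ a]) auto
  next
    case False
    then have "betw T'.E (vertex_point a) (f v) (f u)" "betw T'.E (vertex_point a) (f v) (f u')"
      using split[OF uV(1)] split[OF uV(2)] u(4) by (auto simp: side_def)
    moreover have "{b, a} \<in> T'.E" "f v \<in> cell {b, a}" using e by (simp_all add: insert_commute)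
    ultimately have "wdist T'.E (len T') (f v) (vertex_point b) \<le> 2 * \<delta>"
      using edge_end_near[of b a v u u'] n(1) u(1,2,3) by simp
    then show ?thesis using T'.tdist_eq[OF f_closed[OF v] abP(2)] fix_ab ab by (intro bexI[of _ b]) auto
  qed
qed

end

text \<open>The total fraction of the edges in a set \<open>k\<close> lying between two points; when the points
  are vertices, this is the number of edges of \<open>k\<close> separating them.\<close>

definition crossings :: "'v set set \<Rightarrow> 'v set set \<Rightarrow> ('v \<Rightarrow> real) \<Rightarrow> ('v \<Rightarrow> real) \<Rightarrow> real" where
  "crossings E k x y = wdist E (\<lambda>e. of_bool (e \<in> k)) x y"

lemma crossings_nonneg: "0 \<le> crossings E k x y"
  by (simp add: crossings_def wdist_nonneg)

context metric_tree
begin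

lemma edge_orbitsE:
  assumes "k \<in> edge_orbits G T"
  obtains e where "e \<in> E" "k = orbit G (edge_act T) e"
  using assms by (auto simp: edge_orbits_def orbits_def)

lemma edge_in_edge_orbit_iff:
  assumes "k \<in> edge_orbits G T" "e \<in> E"
  shows "e \<in> k \<longleftrightarrow> orbit G (edge_act T) e = k"
  using assms edge_orbit_eqI edge_in_orbit by (metis edge_orbitsE)

lemma crossings_act:
  assumes "k \<in> edge_orbits G T" "g \<in> carrier G" "x \<in> P" "y \<in> P"
  shows "crossings E k (pact g x) (pact g y) = crossings E k x y"
  unfolding crossings_def
proof (rule wdist_act[OF assms(2-4)])
  show "of_bool (edge_act T g e \<in> k) = (of_bool (e \<in> k) :: real)" if "e \<in> E" for e
    using edge_in_edge_orbit_iff[OF assms(1)] edge_act_closed edge_orbit_act that assms(2) by simp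
qed

lemma wdist_orbit_lengths:
  assumes "finite (edge_orbits G T)" "x \<in> P" "y \<in> P"
  shows "wdist E (\<lambda>e. l (orbit G (edge_act T) e)) x y = (\<Sum>k\<in>edge_orbits G T. l k * crossings E k x y)"
proof -
  let ?F = "{e \<in> E. sep E e x y \<noteq> 0}"
  have "(\<Sum>k\<in>edge_orbits G T. l k * crossings E k x y) =
      (\<Sum>k\<in>edge_orbits G T. \<Sum>e\<in>?F. if orbit G (edge_act T) e = k then l k * sep E e x y else 0)"
    unfolding crossings_def wdist_def sum_distrib_left
    using edge_in_edge_orbit_iff by (intro sum.cong) auto
  also have "\<dots> = (\<Sum>e\<in>?F. \<Sum>k\<in>edge_orbits G T. if orbit G (edge_act T) e = k then l k * sep E e x y else 0)"
    by (rule sum.swap)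
  also have "\<dots> = (\<Sum>e\<in>?F. l (orbit G (edge_act T) e) * sep E e x y)"
    using assms(1) edge_orbit_in by (intro sum.cong) (auto simp: sum.delta')
  finally show ?thesis by (simp add: wdist_def)
qed

lemma crossings_vertices:
  assumes "v \<in> V" "w \<in> V"
  shows "crossings E k (vertex_point v) (vertex_point w) =
    real (card {e \<in> E. e \<in> k \<and> sep E e (vertex_point v) (vertex_point w) \<noteq> 0})"
proof -
  let ?s = "\<lambda>e. sep E e (vertex_point v) (vertex_point w)"
  have fin: "finite {e \<in> E. ?s e \<noteq> 0}" using assms finite_sep vertex_point_in_points by blast
  have "crossings E k (vertex_point v) (vertex_point w) = (\<Sum>e | e \<in> E \<and> ?s e \<noteq> 0. of_bool (e \<in> k))"
    unfolding crossings_def wdist_def using sep_vertex_01 by (intro sum.cong) force+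
  also have "\<dots> = real (card {e \<in> {e \<in> E. ?s e \<noteq> 0}. e \<in> k})"
    using fin by (simp add: Int_def of_bool_def sum.If_cases)
  also have "{e \<in> {e \<in> E. ?s e \<noteq> 0}. e \<in> k} = {e \<in> E. e \<in> k \<and> ?s e \<noteq> 0}" by blast
  finally show ?thesis .
qed

text \<open>An element fixing \<open>v\<close> and \<open>w\<close> fixes the segment between them
  pointwise, and both ends of \<open>e\<close> lie on it.\<close>

lemma fixes_separating_edge:
  assumes h: "h \<in> carrier G" "act T h v = v" "act T h w = w" and vw: "v \<in> V" "w \<in> V"
    and e: "e \<in> E" "sep E e (vertex_point v) (vertex_point w) \<noteq> 0"
  shows "edge_act T h e = e"
proof -
  have fixed: "act T h a = a" if a: "a \<in> e" for a
  proof -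
    have aV: "a \<in> V" using a e edge_verts by blast
    have b: "betw E (vertex_point v) (vertex_point a) (vertex_point w)"
      using e a vw vertex_point_in_points by (intro edge_end_betw[of _ _ e]) (auto simp: sep_def coord_vertex split: if_splits)
    have "vertex_point (act T h a) = vertex_point a"
    proof (rule betw_unique[where l = "len T"])
      show "betw E (vertex_point v) (vertex_point (act T h a)) (vertex_point w)"
        using betw_act[OF h(1) _ _ _ b] vw aV h vertex_point_in_points by (simp add: pact_vertex)
      show "wdist E (len T) (vertex_point v) (vertex_point (act T h a)) = wdist E (len T) (vertex_point v) (vertex_point a)"
        using wdist_act[of h "vertex_point v" "vertex_point a" "len T"] vw aV h vertex_point_in_points
        by (simp add: pact_vertex)
    qed (use b vw aV h vertex_point_in_points in auto)
    then show ?thesis by simp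
  qed
  then show ?thesis by (force simp: edge_act_def)
qed

end

section \<open>Bounding the number of crossed edges\<close>

context simplicial_tree
begin

lemma simple_path_append_last:
  "simple_path E (xs @ [b, a]) \<longleftrightarrow> a \<notin> set (xs @ [b]) \<and> {b, a} \<in> E \<and> simple_path E (xs @ [b])"
  by (auto simp: simple_path_def successively_append_iff)

text \<open>A simple path from \<open>r\<close> to \<open>p\<close> is adjusted at each extremity:
  prolonged by the given edge if it misses the other end of that edge, and otherwise cut so that the
  edge becomes its terminal step.\<close>

lemma path_through_edges:
  assumes pq: "{p, q} \<in> E" and rs: "{r, s} \<in> E" and disj: "{p, q} \<inter> {r, s} = {}"
  obtains a b c w zs where "{a, b} = {p, q}" "{c, w} = {r, s}" "simple_path E (w # c # zs @ [b, a])"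
proof -
  have V: "p \<in> V" "q \<in> V" "r \<in> V" using pq rs edge_verts by auto
  have ne: "p \<noteq> q" "r \<noteq> s" using edge_cases[OF pq] edge_cases[OF rs] by (auto simp: doubleton_eq_iff)
  obtain xs where xs: "simple_path E xs" "hd xs = r" "last xs = p" using simple_path_exists[OF V(1,3)] .
  have "\<exists>ys a b. {a, b} = {p, q} \<and> simple_path E (ys @ [b, a]) \<and> ys \<noteq> [] \<and> hd ys = r"
  proof (cases "q \<in> set xs")
    case True
    then obtain A B where AB: "xs = A @ q # B" by (meson split_list)
    then have "A \<noteq> []" "B \<noteq> []" using xs disj ne by auto
    have "p \<in> set B" using AB xs(3) \<open>B \<noteq> []\<close> by auto
    then have "simple_path E (A @ [q, p])" using AB xs(1) pq ne
      unfolding simple_path_append_last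
      by (auto simp: simple_path_def successively_append_iff insert_commute)
    then show ?thesis using AB xs(2) \<open>A \<noteq> []\<close> by (intro exI[of _ A] exI[of _ p] exI[of _ q]) auto
  next
    case False
    have "xs \<noteq> []" using xs by (simp add: simple_path_def)
    then have e: "xs = butlast xs @ [p]" using xs(3) by (metis append_butlast_last_id)
    then have "simple_path E (butlast xs @ [p, q])"
      unfolding simple_path_append_last using False xs(1) pq by metis
    moreover have "butlast xs \<noteq> []" using e xs(2) disj by (metis append_Nil disjoint_iff insertCI list.sel(1))
    moreover from this have "hd (butlast xs) = r" using e xs(2) by (metis hd_append2)
    ultimately show ?thesis by (intro exI[of _ "butlast xs"] exI[of _ q] exI[of _ p]) auto
  qed
  then obtain ys a b where ab: "{a, b} = {p, q}" "simple_path E (ys @ [b, a])" "ys \<noteq> []" "hd ys = r" by blast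
  show ?thesis
  proof (cases "s \<in> set ys")
    case True
    then obtain A B where AB: "ys = A @ s # B" by (meson split_list)
    then obtain A' where A: "A = r # A'" using ab ne by (cases A) auto
    have "simple_path E (s # B @ [b, a])" "r \<notin> set (s # B @ [b, a])"
      using ab(2) unfolding AB A simple_path_def by (auto simp: successively_append_iff successively_Cons)
    then have "simple_path E (r # s # B @ [b, a])" using rs by (simp add: simple_path_Cons_Cons)
    then show ?thesis using that[of a b s r B] ab(1) by auto
  next
    case False
    obtain ys' where ys': "ys = r # ys'" using ab by (cases ys) auto
    have "s \<notin> set (ys @ [b, a])" using False ab(1) disj by auto
    then have "simple_path E (s # r # ys' @ [b, a])" using ab(2) rs ys' by (simp add: simple_path_Cons_Cons insert_commute)
    then show ?thesis using that[of a b r s ys'] ab(1) by auto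
  qed
qed

end

text \<open>With images at vertices every \<open>sep\<close> is 0 or 1, so crossings become
  cardinalities.\<close>

locale vertex_approximation = approximation G T T' f \<delta> m
  for G :: "('g, 'b) monoid_scheme" (structure) and T T' :: "('g, 'v) gtree" and f \<delta> m +
  assumes f_vertex: "v \<in> verts T \<Longrightarrow> f v \<in> vertex_point ` verts T'"
begin

lemma f_sep_01:
  assumes "u \<in> T.V" "w \<in> T.V"
  shows "sep T'.E e (f u) (f w) = 0 \<or> sep T'.E e (f u) (f w) = 1"
proof -
  obtain a b where "f u = vertex_point a" "f w = vertex_point b" using f_vertex assms by blast
  then show ?thesis using T'.sep_vertex_01[of e a b] by simp
qed

lemma spanning:
  assumes "x \<in> T'.P"
  shows "\<exists>u\<in>T.V. \<exists>w\<in>T.V. betw T'.E (f u) x (f w)"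
proof -
  have "T.V \<noteq> {}" using T.is_tree by (simp add: is_tree_def)
  have "\<exists>s\<in>f ` T.V. \<exists>t\<in>f ` T.V. betw T'.E s x t"
  proof (rule T'.minimal_spanning)
    show "point_act G T' g y \<in> f ` T.V" if "g \<in> carrier G" "y \<in> f ` T.V" for g y
    proof -
      obtain v where v: "v \<in> T.V" "y = f v" using \<open>y \<in> _\<close> by blast
      then have "point_act G T' g y = f (act T g v)" "act T g v \<in> T.V" using f_act \<open>g \<in> _\<close> by simp_all
      then show ?thesis by blast
    qed
  qed (use assms f_vertex \<open>T.V \<noteq> {}\<close> in auto)
  then show ?thesis by blast
qed

text \<open>On a simple path of \<open>T\<close> whose terminal steps are the two edges, distances
  between images grow strictly in both directions. This gives a strict four-point inequality, hence
  an edge \<open>h\<close> of \<open>T'\<close> separating the image of one edge from that of the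
  other, which no edge crossed by both images allows.\<close>

lemma crossed_edges_meet:
  assumes e: "e \<in> T'.E" and pq: "{p, q} \<in> T.E" "sep T'.E e (f p) (f q) \<noteq> 0"
    and rs: "{r, s} \<in> T.E" "sep T'.E e (f r) (f s) \<noteq> 0"
  shows "{p, q} \<inter> {r, s} \<noteq> {}"
proof
  assume "{p, q} \<inter> {r, s} = {}"
  then obtain a b c w zs where p: "{a, b} = {p, q}" "{c, w} = {r, s}" "simple_path T.E (w # c # zs @ [b, a])"
    using T.path_through_edges[OF pq(1) rs(1)] by metis
  have V: "a \<in> T.V" "b \<in> T.V" "c \<in> T.V" "w \<in> T.V"
    using p(1,2) T.edge_verts[OF pq(1)] T.edge_verts[OF rs(1)] by (metis insertCI)+
  have "d a b < d a c"
    using path_monotone(2)[of "c # zs" b a] p(3) by (simp add: simple_path_Cons_Cons)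
  moreover have "d w c < d w b"
  proof -
    have "simple_path T.E (w # c # zs @ [b])"
      using p(3) T.simple_path_append_last[of "w # c # zs" b a] by simp
    then have "simple_path T.E (rev (w # c # zs @ [b]))" by (simp only: simple_path_rev)
    then show ?thesis using path_monotone(2)[of "b # rev zs" c w] by simp
  qed
  ultimately have "d a b + d c w < d a c + d b w"
    using wdist_commute[of T'.E "len T'" "f w"] by simp
  then obtain h where h: "h \<in> T'.E" "sep T'.E h (f a) (f c) + sep T'.E h (f b) (f w) > sep T'.E h (f a) (f b) + sep T'.E h (f c) (f w)"
    using T'.wdist_separated_pairs[of "f a" "f b" "f c" "f w" "len T'"] V by (metis T'.len_nonneg f_closed)
  have ab: "sep T'.E e (f a) (f b) = 1" "sep T'.E e (f c) (f w) = 1"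
    using p(1,2) pq(2) rs(2) f_sep_01 V sep_commute[of T'.E e] by (auto simp: doubleton_eq_iff) metis+
  show False
  proof (cases "e = h")
    case True
    have "sep T'.E h (f a) (f c) \<le> 1" "sep T'.E h (f b) (f w) \<le> 1"
      using f_sep_01[of a c h] f_sep_01[of b w h] V by auto
    then show False using h(2) ab True by simp
  next
    case False
    then show False
      using T'.strictly_separated_pairs(2)[OF f_closed[OF V(1)] f_closed[OF V(2)] f_closed[OF V(3)] f_closed[OF V(4)] h e] ab
      by auto
  qed
qed

lemma crossings_card:
  assumes "u \<in> T.V" "w \<in> T.V"
  shows "crossings T'.E k (f u) (f w) = real (card {e \<in> T'.E. e \<in> k \<and> sep T'.E e (f u) (f w) \<noteq> 0})"
  using f_vertex[OF assms(1)] f_vertex[OF assms(2)] T'.crossings_vertices by auto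

text \<open>Each crossed edge of the orbit is brought to \<open>e\<^sub>0\<close> by a group
  element, which carries \<open>{u, w}\<close> to an edge of \<open>T\<close> whose image again
  crosses \<open>e\<^sub>0\<close>. By \<open>crossed_edges_meet\<close> it meets
  \<open>{u, w}\<close>, and at most \<open>2 * N\<close> edges do. The bound does not depend on
  \<open>T'\<close>.\<close>

lemma crossings_edge_le:
  assumes uw: "{u, w} \<in> T.E" and k: "k \<in> edge_orbits G T'"
    and N: "\<And>v. v \<in> T.V \<Longrightarrow> finite (incident T v)" "\<And>v. v \<in> T.V \<Longrightarrow> card (incident T v) \<le> N"
  shows "crossings T'.E k (f u) (f w) \<le> real (2 * N)"
proof -
  let ?M = "{e \<in> T'.E. e \<in> k \<and> sep T'.E e (f u) (f w) \<noteq> 0}"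
  have V: "u \<in> T.V" "w \<in> T.V" using uw T.edge_verts by auto
  have "card ?M \<le> 2 * N"
  proof (cases "?M = {}")
    case False
    then obtain e\<^sub>0 where e0: "e\<^sub>0 \<in> T'.E" "e\<^sub>0 \<in> k" "sep T'.E e\<^sub>0 (f u) (f w) \<noteq> 0" by blast
    have "\<exists>g. g \<in> carrier G \<and> e = edge_act T' g e\<^sub>0" if "e \<in> ?M" for e
    proof -
      have "e \<in> orbit G (edge_act T') e\<^sub>0"
        using T'.edge_in_edge_orbit_iff[OF k e0(1)] e0(2) that by blast
      then show ?thesis by (auto simp: orbit_def)
    qed
    then obtain \<gamma> where "\<forall>e\<in>?M. \<gamma> e \<in> carrier G \<and> e = edge_act T' (\<gamma> e) e\<^sub>0"
      using bchoice[of ?M "\<lambda>e g. g \<in> carrier G \<and> e = edge_act T' g e\<^sub>0"] by blast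
    then have \<gamma>: "\<And>e. e \<in> ?M \<Longrightarrow> \<gamma> e \<in> carrier G" "\<And>e. e \<in> ?M \<Longrightarrow> e = edge_act T' (\<gamma> e) e\<^sub>0"
      by auto
    define \<theta> where "\<theta> e = edge_act T (inv (\<gamma> e)) {u, w}" for e
    have "\<theta> ` ?M \<subseteq> incident T u \<union> incident T w"
    proof
      fix x assume "x \<in> \<theta> ` ?M"
      then obtain e where e: "e \<in> ?M" "x = \<theta> e" by blast
      let ?g = "inv (\<gamma> e)"
      have g: "?g \<in> carrier G" using \<gamma>(1)[OF e(1)] by simp
      have x: "x = {act T ?g u, act T ?g w}" using e by (simp add: \<theta>_def T.edge_act_doubleton)
      then have xE: "{act T ?g u, act T ?g w} \<in> T.E" using T.edge_act_vertices[OF g uw] by simp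
      have "edge_act T' ?g e = e\<^sub>0" using \<gamma>[OF e(1)] T'.edge_act_inv(1)[of "\<gamma> e" e\<^sub>0] e0 by metis
      then have "sep T'.E e\<^sub>0 (f (act T ?g u)) (f (act T ?g w)) = sep T'.E e (f u) (f w)"
        using T'.sep_act[OF g, of e "f u" "f w"] e V f_act[OF g] by simp
      then have "{u, w} \<inter> {act T ?g u, act T ?g w} \<noteq> {}"
        using crossed_edges_meet[OF e0(1) uw e0(3) xE] e by simp
      then show "x \<in> incident T u \<union> incident T w" using x xE by (auto simp: incident_def)
    qed
    \<comment> \<open>Two crossed edges with the same translate of \<open>{u, w}\<close> differ by
      an element preserving \<open>{u, w}\<close>. It fixes both ends and their images, hence every
      edge separating these images.\<close>
    moreover have "inj_on \<theta> ?M"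
    proof (rule inj_onI)
      fix e e' assume e: "e \<in> ?M" "e' \<in> ?M" "\<theta> e = \<theta> e'"
      let ?g = "\<gamma> e" and ?g' = "\<gamma> e'"
      let ?h = "?g' \<otimes> inv ?g"
      have g: "?g \<in> carrier G" "?g' \<in> carrier G" using \<gamma> e by auto
      have "edge_act T ?h {u, w} = edge_act T ?g' (\<theta> e)" using T.edge_act_mult[of ?g' "inv ?g" "{u, w}"] g uw by (simp add: \<theta>_def)
      also have "\<dots> = {u, w}" unfolding e(3) using T.edge_act_inv(2)[OF g(2) uw] by (simp add: \<theta>_def)
      finally have h: "act T ?h u = u" "act T ?h w = w" using T.no_inversion[OF uw] g by auto
      obtain a b where ab: "f u = vertex_point a" "a \<in> T'.V" "f w = vertex_point b" "b \<in> T'.V" using f_vertex V by blast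
      have "act T' ?h a = a" "act T' ?h b = b"
        using f_act[of ?h u] f_act[of ?h w] h g V ab T'.pact_vertex[of ?h] by auto
      then have "edge_act T' ?h e = e"
        using T'.fixes_separating_edge[of ?h a b e] g ab e(1) by simp
      moreover have "edge_act T' ?h e = edge_act T' ?g' (edge_act T' (inv ?g) e)"
        using T'.edge_act_mult[of ?g' "inv ?g" e] g e by simp
      moreover have "edge_act T' (inv ?g) e = e\<^sub>0" using \<gamma>[OF e(1)] T'.edge_act_inv(1)[of "\<gamma> e" e\<^sub>0] e0 by metis
      ultimately show "e = e'" using \<gamma>(2)[OF e(2)] by simp
    qed
    ultimately have "card ?M \<le> card (incident T u \<union> incident T w)"
      using N(1) V by (intro card_inj_on_le[of \<theta>]) auto
    also have "\<dots> \<le> card (incident T u) + card (incident T w)" by (rule card_Un_le)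
    also have "\<dots> \<le> 2 * N" using N(2)[OF V(1)] N(2)[OF V(2)] by simp
    finally show ?thesis .
  next
    case True
    show ?thesis unfolding True by simp
  qed
  then show ?thesis using crossings_card[OF V] by simp
qed

text \<open>A near pair spans at most two edges, each accounting for \<open>2 * N\<close>.\<close>

lemma crossings_near:
  assumes uw: "(u, w) \<in> near T" and k: "k \<in> edge_orbits G T'"
    and N: "\<And>v. v \<in> T.V \<Longrightarrow> finite (incident T v)" "\<And>v. v \<in> T.V \<Longrightarrow> card (incident T v) \<le> N"
  shows "crossings T'.E k (f u) (f w) \<in> real ` {..4 * N}"
proof -
  have V: "u \<in> T.V" "w \<in> T.V" using uw by (auto simp: near_def)
  have "crossings T'.E k (f u) (f w) \<le> real (4 * N)"
  proof -
    consider "u = w" | "{u, w} \<in> T.E" | v where "{u, v} \<in> T.E" "{v, w} \<in> T.E" using uw by (auto simp: near_def)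
    then show ?thesis
    proof cases
      case 1
      then show ?thesis by (simp add: crossings_def)
    next
      case 2
      then show ?thesis using crossings_edge_le[OF 2 k N] by simp
    next
      case (3 v)
      have "v \<in> T.V" using 3 T.edge_verts by blast
      then have "crossings T'.E k (f u) (f w) \<le> crossings T'.E k (f u) (f v) + crossings T'.E k (f v) (f w)"
        unfolding crossings_def using V by (intro T'.wdist_triangle) auto
      then show ?thesis using crossings_edge_le[OF 3(1) k N] crossings_edge_le[OF 3(2) k N] by simp
    qed
  qed
  then show ?thesis using crossings_card[OF V, of k] by auto
qed

text \<open>If no image crossed an edge, its coordinate would be constant on the images and on the
  segments between them, which cover \<open>T'\<close>.\<close>

lemma edge_crossed:
  assumes e: "e \<in> T'.E"
  obtains u w where "{u, w} \<in> T.E" "sep T'.E e (f u) (f w) \<noteq> 0"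
proof -
  obtain a b where ab: "e = {a, b}" "a \<in> T'.V" "b \<in> T'.V" using e by (auto elim: T'.edge_cases)
  have "\<exists>u\<in>T.V. \<exists>w\<in>T.V. sep T'.E e (f u) (f w) \<noteq> 0"
  proof (rule ccontr)
    assume "\<not> (\<exists>u\<in>T.V. \<exists>w\<in>T.V. sep T'.E e (f u) (f w) \<noteq> 0)"
    then have s0: "sep T'.E e (f u) (f w) = 0" if "u \<in> T.V" "w \<in> T.V" for u w
      using that by blast
    have c: "coord T'.E e (f u) = coord T'.E e (f w)" if "u \<in> T.V" "w \<in> T.V" for u w
      using s0[OF that] by (simp add: sep_def)
    have const: "coord T'.E e x = coord T'.E e (f u)" if x: "x \<in> T'.P" and u: "u \<in> T.V" for x u
    proof -
      obtain s t where s: "s \<in> T.V" "t \<in> T.V" "betw T'.E (f s) x (f t)" using spanning[OF x] by blast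
      then show ?thesis using betw_sepD[OF s(3) e] c[OF s(1) u] c[OF s(2) u] unfolding sep_def by linarith
    qed
    obtain u where "u \<in> T.V" using T.is_tree by (auto simp: is_tree_def)
    then have "coord T'.E e (vertex_point a) = coord T'.E e (vertex_point b)"
      using const[of "vertex_point a" u] const[of "vertex_point b" u] ab T'.vertex_point_in_points by simp
    moreover have "a \<in> branch T'.E e \<longleftrightarrow> b \<notin> branch T'.E e" using T'.branch_ends[of a b] e ab by simp
    ultimately show False by (auto simp: coord_vertex split: if_splits)
  qed
  then obtain u w where uw: "u \<in> T.V" "w \<in> T.V" "sep T'.E e (f u) (f w) \<noteq> 0" by blast
  let ?R = "\<lambda>u w. sep T'.E e (f u) (f w) \<noteq> 0 \<longrightarrow> (\<exists>p q. {p, q} \<in> T.E \<and> sep T'.E e (f p) (f q) \<noteq> 0)"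
  have "?R u w"
  proof (rule T.vertex_points_induct[OF uw(1,2), where R = ?R])
    show "?R u w" if "?R u v" "?R v w" for u v w
      using that sep_triangle[of T'.E e "f u" "f w" "f v"] sep_nonneg[of T'.E e "f u" "f w"]
      by (metis add.right_neutral order_antisym)
  qed auto
  then show ?thesis using uw that by blast
qed

end

section \<open>Finiteness up to the group action\<close>

context metric_tree
begin

lemma near_act: "g \<in> carrier G \<Longrightarrow> (u, w) \<in> near T \<Longrightarrow> (act T g u, act T g w) \<in> near T"
  unfolding near_def using edge_act_vertices by auto blast

lemma finite_neighbours: "locally_finite_gtree T \<Longrightarrow> u \<in> V \<Longrightarrow> finite {w. {u, w} \<in> E}"
proof -
  assume "locally_finite_gtree T" "u \<in> V"
  then have "finite (incident T u)" by (simp add: locally_finite_gtree_def)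
  moreover have "inj_on (\<lambda>w. {u, w}) {w. {u, w} \<in> E}" by (auto simp: inj_on_def doubleton_eq_iff)
  moreover have "(\<lambda>w. {u, w}) ` {w. {u, w} \<in> E} \<subseteq> incident T u" by (auto simp: incident_def)
  ultimately show ?thesis by (meson inj_on_finite)
qed

lemma finite_near:
  assumes "locally_finite_gtree T" "finite R" "R \<subseteq> V"
  shows "finite {(u, w) \<in> near T. u \<in> R}"
proof (rule finite_subset)
  let ?N = "\<lambda>u. {w. {u, w} \<in> E}"
  show "{(u, w) \<in> near T. u \<in> R} \<subseteq> (SIGMA u:R. insert u (?N u \<union> (\<Union>v\<in>?N u. ?N v)))"
    by (auto simp: near_def)
  have "finite (\<Union>v\<in>?N u. ?N v)" if "u \<in> R" for u
  proof (rule finite_UN_I)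
    show "finite (?N u)" using finite_neighbours assms that by blast
    show "finite (?N v)" if "v \<in> ?N u" for v
      using finite_neighbours[OF assms(1)] that edge_verts by blast
  qed
  then show "finite (SIGMA u:R. insert u (?N u \<union> (\<Union>v\<in>?N u. ?N v)))"
    using assms finite_neighbours by (intro finite_SigmaI) auto
qed

lemma incident_act:
  assumes "g \<in> carrier G" "v \<in> V"
  shows "incident T (act T g v) = edge_act T g ` incident T v"
proof
  show "edge_act T g ` incident T v \<subseteq> incident T (act T g v)"
    using assms edge_act_closed by (auto simp: incident_def edge_act_def)
  show "incident T (act T g v) \<subseteq> edge_act T g ` incident T v"
  proof
    fix e assume e: "e \<in> incident T (act T g v)"
    then have eE: "e \<in> E" "act T g v \<in> e" by (auto simp: incident_def)
    then have "edge_act T (inv g) e \<in> E" using assms edge_act_closed by simp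
    moreover have "v \<in> edge_act T (inv g) e"
      unfolding edge_act_def using eE(2) act_inv(1)[OF assms] by (metis image_eqI)
    ultimately have "edge_act T (inv g) e \<in> incident T v" by (simp add: incident_def)
    then show "e \<in> edge_act T g ` incident T v" using edge_act_inv(2)[OF assms(1) eE(1)] by (metis image_eqI)
  qed
qed

lemma finite_geometry:
  assumes lf: "locally_finite_gtree T" and R: "finite R" "R \<subseteq> V"
    "\<And>v. v \<in> V \<Longrightarrow> \<exists>g\<in>carrier G. \<exists>r\<in>R. v = act T g r"
  obtains m N where "0 < m" "\<And>e. e \<in> E \<Longrightarrow> m \<le> len T e"
    "\<And>v. v \<in> V \<Longrightarrow> finite (incident T v)" "\<And>v. v \<in> V \<Longrightarrow> card (incident T v) \<le> N"
proof -
  have fin: "finite (incident T v)" if "v \<in> V" for v using lf that by (simp add: locally_finite_gtree_def)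
  \<comment> \<open>The extra element 1 gives the minimum a value for a tree without edges.\<close>
  define L where "L = insert 1 (len T ` (\<Union>r\<in>R. incident T r))"
  have "finite (\<Union>r\<in>R. incident T r)" using R(1,2) fin by blast
  then have L: "finite L" by (simp add: L_def)
  define m where "m = Min L"
  define N where "N = Max (insert 0 ((\<lambda>r. card (incident T r)) ` R))"
  show ?thesis
  proof (rule that[of m N])
    have "m \<in> L" unfolding m_def using L by (intro Min_in) (auto simp: L_def)
    then show "0 < m" by (auto simp: L_def incident_def)
    show "m \<le> len T e" if e: "e \<in> E" for e
    proof -
      obtain a where a: "a \<in> e" using edge_cases[OF e] by blast
      then obtain g r where g: "g \<in> carrier G" "r \<in> R" "a = act T g r" using R(3)[of a] edge_verts[OF e a] by blast
      then have "e \<in> edge_act T g ` incident T r" using incident_act[of g r] R(2) a e by (auto simp: incident_def)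
      then obtain e' where e': "e' \<in> incident T r" "e = edge_act T g e'" by blast
      then have "len T e = len T e'" using g by (simp add: incident_def)
      then have "len T e \<in> L" using e' g unfolding L_def by blast
      then show ?thesis unfolding m_def using L by (rule Min_le[rotated])
    qed
    show "finite (incident T v)" if "v \<in> V" for v using fin[OF that] .
    show "card (incident T v) \<le> N" if v: "v \<in> V" for v
    proof -
      obtain g r where g: "g \<in> carrier G" "r \<in> R" "v = act T g r" using R(3)[OF v] by blast
      then have "card (incident T v) \<le> card (incident T r)"
        using incident_act[of g r] R(2) fin card_image_le by (metis subsetD)
      also have "\<dots> \<le> N" unfolding N_def using R(1) g by (intro Max_ge) auto
      finally show ?thesis .
    qed
  qed
qed

lemma stabilizer_subgroup: "v \<in> V \<Longrightarrow> subgroup (stabilizer G (act T) v) G"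
  by (rule va.stabilizer_subgroup)

end

text \<open>Seen as an approximation of itself, \<open>T\<close> can be placed in a closed cone by
  the same criterion as the trees converging to it.\<close>

lemma vertex_approximation_refl:
  assumes "metric_tree G T" "\<And>e. e \<in> edges T \<Longrightarrow> m \<le> len T e" "0 < m"
  shows "vertex_approximation G T T vertex_point 0 m"
proof -
  interpret metric_tree G T by (rule assms(1))
  show ?thesis
    using assms(2,3) vertex_point_in_points pact_vertex by unfold_locales auto
qed

text \<open>A Gromov-close tree receives an equivariant map from the vertices of \<open>T\<close>: the finitely
  generated stabilizers are elliptic in \<open>T'\<close> and almost fix the approximating points.\<close>

lemma approximation_exists:
  fixes T T' :: "('g, 'v) gtree" and h :: "('v \<Rightarrow> real) \<Rightarrow> ('v \<Rightarrow> real)"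
  assumes T: "metric_tree G T" and T': "metric_tree G T'"
    and ell: "elliptic_subgroups G T \<subseteq> elliptic_subgroups G T'" and nontrivial: "edges T \<noteq> {}"
    and R: "R \<subseteq> verts T" "\<And>v. v \<in> verts T \<Longrightarrow> \<exists>g\<in>carrier G. \<exists>r\<in>R. v = act T g r"
      "\<And>r s g. r \<in> R \<Longrightarrow> s \<in> R \<Longrightarrow> g \<in> carrier G \<Longrightarrow> act T g r = s \<Longrightarrow> r = s"
    and A: "A \<subseteq> carrier G" "\<And>r. r \<in> R \<Longrightarrow> \<exists>S\<subseteq>A. stabilizer G (act T) r = generate G S"
      "\<And>u w. (u, w) \<in> near T \<Longrightarrow> u \<in> R \<Longrightarrow> \<exists>g\<in>A. \<exists>r\<in>R. w = act T g r"
    and m: "\<And>e. e \<in> edges T \<Longrightarrow> m \<le> len T e" "40 * \<epsilon> < m" "0 < \<epsilon>"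
    and h: "\<And>r. r \<in> R \<Longrightarrow> h (vertex_point r) \<in> points T'"
      "\<And>r s g. r \<in> R \<Longrightarrow> s \<in> R \<Longrightarrow> g \<in> A \<Longrightarrow>
        \<bar>tdist T (vertex_point r) (point_act G T g (vertex_point s)) -
          tdist T' (h (vertex_point r)) (point_act G T' g (h (vertex_point s)))\<bar> < \<epsilon>"
  shows "\<exists>f. vertex_approximation G T T' f (10 * \<epsilon>) m"
proof -
  interpret T: metric_tree G T by (rule T)
  interpret T': metric_tree G T' by (rule T')
  let ?a = "\<lambda>r. h (vertex_point r)" and ?g = "point_act G T'"
  have RV: "r \<in> T.V" if "r \<in> R" for r using that R by blast
  have AG: "g \<in> carrier G" if "g \<in> A" for g using that A by blast
  have tri: "tdist T' x z \<le> tdist T' x y + tdist T' y z" if "x \<in> T'.P" "y \<in> T'.P" "z \<in> T'.P" for x y z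
    using T'.wdist_triangle[OF that, of "len T'"] that by (simp add: T'.tdist_eq)
  have comm: "tdist T' x y = tdist T' y x" if "x \<in> T'.P" "y \<in> T'.P" for x y
    using that wdist_commute[of T'.E "len T'" x y] by (simp add: T'.tdist_eq)
  \<comment> \<open>The image of a representative is first moved to a point fixed by the whole
    stabilizer, by at most half the distance \<epsilon> that bounds its displacement under the
    generators.\<close>
  have "\<exists>p. p \<in> T'.P \<and> (\<forall>g\<in>carrier G. act T g r = r \<longrightarrow> ?g g p = p) \<and> tdist T' (?a r) p \<le> \<epsilon> / 2"
    if r: "r \<in> R" for r
  proof -
    let ?H = "stabilizer G (act T) r"
    obtain S where S: "S \<subseteq> A" "?H = generate G S" using A(2)[OF r] by blast
    have SG: "S \<subseteq> carrier G" using S A by blast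
    have SH: "s \<in> ?H" if "s \<in> S" for s using that S generate.incl by metis
    have "?H \<in> elliptic_subgroups G T"
      unfolding elliptic_subgroups_def
    proof (intro CollectI conjI bexI)
      show "subgroup ?H G" using RV[OF r] by (rule T.stabilizer_subgroup)
      show "vertex_point r \<in> T.P" using RV[OF r] by (rule T.vertex_point_in_points)
      show "\<forall>h\<in>?H. point_act G T h (vertex_point r) = vertex_point r"
        using RV[OF r] by (auto simp: stabilizer_def T.pact_vertex)
    qed
    then have "?H \<in> elliptic_subgroups G T'" using ell by blast
    then have "\<exists>q\<in>T'.P. \<forall>h\<in>?H. ?g h q = q" by (simp add: elliptic_subgroups_def)
    then obtain q where q: "q \<in> T'.P" "\<forall>h\<in>?H. ?g h q = q" by blast
    have sq: "?g s q = q" if "s \<in> S" for s using q(2) SH[OF that] by blast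
    have sa: "tdist T' (?a r) (?g s (?a r)) \<le> \<epsilon>" if s: "s \<in> S" for s
    proof -
      have "s \<in> A" "s \<in> carrier G" "act T s r = r" using s S SH[OF s] SG by (auto simp: stabilizer_def)
      then have "tdist T (vertex_point r) (point_act G T s (vertex_point r)) = 0"
        using RV[OF r] T.pact_vertex T.tdist_eq_0_iff T.vertex_point_in_points by simp
      then show ?thesis using h(2)[OF r r \<open>s \<in> A\<close>] by simp
    qed
    obtain p where p: "p \<in> T'.P" "\<And>g. g \<in> generate G S \<Longrightarrow> ?g g p = p" "tdist T' (?a r) p \<le> \<epsilon> / 2"
      by (rule T'.near_fixed_point[OF SG q(1) sq h(1)[OF r] sa less_imp_le[OF m(3)]]) (assumption+, rule that)
    have "?g g p = p" if "g \<in> carrier G" "act T g r = r" for g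
      using p(2)[of g] that S(2)[symmetric] by (simp add: stabilizer_def)
    then show ?thesis using p by blast
  qed
  then obtain p where p: "\<And>r. r \<in> R \<Longrightarrow> p r \<in> T'.P" "\<And>r g. r \<in> R \<Longrightarrow> g \<in> carrier G \<Longrightarrow> act T g r = r \<Longrightarrow> ?g g (p r) = p r"
    "\<And>r. r \<in> R \<Longrightarrow> tdist T' (?a r) (p r) \<le> \<epsilon> / 2" by metis
  obtain f0 where f0: "\<And>v. v \<in> T.V \<Longrightarrow> f0 v \<in> T'.P" "\<And>g v. g \<in> carrier G \<Longrightarrow> v \<in> T.V \<Longrightarrow> f0 (act T g v) = ?g g (f0 v)"
    "\<And>r. r \<in> R \<Longrightarrow> f0 r = p r"
    by (rule T.equivariant_extension[of R p T'.P ?g])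
      (use R p T'.pact_closed T'.pact_mult in \<open>auto\<close>)
  have shift: "\<exists>g\<in>carrier G. \<exists>r\<in>R. \<exists>w'. (r, w') \<in> near T \<and> u = act T g r \<and> w = act T g w'" if uw: "(u, w) \<in> near T" for u w
  proof -
    have V: "u \<in> T.V" "w \<in> T.V" using uw by (auto simp: near_def)
    obtain g r where g: "g \<in> carrier G" "r \<in> R" "u = act T g r" using R(2)[OF V(1)] by blast
    have "(act T (inv\<^bsub>G\<^esub> g) u, act T (inv\<^bsub>G\<^esub> g) w) \<in> near T" using T.near_act[OF _ uw] g by simp
    then have "(r, act T (inv\<^bsub>G\<^esub> g) w) \<in> near T" using g RV by simp
    moreover have "w = act T g (act T (inv\<^bsub>G\<^esub> g) w)" using g V by simp
    ultimately show ?thesis using g by blast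
  qed
  \<comment> \<open>The error \<epsilon> of the given map, plus \<epsilon>/2 for each of the two
    displaced points.\<close>
  have f0_near: "\<bar>tdist T' (f0 u) (f0 w) - tdist T (vertex_point u) (vertex_point w)\<bar> \<le> 2 * \<epsilon>" if uw: "(u, w) \<in> near T" for u w
  proof -
    obtain g r w' where g: "g \<in> carrier G" "r \<in> R" "(r, w') \<in> near T" "u = act T g r" "w = act T g w'"
      using shift[OF uw] by blast
    obtain k s where k: "k \<in> A" "s \<in> R" "w' = act T k s" using A(3)[OF g(3,2)] by blast
    have kG: "k \<in> carrier G" using AG k by blast
    have V: "r \<in> T.V" "s \<in> T.V" "w' \<in> T.V" using RV g k kG by auto
    have "tdist T' (f0 u) (f0 w) = tdist T' (f0 r) (f0 w')"
      using T'.tdist_act[OF g(1) f0(1)[OF V(1)] f0(1)[OF V(3)]] f0(2)[OF g(1) V(1)] f0(2)[OF g(1) V(3)]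
        g(4,5) by simp
    also have "\<dots> = tdist T' (p r) (?g k (p s))" using f0 k g V kG by simp
    finally have 1: "tdist T' (f0 u) (f0 w) = tdist T' (p r) (?g k (p s))" .
    have 2: "tdist T (vertex_point u) (vertex_point w) = tdist T (vertex_point r) (point_act G T k (vertex_point s))"
      using T.tdist_act[OF g(1), of "vertex_point r" "vertex_point w'"] g V k kG
      by (simp add: T.pact_vertex T.vertex_point_in_points)
    have P: "p r \<in> T'.P" "?a r \<in> T'.P" "?g k (p s) \<in> T'.P" "?g k (?a s) \<in> T'.P" "p s \<in> T'.P" "?a s \<in> T'.P"
      using p(1) h(1) g k kG T'.pact_closed by auto
    have 3: "tdist T' (?g k (?a s)) (?g k (p s)) \<le> \<epsilon> / 2" using T'.tdist_act[OF kG P(6,5)] p(3)[OF k(2)] by simp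
    have 4: "tdist T' (?a r) (p r) \<le> \<epsilon> / 2" using p(3)[OF g(2)] .
    have 5: "tdist T' (p r) (?g k (p s)) \<le> tdist T' (p r) (?a r) + tdist T' (?a r) (?g k (p s))" using tri P by blast
    have 6: "tdist T' (?a r) (?g k (p s)) \<le> tdist T' (?a r) (?g k (?a s)) + tdist T' (?g k (?a s)) (?g k (p s))" using tri P by blast
    have 7: "tdist T' (?a r) (?g k (?a s)) \<le> tdist T' (?a r) (p r) + tdist T' (p r) (?g k (?a s))" using tri P by blast
    have 8: "tdist T' (p r) (?g k (?a s)) \<le> tdist T' (p r) (?g k (p s)) + tdist T' (?g k (p s)) (?g k (?a s))" using tri P by blast
    show ?thesis unfolding 1 2
      using 3 4 5 6 7 8 comm[OF P(1,2)] comm[OF P(3,4)] h(2)[OF g(2) k(2,1)] unfolding abs_le_iff abs_less_iff by linarith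
  qed
  interpret f0: approximation G T T' f0 "2 * \<epsilon>" m
    using f0 f0_near m by unfold_locales auto
  \<comment> \<open>For the error 2 \<epsilon> of \<open>f0\<close>, the nearby fixed vertex is
    within 4 \<epsilon>.\<close>
  have "\<exists>q. q \<in> T'.V \<and> tdist T' (f0 r) (vertex_point q) \<le> 4 * \<epsilon> \<and> (\<forall>g\<in>carrier G. act T g r = r \<longrightarrow> act T' g q = q)"
    if "r \<in> R" for r
    using f0.near_fixed_vertex[OF RV[OF that] nontrivial] by auto
  then obtain q where q: "\<And>r. r \<in> R \<Longrightarrow> q r \<in> T'.V" "\<And>r. r \<in> R \<Longrightarrow> tdist T' (f0 r) (vertex_point (q r)) \<le> 4 * \<epsilon>"
    "\<And>r g. r \<in> R \<Longrightarrow> g \<in> carrier G \<Longrightarrow> act T g r = r \<Longrightarrow> act T' g (q r) = q r" by metis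
  have "?g g x \<in> vertex_point ` T'.V" if "g \<in> carrier G" "x \<in> vertex_point ` T'.V" for g x
    using that T'.pact_vertex by auto
  then obtain f where f: "\<And>v. v \<in> T.V \<Longrightarrow> f v \<in> vertex_point ` T'.V" "\<And>g v. g \<in> carrier G \<Longrightarrow> v \<in> T.V \<Longrightarrow> f (act T g v) = ?g g (f v)"
    "\<And>r. r \<in> R \<Longrightarrow> f r = vertex_point (q r)"
    by (rule_tac T.equivariant_extension[of R "\<lambda>r. vertex_point (q r)" "vertex_point ` T'.V" ?g])
      (use R q T'.pact_vertex T'.pact_mult in \<open>auto\<close>)
  have fP: "f v \<in> T'.P" if "v \<in> T.V" for v using f(1)[OF that] T'.vertex_point_in_points by auto
  have close: "tdist T' (f0 v) (f v) \<le> 4 * \<epsilon>" if v: "v \<in> T.V" for v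
  proof -
    obtain g r where g: "g \<in> carrier G" "r \<in> R" "v = act T g r" using R(2)[OF v] by blast
    have rV: "r \<in> T.V" using RV g by blast
    have "tdist T' (f0 v) (f v) = tdist T' (f0 r) (f r)"
      using T'.tdist_act[OF g(1) f0(1)[OF rV] fP[OF rV]] f0(2)[OF g(1) rV] f(2)[OF g(1) rV] g(3) by simp
    then show ?thesis using q(2) f(3) g by simp
  qed
  \<comment> \<open>The total is 2 \<epsilon> + 4 \<epsilon> + 4 \<epsilon>, and the hypothesis on
    \<open>40 * \<epsilon>\<close> is the smallness condition of \<open>approximation\<close> for
    this error.\<close>
  have "\<bar>tdist T' (f u) (f w) - tdist T (vertex_point u) (vertex_point w)\<bar> \<le> 10 * \<epsilon>" if uw: "(u, w) \<in> near T" for u w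
  proof -
    have V: "u \<in> T.V" "w \<in> T.V" using uw by (auto simp: near_def)
    note P = f0(1)[OF V(1)] f0(1)[OF V(2)] fP[OF V(1)] fP[OF V(2)]
    have "tdist T' (f u) (f w) \<le> tdist T' (f u) (f0 u) + tdist T' (f0 u) (f w)"
      "tdist T' (f0 u) (f w) \<le> tdist T' (f0 u) (f0 w) + tdist T' (f0 w) (f w)"
      "tdist T' (f0 u) (f0 w) \<le> tdist T' (f0 u) (f u) + tdist T' (f u) (f0 w)"
      "tdist T' (f u) (f0 w) \<le> tdist T' (f u) (f w) + tdist T' (f w) (f0 w)" using tri P by blast+
    then show ?thesis
      using close[OF V(1)] close[OF V(2)] comm[OF P(1,3)] comm[OF P(2,4)] f0_near[OF uw] unfolding abs_le_iff by linarith
  qed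
  then have "vertex_approximation G T T' f (10 * \<epsilon>) m"
    using f fP m by unfold_locales auto
  then show ?thesis by blast
qed

context vertex_approximation
begin

text \<open>Every edge of \<open>T'\<close> is crossed by the image of an edge of \<open>T\<close>,
  which can be translated into \<open>F\<close>, and the image of each pair in \<open>F\<close>
  crosses finitely many edges. The lower bound 1 on a crossing number later bounds the length
  parameter of the orbit.\<close>

lemma finite_edge_orbits:
  assumes "finite F" "F \<subseteq> near T"
    "\<And>u w. (u, w) \<in> near T \<Longrightarrow> \<exists>g\<in>carrier G. \<exists>(u', w')\<in>F. u = act T g u' \<and> w = act T g w'"
  shows "finite (edge_orbits G T')"
    and "k \<in> edge_orbits G T' \<Longrightarrow> \<exists>(u, w)\<in>F. 1 \<le> crossings T'.E k (f u) (f w)"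
proof -
  have ex: "\<exists>u w e. (u, w) \<in> F \<and> e \<in> T'.E \<and> sep T'.E e (f u) (f w) \<noteq> 0 \<and> k = orbit G (edge_act T') e"
    if k: "k \<in> edge_orbits G T'" for k
  proof -
    obtain e where e: "e \<in> T'.E" "k = orbit G (edge_act T') e" using k by (rule T'.edge_orbitsE)
    obtain u w where uw: "{u, w} \<in> T.E" "sep T'.E e (f u) (f w) \<noteq> 0" using edge_crossed[OF e(1)] .
    then have "(u, w) \<in> near T" using T.edge_verts by (auto simp: near_def)
    then obtain g u' w' where g: "g \<in> carrier G" "(u', w') \<in> F" "u = act T g u'" "w = act T g w'" using assms(3) by blast
    have V: "u' \<in> T.V" "w' \<in> T.V" using g(2) assms(2) by (auto simp: near_def)
    let ?e = "edge_act T' (inv g) e"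
    have ge: "?e \<in> T'.E" "edge_act T' g ?e = e" using g e T'.edge_act_closed T'.edge_act_inv by auto
    have "sep T'.E e (f u) (f w) = sep T'.E ?e (f u') (f w')"
      using T'.sep_act[OF g(1) ge(1), of "f u'" "f w'"] ge(2) g f_act V by simp
    then have "sep T'.E ?e (f u') (f w') \<noteq> 0" using uw by simp
    moreover have "k = orbit G (edge_act T') ?e" using T'.edge_orbit_act[of "inv g" e] g e by simp
    ultimately show ?thesis using g(2) ge(1) by blast
  qed
  have V: "u \<in> T.V" "w \<in> T.V" if "(u, w) \<in> F" for u w using that assms(2) by (auto simp: near_def)
  have "edge_orbits G T' \<subseteq> (\<Union>(u, w)\<in>F. orbit G (edge_act T') ` {e \<in> T'.E. sep T'.E e (f u) (f w) \<noteq> 0})"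
  proof
    fix k assume "k \<in> edge_orbits G T'"
    then show "k \<in> (\<Union>(u, w)\<in>F. orbit G (edge_act T') ` {e \<in> T'.E. sep T'.E e (f u) (f w) \<noteq> 0})"
      using ex[of k] by blast
  qed
  moreover have "finite (\<Union>(u, w)\<in>F. orbit G (edge_act T') ` {e \<in> T'.E. sep T'.E e (f u) (f w) \<noteq> 0})"
    using assms(1) T'.finite_sep V by auto
  ultimately show "finite (edge_orbits G T')" by (rule finite_subset)
  assume k: "k \<in> edge_orbits G T'"
  then obtain u w e where uw: "(u, w) \<in> F" "e \<in> T'.E" "sep T'.E e (f u) (f w) \<noteq> 0" "k = orbit G (edge_act T') e"
    using ex by blast
  let ?M = "{e \<in> T'.E. e \<in> k \<and> sep T'.E e (f u) (f w) \<noteq> 0}"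
  have "finite ?M"
    by (rule finite_subset[OF _ T'.finite_sep[of "f u" "f w"]]) (use V[OF uw(1)] in auto)
  moreover have "e \<in> ?M" using uw T'.edge_in_orbit by simp
  ultimately have "card ?M \<noteq> 0" by (simp add: card_eq_0_iff) blast
  then have "1 \<le> card ?M" by simp
  then show "\<exists>(u, w)\<in>F. 1 \<le> crossings T'.E k (f u) (f w)"
    using crossings_card[OF V[OF uw(1)], of k] uw(1) by (intro bexI[of _ "(u, w)"]) auto
qed

text \<open>The recursion along paths holds in \<open>T1\<close> for its own lengths and in
  \<open>T'\<close> for any weights \<open>l\<close>, so an identity on near pairs extends to all
  pairs of images, and these span both trees. Thus one approximating tree is recognized in the
  closed cone of another.\<close>

lemma in_cone:
  fixes T1 :: "('g, 'v) gtree"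
  assumes T1: "vertex_approximation G T T1 f1 \<delta>' m'"
    and fin: "finite (edge_orbits G T')" and l: "\<And>k. k \<in> edge_orbits G T' \<Longrightarrow> 0 \<le> l k"
    and eq: "\<And>u w. (u, w) \<in> near T \<Longrightarrow>
      tdist T1 (f1 u) (f1 w) = (\<Sum>k\<in>edge_orbits G T'. l k * crossings T'.E k (f u) (f w))"
  shows "T1 \<in> cone_point G T' l"
proof -
  interpret T1: vertex_approximation G T T1 f1 \<delta>' m' by (rule T1)
  let ?l = "\<lambda>e. l (orbit G (edge_act T') e)"
  have wd: "wdist T'.E ?l (f u) (f w) = (\<Sum>k\<in>edge_orbits G T'. l k * crossings T'.E k (f u) (f w))"
    if "u \<in> T.V" "w \<in> T.V" for u w
    using T'.wdist_orbit_lengths[OF fin] that by simp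
  have all: "T1.d u w = wdist T'.E ?l (f u) (f w)" if uw: "u \<in> T.V" "w \<in> T.V" for u w
  proof (rule near_determines[OF T.simplicial_tree_axioms, where N = "\<lambda>u w. T1.d u w" and N' = "\<lambda>u w. wdist T'.E ?l (f u) (f w)"])
    show "T1.d u w = wdist T'.E ?l (f u) (f w)" if "(u, w) \<in> near T" for u w
    proof -
      have "u \<in> T.V" "w \<in> T.V" using that by (auto simp: near_def)
      then show ?thesis using eq[OF that] wd T1.T'.tdist_eq[of "f1 u" "f1 w"] by simp
    qed
    show "T1.d (last (y # ys)) w + T1.d y z = T1.d (last (y # ys)) z + T1.d y w"
      if "simple_path T.E (w # z # y # ys)" for w z y ys
      using T1.path_recursion[OF that] .
    show "wdist T'.E ?l (f (last (y # ys))) (f w) + wdist T'.E ?l (f y) (f z) =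
        wdist T'.E ?l (f (last (y # ys))) (f z) + wdist T'.E ?l (f y) (f w)"
      if "simple_path T.E (w # z # y # ys)" for w z y ys
      using path_recursion[OF that] .
  qed (rule uw)+
  show ?thesis
  proof (rule T'.cone_pointI[where A = T.V and \<alpha> = "act T" and f = f and f' = f1])
    show "metric_tree G T1" by unfold_locales
    show "tdist T1 (f1 u) (f1 w) = tdist (with_lengths G T' l) (f u) (f w)" if "u \<in> T.V" "w \<in> T.V" for u w
      using all[OF that] that T'.tdist_with_lengths[of "f u" "f w" l] l T1.T'.tdist_eq[of "f1 u" "f1 w"] by simp
  qed (use l f_act T1.f_act spanning T1.spanning in auto)
qed

end

section \<open>Comparison of the topologies\<close>

text \<open>Weights on \<open>K\<^sub>1\<close> are moved to \<open>K\<^sub>0\<close>, sharing them equally among the elements of the same type.\<close>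

lemma transfer_weights:
  fixes \<mu> :: "'k \<Rightarrow> real" and c\<^sub>0 :: "'j \<Rightarrow> 'c" and c\<^sub>1 :: "'k \<Rightarrow> 'c"
  assumes fin: "finite K\<^sub>0" "finite K\<^sub>1" and c: "c\<^sub>0 ` K\<^sub>0 = c\<^sub>1 ` K\<^sub>1" and pos: "\<And>k. k \<in> K\<^sub>1 \<Longrightarrow> 0 < \<mu> k"
  obtains l where "\<And>k. k \<in> K\<^sub>0 \<Longrightarrow> 0 < l k"
    "\<And>\<phi>. (\<Sum>k\<in>K\<^sub>0. l k * \<phi> (c\<^sub>0 k)) = (\<Sum>k\<in>K\<^sub>1. \<mu> k * (\<phi> (c\<^sub>1 k) :: real))"
proof -
  define l where "l k = (\<Sum>j | j \<in> K\<^sub>1 \<and> c\<^sub>1 j = c\<^sub>0 k. \<mu> j) / real (card {j \<in> K\<^sub>0. c\<^sub>0 j = c\<^sub>0 k})" for k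
  have "0 < l k" if k: "k \<in> K\<^sub>0" for k
  proof -
    obtain j where "j \<in> K\<^sub>1" "c\<^sub>1 j = c\<^sub>0 k" using c k by (metis imageE imageI)
    then have "0 < (\<Sum>j | j \<in> K\<^sub>1 \<and> c\<^sub>1 j = c\<^sub>0 k. \<mu> j)" using fin pos by (intro sum_pos) auto
    moreover have "0 < card {j \<in> K\<^sub>0. c\<^sub>0 j = c\<^sub>0 k}" using fin k by (auto simp: card_gt_0_iff)
    ultimately show ?thesis by (simp add: l_def)
  qed
  moreover have "(\<Sum>k\<in>K\<^sub>0. l k * \<phi> (c\<^sub>0 k)) = (\<Sum>k\<in>K\<^sub>1. \<mu> k * \<phi> (c\<^sub>1 k))" for \<phi> :: "'c \<Rightarrow> real"
  proof -
    have "(\<Sum>k\<in>K\<^sub>0. l k * \<phi> (c\<^sub>0 k)) = (\<Sum>x\<in>c\<^sub>0 ` K\<^sub>0. \<Sum>k | k \<in> K\<^sub>0 \<and> c\<^sub>0 k = x. l k * \<phi> (c\<^sub>0 k))"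
      using fin by (intro sum.group[symmetric]) auto
    also have "\<dots> = (\<Sum>x\<in>c\<^sub>0 ` K\<^sub>0. \<phi> x * (\<Sum>j | j \<in> K\<^sub>1 \<and> c\<^sub>1 j = x. \<mu> j))"
    proof (rule sum.cong[OF refl])
      fix x assume x: "x \<in> c\<^sub>0 ` K\<^sub>0"
      let ?n = "card {k \<in> K\<^sub>0. c\<^sub>0 k = x}" and ?s = "\<Sum>j | j \<in> K\<^sub>1 \<and> c\<^sub>1 j = x. \<mu> j"
      have n: "?n \<noteq> 0" using fin x by (auto simp: card_eq_0_iff)
      have "(\<Sum>k | k \<in> K\<^sub>0 \<and> c\<^sub>0 k = x. l k * \<phi> (c\<^sub>0 k)) = (\<Sum>k | k \<in> K\<^sub>0 \<and> c\<^sub>0 k = x. ?s / real ?n * \<phi> x)"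
        by (intro sum.cong) (auto simp: l_def)
      also have "\<dots> = \<phi> x * ?s" using n by simp
      finally show "(\<Sum>k | k \<in> K\<^sub>0 \<and> c\<^sub>0 k = x. l k * \<phi> (c\<^sub>0 k)) = \<phi> x * ?s" .
    qed
    also have "\<dots> = (\<Sum>x\<in>c\<^sub>1 ` K\<^sub>1. \<Sum>j | j \<in> K\<^sub>1 \<and> c\<^sub>1 j = x. \<mu> j * \<phi> (c\<^sub>1 j))"
      unfolding c sum_distrib_left by (intro sum.cong) (auto simp: mult.commute)
    also have "\<dots> = (\<Sum>k\<in>K\<^sub>1. \<mu> k * \<phi> (c\<^sub>1 k))"
      using fin by (intro sum.group) auto
    finally show ?thesis .
  qed
  ultimately show ?thesis using that by blast
qed

text \<open>If every point of \<open>S\<close> had a neighbourhood visited finitely often, a finite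
  subcover would make \<open>I\<close> finite. A cluster point takes the place of a convergent
  subsequence.\<close>

lemma compactin_cluster_point:
  assumes S: "compactin X S" and I: "infinite I" "\<And>n. n \<in> I \<Longrightarrow> x n \<in> S"
  obtains p where "p \<in> S" "\<And>W. openin X W \<Longrightarrow> p \<in> W \<Longrightarrow> infinite {n \<in> I. x n \<in> W}"
proof (rule ccontr)
  assume n: "\<not> thesis"
  have "\<exists>W. openin X W \<and> p \<in> W \<and> finite {n \<in> I. x n \<in> W}" if "p \<in> S" for p
  proof (rule ccontr)
    assume "\<not> (\<exists>W. openin X W \<and> p \<in> W \<and> finite {n \<in> I. x n \<in> W})"
    then have thesis by (intro \<open>\<And>p. p \<in> S \<Longrightarrow> (\<And>W. openin X W \<Longrightarrow> p \<in> W \<Longrightarrow> infinite {n \<in> I. x n \<in> W}) \<Longrightarrow> thesis\<close>[OF \<open>p \<in> S\<close>]) auto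
    then show False using n by contradiction
  qed
  then obtain W where W: "\<forall>p\<in>S. openin X (W p) \<and> p \<in> W p \<and> finite {n \<in> I. x n \<in> W p}"
    using bchoice[of S "\<lambda>p W. openin X W \<and> p \<in> W \<and> finite {n \<in> I. x n \<in> W}"] by blast
  have "\<forall>\<U>. (\<forall>U\<in>\<U>. openin X U) \<and> S \<subseteq> \<Union>\<U> \<longrightarrow> (\<exists>\<F>. finite \<F> \<and> \<F> \<subseteq> \<U> \<and> S \<subseteq> \<Union>\<F>)"
    using S by (simp add: compactin_def)
  moreover have "(\<forall>U\<in>W ` S. openin X U) \<and> S \<subseteq> \<Union>(W ` S)" using W by blast
  ultimately have "\<exists>\<F>. finite \<F> \<and> \<F> \<subseteq> W ` S \<and> S \<subseteq> \<Union>\<F>" by blast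
  then obtain \<F> where F: "finite \<F>" "\<F> \<subseteq> W ` S" "S \<subseteq> \<Union>\<F>" by blast
  have "I \<subseteq> (\<Union>U\<in>\<F>. {n \<in> I. x n \<in> U})" using I(2) F(3) by blast
  moreover have "finite (\<Union>U\<in>\<F>. {n \<in> I. x n \<in> U})" using F W by blast
  ultimately show False using I(1) finite_subset by blast
qed

lemma wdist_cong: "(\<And>e. e \<in> E \<Longrightarrow> l e = l' e) \<Longrightarrow> wdist E l x y = wdist E l' x y"
  by (simp add: wdist_def)

lemma (in metric_tree) orbit_lengths:
  assumes "finite (edge_orbits G T)"
  obtains \<mu> where "\<And>k. k \<in> edge_orbits G T \<Longrightarrow> 0 < \<mu> k"
    "\<And>x y. x \<in> P \<Longrightarrow> y \<in> P \<Longrightarrow> tdist T x y = (\<Sum>k\<in>edge_orbits G T. \<mu> k * crossings E k x y)"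
proof -
  define \<mu> where "\<mu> k = len T (SOME e. e \<in> k)" for k
  have \<mu>: "\<mu> (orbit G (edge_act T) e) = len T e" if e: "e \<in> E" for e
  proof -
    have "(SOME f. f \<in> orbit G (edge_act T) e) \<in> orbit G (edge_act T) e"
      using edge_in_orbit[OF e] by (rule someI)
    then obtain g where "g \<in> carrier G" "(SOME f. f \<in> orbit G (edge_act T) e) = edge_act T g e"
      unfolding orbit_def[of G "edge_act T" e] by blast
    then show ?thesis using e by (simp add: \<mu>_def)
  qed
  have "tdist T x y = (\<Sum>k\<in>edge_orbits G T. \<mu> k * crossings E k x y)" if "x \<in> P" "y \<in> P" for x y
    using wdist_orbit_lengths[OF assms that, of \<mu>] wdist_cong[of E "len T" "\<lambda>e. \<mu> (orbit G (edge_act T) e)"] \<mu>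
      tdist_eq[OF that] by simp
  moreover have "0 < \<mu> k" if "k \<in> edge_orbits G T" for k
    using that \<mu> by (elim edge_orbitsE) simp
  ultimately show ?thesis using that by blast
qed

context deformation_space
begin

text \<open>The test points are orbit representatives; the test elements generate their stabilizers
  and carry representatives to the vertices near them. The construction of an approximation consults
  nothing else.\<close>

lemma gromov_nbhd_approximations:
  assumes fg: "finitely_generated G (carrier G)" and c: "c \<in> D" "T \<in> c"
    and lf: "locally_finite_gtree T" "fg_vertex_stabilizers G T" and nontrivial: "edges T \<noteq> {}"
    and R: "finite R" "R \<subseteq> verts T" "\<And>v. v \<in> verts T \<Longrightarrow> \<exists>g\<in>carrier G. \<exists>r\<in>R. v = act T g r"
      "\<And>r s g. r \<in> R \<Longrightarrow> s \<in> R \<Longrightarrow> g \<in> carrier G \<Longrightarrow> act T g r = s \<Longrightarrow> r = s"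
    and m: "\<And>e. e \<in> edges T \<Longrightarrow> m \<le> len T e"
  obtains X A where "finite X" "X \<subseteq> points T" "finite A" "A \<subseteq> carrier G"
    "\<And>\<epsilon> c'. 0 < \<epsilon> \<Longrightarrow> 40 * \<epsilon> < m \<Longrightarrow> c' \<in> gromov_nbhd G D T X A \<epsilon> \<Longrightarrow>
      c' \<in> D \<and> (\<exists>T'\<in>c'. \<exists>f. vertex_approximation G T T' f (10 * \<epsilon>) m)"
proof -
  interpret T: metric_tree G T using c by (rule class_tree)
  have "\<exists>S. finite S \<and> S \<subseteq> carrier G \<and> stabilizer G (act T) r = generate G S" if "r \<in> R" for r
    using lf(2) R(2) that by (auto simp: fg_vertex_stabilizers_def finitely_generated_def)
  then obtain S where S: "\<forall>r\<in>R. finite (S r) \<and> S r \<subseteq> carrier G \<and> stabilizer G (act T) r = generate G (S r)"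
    using bchoice[of R "\<lambda>r S. finite S \<and> S \<subseteq> carrier G \<and> stabilizer G (act T) r = generate G S"] by blast
  define F where "F = {(u, w) \<in> near T. u \<in> R}"
  have F: "finite F" unfolding F_def by (rule T.finite_near[OF lf(1) R(1,2)])
  have "\<exists>g. g \<in> carrier G \<and> (\<exists>r\<in>R. snd p = act T g r)" if "p \<in> F" for p
  proof -
    have "snd p \<in> T.V" using that by (auto simp: F_def near_def)
    then show ?thesis using R(3) by blast
  qed
  then obtain \<gamma> where \<gamma>: "\<forall>p\<in>F. \<gamma> p \<in> carrier G \<and> (\<exists>r\<in>R. snd p = act T (\<gamma> p) r)"
    using bchoice[of F "\<lambda>p g. g \<in> carrier G \<and> (\<exists>r\<in>R. snd p = act T g r)"] by blast
  define A where "A = (\<Union>r\<in>R. S r) \<union> \<gamma> ` F"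
  define X where "X = vertex_point ` R"
  have A: "finite A" "A \<subseteq> carrier G" using R(1) S F \<gamma> by (auto simp: A_def)
  have A1: "\<exists>S\<subseteq>A. stabilizer G (act T) r = generate G S" if "r \<in> R" for r
    using S that by (intro exI[of _ "S r"]) (auto simp: A_def)
  have A2: "\<exists>g\<in>A. \<exists>r\<in>R. w = act T g r" if "(u, w) \<in> near T" "u \<in> R" for u w
  proof -
    have p: "(u, w) \<in> F" using that by (simp add: F_def)
    then have "\<exists>r\<in>R. w = act T (\<gamma> (u, w)) r" using \<gamma> by force
    then show ?thesis using p by (auto simp: A_def)
  qed
  show ?thesis
  proof (rule that[of X A])
    show "finite X" "X \<subseteq> points T" using R T.vertex_point_in_points by (auto simp: X_def)
    show "finite A" "A \<subseteq> carrier G" by fact+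
    fix \<epsilon> :: real and c' assume \<epsilon>: "0 < \<epsilon>" "40 * \<epsilon> < m" and c': "c' \<in> gromov_nbhd G D T X A \<epsilon>"
    then obtain T' h where h: "c' \<in> D" "T' \<in> c'" "h ` X \<subseteq> points T'"
      "\<forall>x\<in>X. \<forall>y\<in>X. \<forall>g\<in>A.
           \<bar>tdist T x (point_act G T g y) - tdist T' (h x) (point_act G T' g (h y))\<bar> < \<epsilon>"
      unfolding gromov_nbhd_def by (elim CollectE conjE bexE exE)
    have "\<exists>f. vertex_approximation G T T' f (10 * \<epsilon>) m"
    proof (rule approximation_exists[where R = R and A = A and h = h])
      show "metric_tree G T" by unfold_locales
      show "metric_tree G T'" using h(1,2) by (rule class_tree)
      show "elliptic_subgroups G T \<subseteq> elliptic_subgroups G T'"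
        using same_elliptic_subgroups[OF c h(1,2)] by simp
    qed (use nontrivial R(2-4) A(2) A1 A2 m \<epsilon> h(3,4) in \<open>simp_all add: X_def image_subset_iff\<close>)
    then show "c' \<in> D \<and> (\<exists>T'\<in>c'. \<exists>f. vertex_approximation G T T' f (10 * \<epsilon>) m)" using h(1,2) by blast
  qed
qed

lemma weak_open_params:
  assumes U: "openin (weak_topology G D) U" and c: "c \<in> D" "T \<in> c"
  obtains W where "openin (powertop_real (edge_orbits G T)) W"
    "\<And>l. l \<in> closed_cone_params G D T \<Longrightarrow> cone_point G T l \<in> U \<longleftrightarrow> l \<in> W"
proof -
  let ?X = "powertop_real (edge_orbits G T)" and ?P = "closed_cone_params G D T"
  have "?P \<subseteq> topspace ?X"
    by (auto simp: closed_cone_params_def cone_params_def PiE_iff extensional_def)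
  then have top: "topspace (subtopology ?X ?P) = ?P" by (rule topspace_subtopology_subset)
  have "closedin (subtopology ?X ?P) {l \<in> ?P. cone_point G T l \<in> D - U}"
    using U c unfolding openin_weak_topology weakly_closed_def by simp
  then have "openin (subtopology ?X ?P) (?P - {l \<in> ?P. cone_point G T l \<in> D - U})"
    using openin_diff[OF openin_topspace, of "subtopology ?X ?P"] unfolding top by simp
  then obtain W where W: "openin ?X W" "?P - {l \<in> ?P. cone_point G T l \<in> D - U} = W \<inter> ?P"
    unfolding openin_subtopology by blast
  have "cone_point G T l \<in> U \<longleftrightarrow> l \<in> W" if l: "l \<in> ?P" for l
  proof -
    have "cone_point G T l \<in> D" using l by (simp add: closed_cone_params_def)
    then have "cone_point G T l \<in> U \<longleftrightarrow> l \<in> ?P - {l \<in> ?P. cone_point G T l \<in> D - U}" using l by simp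
    then have "cone_point G T l \<in> U \<longleftrightarrow> l \<in> W \<inter> ?P" unfolding W(2) .
    then show ?thesis using l by simp
  qed
  then show ?thesis using W(1) that by blast
qed

lemma weak_open_imp_gromov_nbhd:
  fixes T :: "('g, 'v) gtree"
  assumes fg: "finitely_generated G (carrier G)"
    and lf: "locally_finite_gtree T" "fg_vertex_stabilizers G T" and nontrivial: "edges T \<noteq> {}"
    and U: "openin (weak_topology G D) U" and c: "c \<in> U" "T \<in> c"
  shows "\<exists>X A \<epsilon>. finite X \<and> X \<subseteq> points T \<and> finite A \<and> A \<subseteq> carrier G \<and> \<epsilon> > 0 \<and>
        gromov_nbhd G D T X A \<epsilon> \<subseteq> U"
proof (rule ccontr)
  assume neg: "\<not> ?thesis"
  have cD: "c \<in> D" using U c(1) openin_subset[OF U] by (auto simp: topspace_weak_topology)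
  interpret T: metric_tree G T using cD c(2) by (rule class_tree)
  obtain R where R: "finite R" "R \<subseteq> T.V" "\<And>v. v \<in> T.V \<Longrightarrow> \<exists>g\<in>carrier G. \<exists>r\<in>R. v = act T g r"
    "\<And>r s g. r \<in> R \<Longrightarrow> s \<in> R \<Longrightarrow> g \<in> carrier G \<Longrightarrow> act T g r = s \<Longrightarrow> r = s"
    by (rule T.orbit_transversal[OF fg]) (rule that)
  obtain m N where m: "0 < m" "\<And>e. e \<in> T.E \<Longrightarrow> m \<le> len T e"
    and N: "\<And>v. v \<in> T.V \<Longrightarrow> finite (incident T v)" "\<And>v. v \<in> T.V \<Longrightarrow> card (incident T v) \<le> N"
    by (rule T.finite_geometry[OF lf(1) R(1,2,3)]) (assumption+, rule that)
  obtain X A where XA: "finite X" "X \<subseteq> points T" "finite A" "A \<subseteq> carrier G"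
    "\<And>\<epsilon> c'. 0 < \<epsilon> \<Longrightarrow> 40 * \<epsilon> < m \<Longrightarrow> c' \<in> gromov_nbhd G D T X A \<epsilon> \<Longrightarrow>
      c' \<in> D \<and> (\<exists>T'\<in>c'. \<exists>f. vertex_approximation G T T' f (10 * \<epsilon>) m)"
    by (rule gromov_nbhd_approximations[OF fg cD c(2) lf nontrivial R m(2)]) (assumption+, rule that)
  \<comment> \<open>Near pairs up to translation; finitely many because \<open>T\<close> is locally
    finite.\<close>
  define F where "F = {(u, w) \<in> near T. u \<in> R}"
  have F: "finite F" "F \<subseteq> near T" unfolding F_def using T.finite_near[OF lf(1) R(1,2)] by auto
  have FV: "u \<in> T.V" "w \<in> T.V" if "(u, w) \<in> F" for u w using that F(2) by (auto simp: near_def)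
  have F_rep: "\<exists>g\<in>carrier G. \<exists>(u', w')\<in>F. u = act T g u' \<and> w = act T g w'" if uw: "(u, w) \<in> near T" for u w
  proof -
    have V: "u \<in> T.V" "w \<in> T.V" using uw by (auto simp: near_def)
    obtain g r where g: "g \<in> carrier G" "r \<in> R" "u = act T g r" using R(3)[OF V(1)] by blast
    have rV: "r \<in> T.V" using R(2) g(2) by blast
    have "(act T (inv g) u, act T (inv g) w) \<in> near T" using T.near_act[OF _ uw] g(1) by simp
    then have "(r, act T (inv g) w) \<in> F" using g rV by (simp add: F_def)
    moreover have "w = act T g (act T (inv g) w)" using g(1) V(2) by simp
    ultimately show ?thesis using g(1,3) by blast
  qed
  \<comment> \<open>This tends to 0 and satisfies \<open>4 * \<delta> n < m\<close> for every
    \<open>n\<close>; the Gromov radius is a tenth of it because an approximation multiplies the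
    error by 10.\<close>
  define \<delta> where "\<delta> n = m / (10 * real (Suc n))" for n
  have \<delta>: "0 < \<delta> n" "4 * \<delta> n < m" for n
    using m(1) by (auto simp: \<delta>_def field_simps intro!: add_pos_nonneg)
  have "\<exists>c' T' f. c' \<in> D \<and> c' \<notin> U \<and> T' \<in> c' \<and> vertex_approximation G T T' f (\<delta> n) m" for n
  proof -
    have \<epsilon>: "0 < \<delta> n / 10" "40 * (\<delta> n / 10) < m" using \<delta>[of n] by auto
    have "\<not> gromov_nbhd G D T X A (\<delta> n / 10) \<subseteq> U" using neg XA(1-4) \<epsilon>(1) by blast
    then obtain c' where c': "c' \<in> gromov_nbhd G D T X A (\<delta> n / 10)" "c' \<notin> U" by blast
    from XA(5)[OF \<epsilon> c'(1)] show ?thesis using c'(2) by auto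
  qed
  then obtain cs Ts fs where seq: "\<And>n. cs n \<in> D" "\<And>n. cs n \<notin> U" "\<And>n. Ts n \<in> cs n"
    "\<And>n. vertex_approximation G T (Ts n) (fs n) (\<delta> n) m" by metis
  define cr where "cr n k u w = crossings (edges (Ts n)) k (fs n u) (fs n w)" for n k u w
  \<comment> \<open>A column records the crossings of one edge orbit with all pairs of
    \<open>F\<close>. A type is only the set of columns, so several orbits may share one.\<close>
  define col where "col n k = restrict (\<lambda>(u, w). cr n k u w) F" for n k
  define K where "K n = edge_orbits G (Ts n)" for n
  have finK: "finite (K n)" for n
    unfolding K_def using vertex_approximation.finite_edge_orbits(1)[OF seq(4) F F_rep] .
  have crossed: "\<exists>(u, w)\<in>F. 1 \<le> cr n k u w" if "k \<in> K n" for n k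
    unfolding cr_def
    by (rule vertex_approximation.finite_edge_orbits(2)[OF seq(4) F F_rep]) (use that in \<open>auto simp: K_def\<close>)
  have "col n ` K n \<in> Pow (F \<rightarrow>\<^sub>E real ` {..4 * N})" for n
  proof -
    have "cr n k u w \<in> real ` {..4 * N}" if "k \<in> K n" "(u, w) \<in> F" for k u w
      unfolding cr_def
      by (rule vertex_approximation.crossings_near[OF seq(4) _ _ N]) (use that F(2) in \<open>auto simp: K_def\<close>)
    then show ?thesis by (auto simp: col_def)
  qed
  then have "range (\<lambda>n. col n ` K n) \<subseteq> Pow (F \<rightarrow>\<^sub>E real ` {..4 * N})" by blast
  moreover have "finite (Pow (F \<rightarrow>\<^sub>E real ` {..4 * N}))" using F(1) by (simp add: finite_PiE)
  ultimately have "finite (range (\<lambda>n. col n ` K n))" by (rule finite_subset)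
  then obtain z where z: "infinite {n \<in> UNIV. col n ` K n = col z ` K z}"
    using pigeonhole_infinite[OF infinite_UNIV_nat, of "\<lambda>n. col n ` K n"] by auto
  define I where "I = {n. col n ` K n = col z ` K z}"
  have I: "infinite I" using z by (simp add: I_def)
  interpret Z: vertex_approximation G T "Ts z" "fs z" "\<delta> z" m by (rule seq(4))
  \<comment> \<open>Distances on \<open>F\<close> involve the lengths only through the total weight
    of each column, so the lengths of a tree of the same type can be transferred to the edge orbits
    of \<open>Ts z\<close>.\<close>
  have "\<exists>l. (\<forall>k\<in>K z. 0 < l k) \<and> l \<in> extensional (K z) \<and>
      (\<forall>(u, w)\<in>F. (\<Sum>k\<in>K z. l k * cr z k u w) = tdist (Ts n) (fs n u) (fs n w))" if n: "n \<in> I" for n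
  proof -
    interpret An: vertex_approximation G T "Ts n" "fs n" "\<delta> n" m by (rule seq(4))
    obtain \<mu> where \<mu>: "\<And>k. k \<in> K n \<Longrightarrow> 0 < \<mu> k" "\<And>x y. x \<in> An.T'.P \<Longrightarrow> y \<in> An.T'.P \<Longrightarrow>
        tdist (Ts n) x y = (\<Sum>k\<in>K n. \<mu> k * crossings An.T'.E k x y)"
      using An.T'.orbit_lengths finK[of n] unfolding K_def by metis
    have "col z ` K z = col n ` K n" using n by (simp add: I_def)
    then obtain l where l: "\<And>k. k \<in> K z \<Longrightarrow> 0 < l k"
      "\<And>\<phi>. (\<Sum>k\<in>K z. l k * \<phi> (col z k)) = (\<Sum>k\<in>K n. \<mu> k * (\<phi> (col n k) :: real))"
      using transfer_weights[OF finK finK, of "col z" z "col n" n \<mu>] \<mu>(1) by metis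
    have "(\<Sum>k\<in>K z. restrict l (K z) k * cr z k u w) = tdist (Ts n) (fs n u) (fs n w)" if uw: "(u, w) \<in> F" for u w
    proof -
      have "(\<Sum>k\<in>K z. restrict l (K z) k * cr z k u w) = (\<Sum>k\<in>K z. l k * (\<lambda>c. c (u, w)) (col z k))"
        using uw by (intro sum.cong) (auto simp: col_def)
      also have "\<dots> = (\<Sum>k\<in>K n. \<mu> k * (\<lambda>c. c (u, w)) (col n k))" by (rule l(2))
      also have "\<dots> = (\<Sum>k\<in>K n. \<mu> k * crossings An.T'.E k (fs n u) (fs n w))"
        using uw by (intro sum.cong) (auto simp: col_def cr_def)
      also have "\<dots> = tdist (Ts n) (fs n u) (fs n w)" using \<mu>(2) FV[OF uw] by simp
      finally show ?thesis .
    qed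
    then show ?thesis using l(1) by (intro exI[of _ "restrict l (K z)"]) auto
  qed
  then obtain ls where ls: "\<forall>n\<in>I. (\<forall>k\<in>K z. 0 < ls n k) \<and> ls n \<in> extensional (K z) \<and>
      (\<forall>(u, w)\<in>F. (\<Sum>k\<in>K z. ls n k * cr z k u w) = tdist (Ts n) (fs n u) (fs n w))"
    using bchoice[of I "\<lambda>n l. (\<forall>k\<in>K z. 0 < l k) \<and> l \<in> extensional (K z) \<and>
      (\<forall>(u, w)\<in>F. (\<Sum>k\<in>K z. l k * cr z k u w) = tdist (Ts n) (fs n u) (fs n w))"] by blast
  \<comment> \<open>Equivariance of both sides extends the identity from \<open>F\<close> to all
    near pairs.\<close>
  have in_cone: "T1 \<in> cone_point G (Ts z) l"
    if T1: "vertex_approximation G T T1 f1 \<delta>' m'" and l: "\<And>k. k \<in> K z \<Longrightarrow> 0 \<le> l k"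
      and eq: "\<And>u w. (u, w) \<in> F \<Longrightarrow> (\<Sum>k\<in>K z. l k * cr z k u w) = tdist T1 (f1 u) (f1 w)" for T1 f1 \<delta>' m' l
  proof -
    interpret T1: vertex_approximation G T T1 f1 \<delta>' m' by (rule T1)
    show ?thesis
    proof (rule Z.in_cone[OF T1])
      show "finite (edge_orbits G (Ts z))" using finK K_def by metis
      show "0 \<le> l k" if "k \<in> edge_orbits G (Ts z)" for k using l that by (simp add: K_def)
      fix u w assume "(u, w) \<in> near T"
      then obtain g u' w' where g: "g \<in> carrier G" "(u', w') \<in> F" "u = act T g u'" "w = act T g w'"
        using F_rep by blast
      have V: "u' \<in> T.V" "w' \<in> T.V" using FV g(2) by blast+
      have "tdist T1 (f1 u) (f1 w) = tdist T1 (f1 u') (f1 w')"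
        using T1.T'.tdist_act[OF g(1) T1.f_closed[OF V(1)] T1.f_closed[OF V(2)]]
          T1.f_act[OF g(1) V(1)] T1.f_act[OF g(1) V(2)] g(3,4) by simp
      also have "\<dots> = (\<Sum>k\<in>K z. l k * cr z k u' w')" using eq[OF g(2)] by simp
      also have "\<dots> = (\<Sum>k\<in>K z. l k * crossings Z.T'.E k (fs z u) (fs z w))"
      proof (rule sum.cong[OF refl])
        fix k assume "k \<in> K z"
        then have k: "k \<in> edge_orbits G (Ts z)" by (simp add: K_def)
        show "l k * cr z k u' w' = l k * crossings Z.T'.E k (fs z u) (fs z w)"
          using Z.T'.crossings_act[OF k g(1) Z.f_closed[OF V(1)] Z.f_closed[OF V(2)]]
            Z.f_act[OF g(1) V(1)] Z.f_act[OF g(1) V(2)] g(3,4) by (simp add: cr_def)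
      qed
      finally show "tdist T1 (f1 u) (f1 w) =
          (\<Sum>k\<in>edge_orbits G (Ts z). l k * crossings Z.T'.E k (fs z u) (fs z w))" by (simp add: K_def)
    qed
  qed
  have Z_tree: "metric_tree G (Ts z)" using seq(1,3) by (rule class_tree)
  have params: "l \<in> closed_cone_params G D (Ts z) \<and> cone_point G (Ts z) l = c'"
    if "T1 \<in> cone_point G (Ts z) l" "c' \<in> D" "T1 \<in> c'" "l \<in> extensional (K z)" "\<And>k. k \<in> K z \<Longrightarrow> 0 \<le> l k"
      "\<exists>k\<in>K z. l k \<noteq> 0" for T1 l c'
    using cone_point_eq[OF that(2,3) Z_tree that(1)] that
    by (auto simp: closed_cone_params_def cone_params_def K_def PiE_iff)
  \<comment> \<open>A pair of distinct vertices, whose positive distance in \<open>T\<close> will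
    keep the limit parameters from all being 0.\<close>
  obtain a b where ab: "{a, b} \<in> T.E"
    using nontrivial T.edge_cases by (metis ex_in_conv)
  then have "(a, b) \<in> near T" using T.edge_verts by (auto simp: near_def)
  then obtain g a' b' where a'b': "g \<in> carrier G" "(a', b') \<in> F" "a = act T g a'" "b = act T g b'"
    using F_rep by blast
  have "a \<noteq> b" using T.edge_cases[OF ab] by (auto simp: doubleton_eq_iff)
  then have neq: "a' \<noteq> b'" using a'b'(3,4) by blast
  have near_eq: "\<bar>(\<Sum>k\<in>K z. ls n k * cr z k u w) - tdist T (vertex_point u) (vertex_point w)\<bar> \<le> \<delta> n"
    if n: "n \<in> I" and uw: "(u, w) \<in> F" for n u w
  proof -
    interpret An: vertex_approximation G T "Ts n" "fs n" "\<delta> n" m by (rule seq(4))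
    have "(\<Sum>k\<in>K z. ls n k * cr z k u w) = tdist (Ts n) (fs n u) (fs n w)" using ls n uw by auto
    then show ?thesis using An.f_near[of u w] F(2) uw by auto
  qed
  \<comment> \<open>Every orbit is crossed by the image of some pair of \<open>F\<close>, so its
    length is at most the distance between these images, which exceeds the distance of the pair in
    \<open>T\<close> by less than \<open>m\<close>.\<close>
  define B where "B = (\<Sum>(u, w)\<in>F. tdist T (vertex_point u) (vertex_point w)) + m"
  have tpos: "0 \<le> tdist T (vertex_point u) (vertex_point w)" if "(u, w) \<in> F" for u w
    using FV[OF that] T.vertex_point_in_points by (simp add: T.tdist_eq wdist_nonneg)
  have bound: "ls n \<in> K z \<rightarrow>\<^sub>E {0..B}" if n: "n \<in> I" for n
  proof -
    have l: "\<And>k. k \<in> K z \<Longrightarrow> 0 < ls n k" "ls n \<in> extensional (K z)" using ls n by auto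
    have "ls n k \<le> B" if k: "k \<in> K z" for k
    proof -
      obtain u w where uw: "(u, w) \<in> F" "1 \<le> cr z k u w" using crossed[OF k] by blast
      have "ls n k \<le> ls n k * cr z k u w" using uw(2) l(1)[OF k] by simp
      also have "\<dots> \<le> (\<Sum>k\<in>K z. ls n k * cr z k u w)"
        using finK k l(1) by (intro member_le_sum) (auto simp: cr_def crossings_nonneg less_imp_le)
      also have "\<dots> \<le> tdist T (vertex_point u) (vertex_point w) + m"
        using near_eq[OF n uw(1)] \<delta>[of n] unfolding abs_le_iff by linarith
      also have "tdist T (vertex_point u) (vertex_point w) \<le> (\<Sum>(u, w)\<in>F. tdist T (vertex_point u) (vertex_point w))"
        using member_le_sum[OF uw(1), of "\<lambda>(u, w). tdist T (vertex_point u) (vertex_point w)"] tpos F(1) by auto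
      finally show ?thesis by (simp add: B_def)
    qed
    then show ?thesis using l by (auto simp: PiE_iff less_imp_le)
  qed
  let ?X = "powertop_real (K z)"
  \<comment> \<open>The box contains its faces: at the cluster point some lengths may be 0, which is
    why closed cones are needed.\<close>
  have "compactin ?X (K z \<rightarrow>\<^sub>E {0..B})" by (simp add: compactin_PiE)
  then obtain l where l: "l \<in> K z \<rightarrow>\<^sub>E {0..B}" "\<And>W. openin ?X W \<Longrightarrow> l \<in> W \<Longrightarrow> infinite {n \<in> I. ls n \<in> W}"
    by (rule compactin_cluster_point[OF _ I bound]) (assumption+, rule that)
  have limit: "(\<Sum>k\<in>K z. l k * cr z k u w) = tdist T (vertex_point u) (vertex_point w)" if uw: "(u, w) \<in> F" for u w
  proof (rule ccontr)
    let ?\<phi> = "\<lambda>l. \<Sum>k\<in>K z. l k * cr z k u w" and ?t = "tdist T (vertex_point u) (vertex_point w)"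
    assume "?\<phi> l \<noteq> ?t"
    define \<eta> where "\<eta> = \<bar>?\<phi> l - ?t\<bar> / 2"
    have \<eta>: "0 < \<eta>" using \<open>?\<phi> l \<noteq> ?t\<close> by (simp add: \<eta>_def)
    have cont: "continuous_map ?X euclideanreal ?\<phi>"
      using finK by (intro continuous_map_sum continuous_map_real_mult continuous_map_product_projection) auto
    have "openin ?X {l' \<in> topspace ?X. ?\<phi> l' \<in> {?\<phi> l - \<eta> <..< ?\<phi> l + \<eta>}}"
      by (rule openin_continuous_map_preimage[OF cont]) auto
    moreover have "l \<in> {l' \<in> topspace ?X. ?\<phi> l' \<in> {?\<phi> l - \<eta> <..< ?\<phi> l + \<eta>}}"
      using l(1) \<eta> by (auto simp: PiE_iff)
    ultimately have "infinite {n \<in> I. ls n \<in> {l' \<in> topspace ?X. ?\<phi> l' \<in> {?\<phi> l - \<eta> <..< ?\<phi> l + \<eta>}}}"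
      by (rule l(2))
    \<comment> \<open>Infinitely many indices are available, so one can be taken large enough to
      make \<open>\<delta> n\<close> smaller than \<eta>, half of the supposed gap.\<close>
    moreover obtain n0 :: nat where n0: "m / \<eta> < real n0" using reals_Archimedean2 by blast
    ultimately obtain n where n: "n > n0" "n \<in> I" "?\<phi> (ls n) \<in> {?\<phi> l - \<eta> <..< ?\<phi> l + \<eta>}"
      unfolding infinite_nat_iff_unbounded by blast
    have "m / \<eta> < real (Suc n)" using n0 n(1) by linarith
    then have "m < \<eta> * real (Suc n)" using \<eta> by (simp add: pos_divide_less_eq mult.commute)
    also have "\<dots> \<le> \<eta> * (10 * real (Suc n))" using \<eta> by simp
    finally have "\<delta> n < \<eta>" unfolding \<delta>_def by (simp add: pos_divide_less_eq)
    moreover have "\<bar>?\<phi> l - ?t\<bar> = 2 * \<eta>" by (simp add: \<eta>_def)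
    ultimately show False using near_eq[OF n(2) uw] n(3) unfolding greaterThanLessThan_iff by linarith
  qed
  have l0: "l \<in> extensional (K z)" "\<And>k. k \<in> K z \<Longrightarrow> 0 \<le> l k" using l(1) by (auto simp: PiE_iff)
  have "T \<in> cone_point G (Ts z) l"
    by (rule in_cone[OF vertex_approximation_refl[OF T.metric_tree_axioms m(2,1)]]) (use l0 limit in auto)
  moreover have "\<exists>k\<in>K z. l k \<noteq> 0"
  proof (rule ccontr)
    assume "\<not> (\<exists>k\<in>K z. l k \<noteq> 0)"
    then have "tdist T (vertex_point a') (vertex_point b') = 0" using limit[OF a'b'(2)] by simp
    then show False using neq FV[OF a'b'(2)] T.tdist_eq_0_iff T.vertex_point_in_points by simp
  qed
  ultimately have lP: "l \<in> closed_cone_params G D (Ts z)" "cone_point G (Ts z) l = c"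
    using params[OF _ cD c(2) l0] by auto
  obtain W where W: "openin ?X W" "\<And>l. l \<in> closed_cone_params G D (Ts z) \<Longrightarrow> cone_point G (Ts z) l \<in> U \<longleftrightarrow> l \<in> W"
    using weak_open_params[OF U seq(1,3)] unfolding K_def by metis
  \<comment> \<open>The open set \<open>W\<close> contains the parameters of \<open>T\<close>, hence
    those of some \<open>Ts n\<close>; but then the class of \<open>Ts n\<close> would belong to
    \<open>U\<close>.\<close>
  have "l \<in> W" using W(2)[OF lP(1)] lP(2) c(1) by simp
  then have "{n \<in> I. ls n \<in> W} \<noteq> {}" using l(2)[OF W(1)] by (metis finite.emptyI)
  then obtain n where n: "n \<in> I" "ls n \<in> W" by blast
  have lsn: "\<And>k. k \<in> K z \<Longrightarrow> 0 < ls n k" "ls n \<in> extensional (K z)"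
    "\<And>u w. (u, w) \<in> F \<Longrightarrow> (\<Sum>k\<in>K z. ls n k * cr z k u w) = tdist (Ts n) (fs n u) (fs n w)"
    using ls n(1) by auto
  have "Ts n \<in> cone_point G (Ts z) (ls n)"
    by (rule in_cone[OF seq(4)]) (use lsn in \<open>auto simp: less_imp_le\<close>)
  moreover have "\<exists>k\<in>K z. ls n k \<noteq> 0"
  proof -
    \<comment> \<open>Without edges all sums over \<open>K z\<close> would vanish, and with them the
      distance in \<open>T\<close> of two distinct vertices.\<close>
    have "Z.T'.E \<noteq> {}"
    proof
      assume E: "Z.T'.E = {}"
      then have "K z = {}" by (simp add: K_def edge_orbits_def orbits_def)
      then have "tdist T (vertex_point a') (vertex_point b') = 0" using limit[OF a'b'(2)] by simp
      then show False using neq FV[OF a'b'(2)] T.tdist_eq_0_iff T.vertex_point_in_points by simp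
    qed
    then obtain e where "e \<in> Z.T'.E" by blast
    then have k: "orbit G (edge_act (Ts z)) e \<in> K z" unfolding K_def by (rule Z.T'.edge_orbit_in)
    show ?thesis using lsn(1)[OF k] k by (intro bexI[OF _ k]) simp
  qed
  ultimately have "ls n \<in> closed_cone_params G D (Ts z)" "cone_point G (Ts z) (ls n) = cs n"
    using params[OF _ seq(1,3) lsn(2)] lsn(1) by (auto simp: less_imp_le)
  then show False using W(2) n(2) seq(2) by metis
qed

end

section \<open>Excluding trees without edges, and the conclusion\<close>

lemma points_edgeless:
  assumes "metric_tree G T" "edges T = {}"
  obtains v where "points T = {vertex_point v}" "\<And>g. g \<in> carrier G \<Longrightarrow> point_act G T g (vertex_point v) = vertex_point v"
proof -
  interpret metric_tree G T by (rule assms(1))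
  obtain v where v: "v \<in> V" using is_tree by (auto simp: is_tree_def)
  have "u = v" if "u \<in> V" for u
  proof -
    have "(u, v) \<in> (adj {})\<^sup>*" using connected[OF that v] assms(2) by simp
    then show ?thesis by (simp add: adj_def)
  qed
  then have V: "V = {v}" using v by blast
  then have "P = {vertex_point v}" using assms(2) by (simp add: points_def)
  moreover have "pact g (vertex_point v) = vertex_point v" if "g \<in> carrier G" for g
    using pact_vertex[OF that v] act_closed[OF that v] V by simp
  ultimately show ?thesis using that by blast
qed

text \<open>A one-point tree carries neither a hyperbolic element nor a ray. Having an edge provides
  the neighbours in \<open>near_fixed_vertex\<close> and a nonzero parameter at the limit.\<close>

lemma edges_nonempty:
  assumes T: "metric_tree G T" and "irreducible_gtree G T \<or> genuine_abelian_gtree G T"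
  shows "edges T \<noteq> {}"
proof
  assume E: "edges T = {}"
  interpret metric_tree G T by (rule T)
  obtain v where v: "P = {vertex_point v}" "\<And>g. g \<in> carrier G \<Longrightarrow> pact g (vertex_point v) = vertex_point v"
    using points_edgeless[OF T E] by metis
  from assms(2) show False
  proof
    assume "irreducible_gtree G T"
    then obtain g where "hyperbolic G T g" unfolding irreducible_gtree_def by blast
    then show False using v by (auto simp: hyperbolic_def)
  next
    assume "genuine_abelian_gtree G T"
    then obtain \<rho> where "is_ray T \<rho>" unfolding genuine_abelian_gtree_def fixes_end_def by blast
    then have \<rho>: "\<rho> ` {0..} \<subseteq> P" "\<forall>s\<in>{0..}. \<forall>t\<in>{0..}. tdist T (\<rho> s) (\<rho> t) = \<bar>s - t\<bar>"
      by (auto simp: is_ray_def isometric_on_def)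
    have "\<rho> t = vertex_point v" if "0 \<le> t" for t using \<rho>(1) v(1) that by auto
    then have "\<rho> 0 = vertex_point v" "\<rho> 1 = vertex_point v" by simp_all
    moreover have "tdist T (\<rho> 0) (\<rho> 1) = 1" using \<rho>(2) by simp
    ultimately show False using tdist_eq_0_iff[of "vertex_point v" "vertex_point v"] v(1) by simp
  qed
qed

theorem proposition5p4:
  fixes G :: "('g, 'b) monoid_scheme" and D :: "('g, 'v) gtree set set"
  assumes "group G" and "finitely_generated G (carrier G)"
    and "infinite (UNIV :: 'v set)"
    and "is_deformation_space G D \<or> is_restricted_deformation_space G D"
    and "irreducible_space G D \<or> genuine_abelian_space G D"
    and "\<forall>c\<in>D. \<forall>T\<in>c. locally_finite_gtree T \<and> fg_vertex_stabilizers G T"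
  shows "gromov_topology G D = weak_topology G D \<and>
    projectivization (gromov_topology G D) = projectivization (weak_topology G D)"
proof -
  interpret group G by (rule assms(1))
  interpret deformation_space G D by unfold_locales (rule assms(4))
  have "openin (gromov_topology G D) U" if U: "openin (weak_topology G D) U" for U
    unfolding openin_gromov_topology
  proof (intro conjI ballI)
    show UD: "U \<subseteq> D" using openin_subset[OF U] by (simp add: topspace_weak_topology)
    fix c T assume c: "c \<in> U" "T \<in> c"
    then have cD: "c \<in> D" using UD by blast
    have "irreducible_gtree G T \<or> genuine_abelian_gtree G T"
      using assms(5) cD c(2) by (auto simp: irreducible_space_def genuine_abelian_space_def)
    then have "edges T \<noteq> {}" by (rule edges_nonempty[OF class_tree[OF cD c(2)]])
    then show "\<exists>X A \<epsilon>. finite X \<and> X \<subseteq> points T \<and> finite A \<and> A \<subseteq> carrier G \<and> \<epsilon> > 0 \<and>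
        gromov_nbhd G D T X A \<epsilon> \<subseteq> U"
      using assms(6) cD c(2) by (intro weak_open_imp_gromov_nbhd[OF assms(2) _ _ _ U c]) auto
  qed
  then have "gromov_topology G D = weak_topology G D"
    using gromov_open_imp_weak_open by (auto simp: topology_eq)
  then show ?thesis by simp
qed

end
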